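(* Let $f$ be a polynomial, let $\mathcal{C}(t)$ be the evolution of an $n\times n$ CMV matrix under the Hamiltonian $\phi(\mathcal{C})=\mathrm{Im}\,\mathrm{tr}(f(\mathcal{C}))$, with Verblunsky coefficients $\alpha_j(t)$. Let $z_1,\ldots,z_n$ be the eigenvalues and $\lambda_k=2\,\mathrm{Re}[z_kf'(z_k)]$, labelled so that $\lambda_1\ge\cdots\ge\lambda_n$. Suppose all $\lambda_j$ are distinct. Then for $1\le k\le n-1$ $$\alpha_{k-1}(+\infty)\,\alpha_{n-k-1}(-\infty)=(-1)^n\bar z_1\cdots\bar z_n=(-1)^n\det(\mathcal{C}^\dagger)=-\alpha_{n-1},$$ which is independent of $t$. Furthermore, $$\xi_{k-1}\zeta_{n-k-1}=|z_{k+1}-z_k|^2\prod_{l=1}^{k-1}\left|\frac{z_{k+1}-z_l}{z_k-z_l}\right|^2\prod_{m=k+2}^{n}\left|\frac{z_k-z_m}{z_{k+1}-z_m}\right|^2 .$$ The eigenvalues $z_j$ are time independent and can be recovered from the asymptotic values of the Verblunsky coefficients as follows: $$z_j=-\frac{\alpha_{j-2}(+\infty)}{\alpha_{j-1}(+\infty)}=-\frac{\alpha_{n-j-1}(-\infty)}{\alpha_{n-j}(-\infty)},\qquad 1\le j\le n.$$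
   Context: CMV matrices: given Verblunsky coefficients $\alpha_0,\ldots,\alpha_{n-2}$ in the open unit disk and $\alpha_{n-1}$ on the unit circle, put $\rho_k=\sqrt{1-|\alpha_k|^2}$, $\Xi_k=\begin{bmatrix}\bar\alpha_k&\rho_k\\ \rho_k&-\alpha_k\end{bmatrix}$ for $0\le k\le n-2$, $\Xi_{-1}=[1]$, $\Xi_{n-1}=[\bar\alpha_{n-1}]$. The CMV matrix is $\mathcal{C}=\mathcal{L}\mathcal{M}$ with $n\times n$ block-diagonal $\mathcal{L}=\mathrm{diag}(\Xi_0,\Xi_2,\ldots)$, $\mathcal{M}=\mathrm{diag}(\Xi_{-1},\Xi_1,\Xi_3,\ldots)$. Convention: $\alpha_{-1}=-1$. The eigenvalues are distinct and the spectral measure of $(\mathcal{C}(0),e_1)$, $e_1=[1,0,\dots,0]^T$, is $\sum_k\mu_k\delta_{z_k}$ with $\mu_k>0$. Flow: let $\mathfrak{g}$ be the $n\times n$ complex matrices viewed as a real manifold; $\mathfrak{g}=\mathfrak{l}\oplus\mathfrak{a}$ with $\mathfrak{a}=\{A:A=-A^\dagger\}$ and $\mathfrak{l}$ the lower triangular matrices with real diagonal; $\pi_{\mathfrak l},\pi_{\mathfrak a}$ the projections, $R=\pi_{\mathfrak l}-\pi_{\mathfrak a}$. With $\langle X,Y\rangle=\mathrm{Im}\,\mathrm{tr}(XY)$ and $\nabla\phi$ defined by $\frac{d}{dt}|_{t=0}\phi(B+tC)=\langle\nabla\phi|_B,C\rangle$, the Poisson bracket is $\{\phi,\psi\}|_B=\tfrac12\langle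 R(XB),YB\rangle-\tfrac12\langle R(BX),BY\rangle$, $X=\nabla\phi|_B$, $Y=\nabla\psi|_B$, and the flow of $\phi$ satisfies $\dot\psi=\{\phi,\psi\}$ for all $\psi$. For $\phi=\mathrm{Im}\,\mathrm{tr} f$ this is $\dot{\mathcal{C}}=-[\mathcal{C},\pi_{\mathfrak a}(\mathcal{C}f'(\mathcal{C}))]$; it preserves CMV matrices and fixes $\alpha_{n-1}$. Asymptotic data: $\alpha_j(\pm\infty)=\lim_{t\to\pm\infty}\alpha_j(t)$, and for $1\le k\le n-1$ the numbers $\xi_{k-1},\zeta_{k-1}$ are the leading correction coefficients in $$\alpha_{k-1}(t)=\alpha_{k-1}(+\infty)\big[1+\xi_{k-1}e^{-(\lambda_k-\lambda_{k+1})t}+O(e^{-\gamma t})\big]\ (t\to+\infty),$$ $$\alpha_{k-1}(t)=\alpha_{k-1}(-\infty)\big[1+\zeta_{k-1}e^{(\lambda_{n-k}-\lambda_{n-k+1})t}+O(e^{\gamma' t})\big]\ (t\to-\infty),$$ for some $\gamma>\lambda_k-\lambda_{k+1}$, $\gamma'>\lambda_{n-k}-\lambda_{n-k+1}$; explicitly $$\xi_{k-1}=(z_k\bar z_{k+1}-1)\frac{\mu_{k+1}}{\mu_k}\prod_{l=1}^{k-1}\left|\frac{z_{k+1}-z_l}{z_k-z_l}\right|^2,\qquad \zeta_{k-1}=(z_{n-k+1}\bar z_{n-k}-1)\frac{\mu_{n-k}}{\mu_{n-k+1}}\prod_{l=n-k+2}^{n}\left|\frac{z_{n-k}-z_l}{z_{n-k+1}-z_l}\right|^2.$$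 *)

theory Defs
  imports
    "HOL-Library.Landau_Symbols"
    "Jordan_Normal_Form.Schur_Decomposition"
    "Jordan_Normal_Form.Spectral_Radius"
begin

section \<open>CMV matrices\<close>

text \<open>
  Verblunsky coefficients are indexed by integers, so that the convention
  \<open>\<alpha> (-1) = -1\<close> is literally a value of \<open>\<alpha>\<close>. Values outside \<open>{-1..n-1}\<close> are irrelevant.
\<close>

definition verblunsky :: "nat \<Rightarrow> (int \<Rightarrow> complex) \<Rightarrow> bool" where
  "verblunsky n \<alpha> \<longleftrightarrow>
     \<alpha> (-1) = -1 \<and> (\<forall>k\<in>{0..int n - 2}. cmod (\<alpha> k) < 1) \<and> cmod (\<alpha> (int n - 1)) = 1"

definition Xi :: "nat \<Rightarrow> (int \<Rightarrow> complex) \<Rightarrow> int \<Rightarrow> complex mat" where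
  "Xi n \<alpha> k =
     (if k = -1 then mat_of_rows_list 1 [[1]]
      else if k = int n - 1 then mat_of_rows_list 1 [[cnj (\<alpha> k)]]
      else let \<rho> = complex_of_real (sqrt (1 - (cmod (\<alpha> k))\<^sup>2))
           in mat_of_rows_list 2 [[cnj (\<alpha> k), \<rho>], [\<rho>, - \<alpha> k]])"

definition cmv_L :: "nat \<Rightarrow> (int \<Rightarrow> complex) \<Rightarrow> complex mat" where
  "cmv_L n \<alpha> = diag_block_mat (map (Xi n \<alpha>) (filter even [-1..int n - 1]))"

definition cmv_M :: "nat \<Rightarrow> (int \<Rightarrow> complex) \<Rightarrow> complex mat" where
  "cmv_M n \<alpha> = diag_block_mat (map (Xi n \<alpha>) (filter odd [-1..int n - 1]))"

definition cmv :: "nat \<Rightarrow> (int \<Rightarrow> complex) \<Rightarrow> complex mat" where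
  "cmv n \<alpha> = cmv_L n \<alpha> * cmv_M n \<alpha>"


section \<open>The R-matrix Poisson structure on the complex \<open>n \<times> n\<close> matrices\<close>

definition mtrace :: "'a::comm_monoid_add mat \<Rightarrow> 'a" where
  "mtrace A = (\<Sum>i<dim_row A. A $$ (i, i))"

definition poly_mat :: "complex poly \<Rightarrow> complex mat \<Rightarrow> complex mat" where
  "poly_mat f B = mat (dim_row B) (dim_row B)
     (\<lambda>(i, j). \<Sum>k\<le>degree f. coeff f k * (B ^\<^sub>m k) $$ (i, j))"

definition skew_mats :: "nat \<Rightarrow> complex mat set" where
  "skew_mats n = {A \<in> carrier_mat n n. A = - mat_adjoint A}"

definition lower_mats :: "nat \<Rightarrow> complex mat set" where
  "lower_mats n = {A \<in> carrier_mat n n.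
     (\<forall>i<n. \<forall>j<n. i < j \<longrightarrow> A $$ (i, j) = 0) \<and> (\<forall>i<n. A $$ (i, i) \<in> \<real>)}"

lemma mat_adjoint_index:
  assumes "A \<in> carrier_mat n n" "i < n" "j < n"
  shows "mat_adjoint (A :: complex mat) $$ (i, j) = cnj (A $$ (j, i))"
  using assms by (auto simp: mat_adjoint_def mat_of_rows_def)

text \<open>
  The decomposition of a matrix into its skew-adjoint and lower triangular parts exists and
  is unique, so the two projections are well defined.
\<close>

lemma decomposition_ex1:
  assumes B: "B \<in> carrier_mat n n"
  shows "\<exists>!A. A \<in> skew_mats n \<and> B - A \<in> lower_mats n"
proof (rule ex1I)
  define A where "A = mat n n (\<lambda>(i, j). if i < j then B $$ (i, j)
    else if j < i then - cnj (B $$ (j, i)) else \<i> * complex_of_real (Im (B $$ (i, i))))"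
  have A: "A \<in> carrier_mat n n" by (simp add: A_def)
  have adj: "mat_adjoint A \<in> carrier_mat n n"
    using A by (auto simp: mat_adjoint_def)
  have "A = - mat_adjoint A"
  proof (rule eq_matI)
    fix i j assume "i < dim_row (- mat_adjoint A)" "j < dim_col (- mat_adjoint A)"
    then have ij: "i < n" "j < n" using adj by auto
    then have "(- mat_adjoint A) $$ (i, j) = - cnj (A $$ (j, i))"
      using adj mat_adjoint_index[OF A ij] by auto
    with ij show "A $$ (i, j) = (- mat_adjoint A) $$ (i, j)"
      by (auto simp: A_def)
  qed (use A adj in auto)
  moreover have "B - A \<in> lower_mats n"
    using A B by (auto simp: lower_mats_def A_def complex_is_Real_iff)
  ultimately show "A \<in> skew_mats n \<and> B - A \<in> lower_mats n"
    using A by (auto simp: skew_mats_def)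
  fix A' assume A': "A' \<in> skew_mats n \<and> B - A' \<in> lower_mats n"
  then have c: "A' \<in> carrier_mat n n" and s: "A' = - mat_adjoint A'"
    by (auto simp: skew_mats_def)
  have sk: "A' $$ (i, j) = - cnj (A' $$ (j, i))" if "i < n" "j < n" for i j
  proof -
    have "A' $$ (i, j) = (- mat_adjoint A') $$ (i, j)" using s by simp
    also have "\<dots> = - (mat_adjoint A' $$ (i, j))"
      using that c by (auto simp: mat_adjoint_def)
    finally show ?thesis using mat_adjoint_index[OF c that] by simp
  qed
  have low: "A' $$ (i, j) = B $$ (i, j)" if "i < j" "j < n" for i j
    using A' B c that by (auto simp: lower_mats_def)
  have diag: "A' $$ (i, i) = \<i> * complex_of_real (Im (B $$ (i, i)))" if "i < n" for i
  proof -
    have "Re (A' $$ (i, i)) = 0" using sk[OF that that] by (auto simp: complex_eq_iff)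
    moreover have "Im (B $$ (i, i) - A' $$ (i, i)) = 0"
      using A' B c that by (auto simp: lower_mats_def complex_is_Real_iff)
    ultimately show ?thesis by (auto simp: complex_eq_iff)
  qed
  show "A' = A"
  proof (rule eq_matI)
    fix i j assume "i < dim_row A" "j < dim_col A"
    then have "i < n" "j < n" using A by auto
    then show "A' $$ (i, j) = A $$ (i, j)"
      using low[of i j] low[of j i] sk[of i j] diag[of i]
      by (cases i j rule: linorder_cases) (auto simp: A_def)
  qed (use A c in auto)
qed

definition proj_a :: "nat \<Rightarrow> complex mat \<Rightarrow> complex mat" where
  "proj_a n B = (THE A. A \<in> skew_mats n \<and> B - A \<in> lower_mats n)"

definition proj_l :: "nat \<Rightarrow> complex mat \<Rightarrow> complex mat" where
  "proj_l n B = (THE L. L \<in> lower_mats n \<and> B - L \<in> skew_mats n)"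

definition Rmat :: "nat \<Rightarrow> complex mat \<Rightarrow> complex mat" where
  "Rmat n B = proj_l n B - proj_a n B"

definition pairing :: "complex mat \<Rightarrow> complex mat \<Rightarrow> real" where
  "pairing X Y = Im (mtrace (X * Y))"

definition is_grad :: "nat \<Rightarrow> (complex mat \<Rightarrow> real) \<Rightarrow> complex mat \<Rightarrow> complex mat \<Rightarrow> bool" where
  "is_grad n \<phi> B X \<longleftrightarrow> X \<in> carrier_mat n n \<and>
     (\<forall>C\<in>carrier_mat n n.
        ((\<lambda>t. \<phi> (B + complex_of_real t \<cdot>\<^sub>m C)) has_real_derivative pairing X C) (at 0))"

text \<open>The gradient is unique if it exists, as the pairing is nondegenerate.\<close>

definition grad :: "nat \<Rightarrow> (complex mat \<Rightarrow> real) \<Rightarrow> complex mat \<Rightarrow> complex mat" where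
  "grad n \<phi> B = (THE X. is_grad n \<phi> B X)"

text \<open>
  Matrices carry no topology in the library. Entrywise closeness is used for continuity, and
  \<open>C\<^sup>k\<close> is obtained by iterating: all directional derivatives exist, are given by a gradient,
  and the real coordinates of the gradient are of class \<open>C\<^sup>k\<^sup>-\<^sup>1\<close>. By continuity of the partial
  derivatives this is the usual class \<open>C\<^sup>k\<close> on the real vector space of complex matrices.
\<close>

definition cont_mat :: "nat \<Rightarrow> (complex mat \<Rightarrow> real) \<Rightarrow> bool" where
  "cont_mat n \<psi> \<longleftrightarrow>
     (\<forall>B\<in>carrier_mat n n. \<forall>\<epsilon>>0. \<exists>\<delta>>0. \<forall>B'\<in>carrier_mat n n.
        (\<forall>i<n. \<forall>j<n. cmod (B' $$ (i, j) - B $$ (i, j)) < \<delta>) \<longrightarrow> \<bar>\<psi> B' - \<psi> B\<bar> < \<epsilon>)"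

primrec Ck_mat :: "nat \<Rightarrow> nat \<Rightarrow> (complex mat \<Rightarrow> real) \<Rightarrow> bool" where
  "Ck_mat n 0 \<psi> \<longleftrightarrow> cont_mat n \<psi>"
| "Ck_mat n (Suc k) \<psi> \<longleftrightarrow>
     (\<exists>X. (\<forall>B\<in>carrier_mat n n. is_grad n \<psi> B (X B)) \<and>
          (\<forall>i<n. \<forall>j<n. Ck_mat n k (\<lambda>B. Re (X B $$ (i, j))) \<and>
                        Ck_mat n k (\<lambda>B. Im (X B $$ (i, j)))))"

definition smooth_mat :: "nat \<Rightarrow> (complex mat \<Rightarrow> real) \<Rightarrow> bool" where
  "smooth_mat n \<psi> \<longleftrightarrow> (\<forall>k. Ck_mat n k \<psi>)"

definition poisson ::
  "nat \<Rightarrow> (complex mat \<Rightarrow> real) \<Rightarrow> (complex mat \<Rightarrow> real) \<Rightarrow> complex mat \<Rightarrow> real" where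
  "poisson n \<phi> \<psi> B =
     (let X = grad n \<phi> B; Y = grad n \<psi> B
      in 1 / 2 * pairing (Rmat n (X * B)) (Y * B) - 1 / 2 * pairing (Rmat n (B * X)) (B * Y))"

definition hamiltonian_flow ::
  "nat \<Rightarrow> (complex mat \<Rightarrow> real) \<Rightarrow> (real \<Rightarrow> complex mat) \<Rightarrow> bool" where
  "hamiltonian_flow n \<phi> C \<longleftrightarrow>
     (\<forall>t. C t \<in> carrier_mat n n) \<and>
     (\<forall>\<psi>. smooth_mat n \<psi> \<longrightarrow>
        (\<forall>t. ((\<lambda>s. \<psi> (C s)) has_real_derivative poisson n \<phi> \<psi> (C t)) (at t)))"

definition im_tr :: "complex poly \<Rightarrow> complex mat \<Rightarrow> real" where
  "im_tr f B = Im (mtrace (poly_mat f B))"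


section \<open>Asymptotic data\<close>

definition rate :: "complex poly \<Rightarrow> complex \<Rightarrow> real" where
  "rate f z = 2 * Re (z * poly (pderiv f) z)"

text \<open>
  \<open>\<alpha>p j\<close> and \<open>\<alpha>m j\<close> are the limits of \<open>\<alpha> t j\<close> as \<open>t\<close> tends to plus and minus infinity;
  \<open>\<xi>\<close> and \<open>\<zeta>\<close> are the coefficients of the leading corrections.
\<close>

definition asymptotic_data ::
  "nat \<Rightarrow> (real \<Rightarrow> int \<Rightarrow> complex) \<Rightarrow> (nat \<Rightarrow> real) \<Rightarrow>
   (int \<Rightarrow> complex) \<Rightarrow> (int \<Rightarrow> complex) \<Rightarrow> (nat \<Rightarrow> complex) \<Rightarrow> (nat \<Rightarrow> complex) \<Rightarrow> bool" where
  "asymptotic_data n \<alpha> l \<alpha>p \<alpha>m \<xi> \<zeta> \<longleftrightarrow>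
     (\<forall>j\<in>{-1..int n - 1}.
        ((\<lambda>t. \<alpha> t j) \<longlongrightarrow> \<alpha>p j) at_top \<and> ((\<lambda>t. \<alpha> t j) \<longlongrightarrow> \<alpha>m j) at_bot) \<and>
     (\<forall>k\<in>{1..<n}. \<exists>\<gamma> > l k - l (k + 1). \<exists>r.
        r \<in> O[at_top](\<lambda>t. complex_of_real (exp (- \<gamma> * t))) \<and>
        (\<forall>t. \<alpha> t (int k - 1) = \<alpha>p (int k - 1) *
           (1 + \<xi> (k - 1) * complex_of_real (exp (- (l k - l (k + 1)) * t)) + r t))) \<and>
     (\<forall>k\<in>{1..<n}. \<exists>\<gamma> > l (n - k) - l (n - k + 1). \<exists>r.
        r \<in> O[at_bot](\<lambda>t. complex_of_real (exp (\<gamma> * t))) \<and>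
        (\<forall>t. \<alpha> t (int k - 1) = \<alpha>m (int k - 1) *
           (1 + \<zeta> (k - 1) * complex_of_real (exp ((l (n - k) - l (n - k + 1)) * t)) + r t)))"

end

(*
  The gradient of Im tr f is f', so the flow has the Lax form C' = [A, C] with A skew-adjoint.
  It therefore preserves the Frobenius norm of p(C) for every polynomial p; as the
  characteristic polynomial annihilates C(0), it annihilates every C(t). Since C f'(C) - A is
  lower triangular with real diagonal, the diagonal entry mu_j of the j-th spectral projection
  at e_1 satisfies mu_j' = (lambda_j - s) mu_j with a common s, so that mu_j(t) is proportional
  to exp(lambda_j t) mu_j(0).

  Factorising C = L M turns the columns of the alternating products 1, L, LM, LML, ... into the
  Szego recursion. Its polynomials Phi_k are thus the monic orthogonal polynomials of the
  spectral measure, and they have the explicit form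
    Phi_k(x) = (SUM I. w_I * (PROD i:I. x - z_i)) / (SUM I. w_I),
    w_I = (PROD i:I. mu_i) * (PROD i<j in I. |z_i - z_j|^2),
  I ranging over the k-element sets of indices: orthogonality amounts to the vanishing of
  divided differences of order k of polynomials of degree less than k. At x = 0 this expresses
  alpha_{k-1}(t) as a ratio of exponential sums. Its dominant term as t tends to +infinity is
  I = {1..k}, its next one I = {1..k-1, k+1}; the reflection j -> n + 1 - j together with
  t -> -t reduces -infinity to +infinity.
*)
theory Submission
  imports Defs
begin

text \<open>The Lax equation fixes the spectrum once C(t) is conjugated by a unitary propagator;
  conservation of the Frobenius norm takes the place of that conjugation, because it propagates the
  equation p(C) = 0 in time. Once a polynomial with simple roots z_j annihilates every C(t), the
  spectral projections are Lagrange polynomials in C(t) at nodes that do not move, so they satisfy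
  the Lax equation themselves and can be differentiated. The skew part A is known only through the
  splitting, but its first row and first column are explicit, and the corner entry of a commutator
  involves nothing else. The common rate s need not be integrated: it contributes a factor c^k to
  w_I for every k-set I, which cancels in the ratio for \<alpha>_{k-1}. Cyclicity of e_1 (a
  polynomial in C that kills e_1 is zero) enters twice: it turns Phi_n(C) e_1 = 0 into the
  annihilation at time 0, and it makes the mu_j positive. The statement quantifies over all limits
  and correction coefficients that fit the expansions, so uniqueness of the expansions is needed
  besides their existence.\<close>

section \<open>Entrywise algebra of square matrices: products, adjoints, traces\<close>

lemma mat_adjoint_carrier [simp]:
  "A \<in> carrier_mat n n \<Longrightarrow> mat_adjoint (A :: complex mat) \<in> carrier_mat n n"
  by (auto simp: mat_adjoint_def)

lemma sq_mult_carrier [simp]: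
  "A \<in> carrier_mat n n \<Longrightarrow> B \<in> carrier_mat n n \<Longrightarrow> A * B \<in> carrier_mat n n"
  by simp

lemma sq_add_index:
  "A \<in> carrier_mat n n \<Longrightarrow> B \<in> carrier_mat n n \<Longrightarrow> i < n \<Longrightarrow> j < n \<Longrightarrow>
    (A + B) $$ (i, j) = A $$ (i, j) + B $$ (i, j)"
  by auto

lemma sq_minus_index:
  "A \<in> carrier_mat n n \<Longrightarrow> B \<in> carrier_mat n n \<Longrightarrow> i < n \<Longrightarrow> j < n \<Longrightarrow>
    (A - B) $$ (i, j) = A $$ (i, j) - B $$ (i, j)"
  by auto

lemma sq_smult_index:
  "A \<in> carrier_mat n n \<Longrightarrow> i < n \<Longrightarrow> j < n \<Longrightarrow> (c \<cdot>\<^sub>m A) $$ (i, j) = c * A $$ (i, j)"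
  by auto

lemma sq_eqI:
  "A \<in> carrier_mat n n \<Longrightarrow> B \<in> carrier_mat n n \<Longrightarrow>
    (\<And>i j. i < n \<Longrightarrow> j < n \<Longrightarrow> A $$ (i, j) = B $$ (i, j)) \<Longrightarrow> A = B"
  by (rule eq_matI) auto

lemma sq_telescope:
  fixes X :: "'a :: ab_group_add mat"
  assumes "X \<in> carrier_mat n n" "Y \<in> carrier_mat n n" "Z \<in> carrier_mat n n"
  shows "(X - Y) + (Y - Z) = X - Z"
  using assms by (intro sq_eqI[of _ n])
    (auto simp: sq_add_index[of _ n] sq_minus_index[of _ n] intro!: minus_carrier_mat)

text \<open>The commutator with \<open>A\<close> is a derivation. Combined with the product rule,
  this makes solutions of a Lax equation with the same \<open>A\<close> closed under
  multiplication.\<close>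

lemma sq_commutator_mult:
  fixes A :: "complex mat"
  assumes [simp]: "A \<in> carrier_mat n n" "B \<in> carrier_mat n n" "P \<in> carrier_mat n n"
  shows "(A * B - B * A) * P + B * (A * P - P * A) = A * (B * P) - (B * P) * A"
proof -
  have 1: "(A * B - B * A) * P = A * (B * P) - B * (A * P)"
    by (simp add: minus_mult_distrib_mat[of _ n n _ _ n] assoc_mult_mat[of _ n n _ n _ n])
  have 2: "B * (A * P - P * A) = B * (A * P) - (B * P) * A"
    by (simp add: mult_minus_distrib_mat[of _ n n _ n] assoc_mult_mat[of _ n n _ n _ n])
  show ?thesis unfolding 1 2 by (rule sq_telescope[of _ n]) simp_all
qed

lemma mult_mat_index_sum:
  assumes "A \<in> carrier_mat n n" "B \<in> carrier_mat n n" "i < n" "j < n"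
  shows "(A * B) $$ (i, j) = (\<Sum>k<n. A $$ (i, k) * B $$ (k, j))"
  using assms by (auto simp: scalar_prod_def lessThan_atLeast0)

lemma mat_adjoint_mult:
  assumes A: "(A :: complex mat) \<in> carrier_mat n n" and B: "B \<in> carrier_mat n n"
  shows "mat_adjoint (A * B) = mat_adjoint B * mat_adjoint A"
proof (rule eq_matI)
  fix i j assume "i < dim_row (mat_adjoint B * mat_adjoint A)"
    "j < dim_col (mat_adjoint B * mat_adjoint A)"
  with A B have ij: "i < n" "j < n"
    by (auto simp: mat_adjoint_def)
  have AB: "A * B \<in> carrier_mat n n"
    using A B by simp
  show "mat_adjoint (A * B) $$ (i, j) = (mat_adjoint B * mat_adjoint A) $$ (i, j)"
    using ij A B AB
    by (simp add: mat_adjoint_index[OF AB] mult_mat_index_sum[of _ n] mat_adjoint_index[of _ n]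
        mult.commute del: index_mult_mat)
qed (use A B in \<open>auto simp: mat_adjoint_def\<close>)

lemma mat_adjoint_adjoint:
  assumes A: "(A :: complex mat) \<in> carrier_mat n n"
  shows "mat_adjoint (mat_adjoint A) = A"
proof (rule eq_matI)
  fix i j assume "i < dim_row A" "j < dim_col A"
  with A have "i < n" "j < n" by auto
  with A show "mat_adjoint (mat_adjoint A) $$ (i, j) = A $$ (i, j)"
    by (simp add: mat_adjoint_index[of _ n])
qed (use A in \<open>auto simp: mat_adjoint_def\<close>)

lemma mat_adjoint_one: "mat_adjoint (1\<^sub>m n :: complex mat) = 1\<^sub>m n"
  by (rule eq_matI) (auto simp: mat_adjoint_index[of _ n] mat_adjoint_def mat_of_rows_def)

lemma mtrace_carrier: "A \<in> carrier_mat n n \<Longrightarrow> mtrace A = (\<Sum>i<n. A $$ (i, i))"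
  by (simp add: mtrace_def)

lemma mtrace_mult_commute:
  assumes "(A :: complex mat) \<in> carrier_mat n n" "B \<in> carrier_mat n n"
  shows "mtrace (A * B) = mtrace (B * A)"
proof -
  have "mtrace (A * B) = (\<Sum>i<n. \<Sum>k<n. A $$ (i, k) * B $$ (k, i))"
    using assms by (simp add: mtrace_carrier[of _ n] mult_mat_index_sum[of _ n] del: index_mult_mat)
  also have "\<dots> = (\<Sum>k<n. \<Sum>i<n. B $$ (k, i) * A $$ (i, k))"
    by (subst sum.swap) (simp add: mult.commute)
  also have "\<dots> = mtrace (B * A)"
    using assms by (simp add: mtrace_carrier[of _ n] mult_mat_index_sum[of _ n] del: index_mult_mat)
  finally show ?thesis .
qed

lemma mtrace_add:
  assumes "(A :: complex mat) \<in> carrier_mat n n" "B \<in> carrier_mat n n"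
  shows "mtrace (A + B) = mtrace A + mtrace B"
  using assms by (simp add: mtrace_carrier[of _ n] sum.distrib)

lemma mtrace_adjoint_mult_self:
  assumes A: "(A :: complex mat) \<in> carrier_mat n n"
  shows "mtrace (mat_adjoint A * A) = complex_of_real (\<Sum>i<n. \<Sum>k<n. (cmod (A $$ (k, i)))\<^sup>2)"
proof -
  have "mtrace (mat_adjoint A * A) = (\<Sum>i<n. \<Sum>k<n. cnj (A $$ (k, i)) * A $$ (k, i))"
    using A by (simp add: mtrace_carrier[of _ n] mult_mat_index_sum[of _ n]
        mat_adjoint_index[of _ n] del: index_mult_mat)
  also have "\<dots> = complex_of_real (\<Sum>i<n. \<Sum>k<n. (cmod (A $$ (k, i)))\<^sup>2)"
    by (simp add: complex_norm_square mult.commute del: of_real_power)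
  finally show ?thesis .
qed

text \<open>The trace is the squared Frobenius norm, a sum of squares of moduli; so the quantity
  conserved by a Lax flow detects the zero matrix.\<close>

lemma mtrace_adjoint_mult_self_eq_0:
  assumes A: "(A :: complex mat) \<in> carrier_mat n n" and "mtrace (mat_adjoint A * A) = 0"
  shows "A = 0\<^sub>m n n"
proof -
  have "(\<Sum>i<n. \<Sum>k<n. (cmod (A $$ (k, i)))\<^sup>2) = 0"
    using assms unfolding mtrace_adjoint_mult_self[OF A] of_real_eq_0_iff by simp
  then have "\<forall>i<n. \<forall>k<n. A $$ (k, i) = 0"
    by (simp add: sum_nonneg_eq_0_iff sum_nonneg)
  with A show ?thesis by (auto intro!: eq_matI)
qed

subsection \<open>Polynomials of matrices\<close>

lemma poly_mat_carrier [simp]: "B \<in> carrier_mat n n \<Longrightarrow> poly_mat p B \<in> carrier_mat n n"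
  by (simp add: poly_mat_def)

text \<open>Coefficients beyond the degree vanish, so any bound \<open>N\<close> may replace the
  degree; polynomials of different degrees can then be added over one range.\<close>

lemma poly_mat_index:
  assumes "B \<in> carrier_mat n n" "degree p \<le> N" "i < n" "j < n"
  shows "poly_mat p B $$ (i, j) = (\<Sum>k\<le>N. coeff p k * (B ^\<^sub>m k) $$ (i, j))"
proof -
  have "poly_mat p B $$ (i, j) = (\<Sum>k\<le>degree p. coeff p k * (B ^\<^sub>m k) $$ (i, j))"
    using assms by (simp add: poly_mat_def)
  also have "\<dots> = (\<Sum>k\<le>N. coeff p k * (B ^\<^sub>m k) $$ (i, j))"
    using assms by (intro sum.mono_neutral_left) (auto simp: coeff_eq_0)
  finally show ?thesis .
qed

lemma pow_mat_Suc_left: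
  assumes B: "(B :: complex mat) \<in> carrier_mat n n"
  shows "B ^\<^sub>m Suc k = B * B ^\<^sub>m k"
proof (induction k)
  case (Suc k)
  have "B ^\<^sub>m Suc (Suc k) = (B * B ^\<^sub>m k) * B" using Suc by simp
  also have "\<dots> = B * (B ^\<^sub>m k * B)" using B by (intro assoc_mult_mat) auto
  finally show ?case by simp
qed (use B in simp)

text \<open>The Horner step. It turns statements about matrix polynomials into inductions over
  \<open>pCons\<close>.\<close>

lemma poly_mat_pCons:
  assumes B: "B \<in> carrier_mat n n"
  shows "poly_mat (pCons a p) B = a \<cdot>\<^sub>m 1\<^sub>m n + B * poly_mat p B"
proof (rule eq_matI)
  fix i j assume "i < dim_row (a \<cdot>\<^sub>m 1\<^sub>m n + B * poly_mat p B)"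
    "j < dim_col (a \<cdot>\<^sub>m 1\<^sub>m n + B * poly_mat p B)"
  with B have ij: "i < n" "j < n" by (auto simp: poly_mat_def)
  have d: "degree (pCons a p) \<le> Suc (degree p)" by (rule degree_pCons_le)
  have "poly_mat (pCons a p) B $$ (i, j) =
      a * (1\<^sub>m n) $$ (i, j) + (\<Sum>k\<le>degree p. coeff p k * (B ^\<^sub>m Suc k) $$ (i, j))"
    using B by (subst poly_mat_index[OF B d ij], subst sum.atMost_Suc_shift) simp
  also have "(\<Sum>k\<le>degree p. coeff p k * (B ^\<^sub>m Suc k) $$ (i, j)) =
      (\<Sum>k\<le>degree p. \<Sum>l<n. coeff p k * (B $$ (i, l) * (B ^\<^sub>m k) $$ (l, j)))"
    using B ij by (simp only: pow_mat_Suc_left[OF B] mult_mat_index_sum[OF B pow_carrier_mat[OF B] ij]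
        sum_distrib_left)
  also have "\<dots> = (\<Sum>l<n. B $$ (i, l) * poly_mat p B $$ (l, j))"
    using ij by (subst sum.swap) (simp add: poly_mat_index[OF B order_refl] sum_distrib_left algebra_simps)
  also have "\<dots> = (B * poly_mat p B) $$ (i, j)"
    using B ij by (simp add: mult_mat_index_sum[of _ n] del: index_mult_mat)
  finally show "poly_mat (pCons a p) B $$ (i, j) = (a \<cdot>\<^sub>m 1\<^sub>m n + B * poly_mat p B) $$ (i, j)"
    using ij B by (subst sq_add_index[of _ n]) (auto simp del: index_mult_mat(1))
qed (use B in \<open>auto simp: poly_mat_def\<close>)

lemma poly_mat_pCons_0:
  assumes B: "B \<in> carrier_mat n n"
  shows "poly_mat (pCons 0 p) B = B * poly_mat p B"
  unfolding poly_mat_pCons[OF B] using B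
  by (intro sq_eqI[of _ n]) (auto simp: sq_add_index[of _ n] simp del: index_mult_mat(1))

lemma poly_mat_0: "B \<in> carrier_mat n n \<Longrightarrow> poly_mat 0 B = 0\<^sub>m n n"
  by (auto intro!: eq_matI simp: poly_mat_def)

lemma poly_mat_1: "B \<in> carrier_mat n n \<Longrightarrow> poly_mat 1 B = 1\<^sub>m n"
  by (auto intro!: eq_matI simp: poly_mat_def)

lemma poly_mat_add:
  assumes B: "B \<in> carrier_mat n n"
  shows "poly_mat (p + q) B = poly_mat p B + poly_mat q B"
proof (rule eq_matI)
  fix i j assume "i < dim_row (poly_mat p B + poly_mat q B)" "j < dim_col (poly_mat p B + poly_mat q B)"
  with B have ij: "i < n" "j < n" by (auto simp: poly_mat_def)
  define N where "N = max (degree p) (degree q)"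
  have "degree p \<le> N" "degree q \<le> N" "degree (p + q) \<le> N"
    by (auto simp: N_def intro: degree_add_le)
  with B ij show "poly_mat (p + q) B $$ (i, j) = (poly_mat p B + poly_mat q B) $$ (i, j)"
    by (simp add: poly_mat_index[of _ n _ N] sq_add_index[of _ n] sum.distrib distrib_right)
qed (use B in \<open>auto simp: poly_mat_def\<close>)

lemma poly_mat_smult:
  assumes B: "B \<in> carrier_mat n n"
  shows "poly_mat (Polynomial.smult c p) B = c \<cdot>\<^sub>m poly_mat p B"
proof (rule eq_matI)
  fix i j assume "i < dim_row (c \<cdot>\<^sub>m poly_mat p B)" "j < dim_col (c \<cdot>\<^sub>m poly_mat p B)"
  with B have ij: "i < n" "j < n" by (auto simp: poly_mat_def)
  have "degree (Polynomial.smult c p) \<le> degree p" by simp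
  with B ij show "poly_mat (Polynomial.smult c p) B $$ (i, j) = (c \<cdot>\<^sub>m poly_mat p B) $$ (i, j)"
    by (simp add: poly_mat_index[of _ n _ "degree p"] sq_smult_index[of _ n] sum_distrib_left mult.assoc)
qed (use B in \<open>auto simp: poly_mat_def\<close>)

lemma poly_mat_diff:
  assumes B: "B \<in> carrier_mat n n"
  shows "poly_mat (p - q) B = poly_mat p B - poly_mat q B"
proof -
  have "p - q = p + Polynomial.smult (-1) q" by simp
  then show ?thesis
    using B by (simp only: poly_mat_add[OF B] poly_mat_smult[OF B]) (auto intro!: eq_matI simp: poly_mat_def)
qed

lemma poly_mat_sum_index:
  assumes B: "B \<in> carrier_mat n n" and "i < n" "j < n"
  shows "poly_mat (\<Sum>k\<in>K. p k) B $$ (i, j) = (\<Sum>k\<in>K. poly_mat (p k) B $$ (i, j))"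
proof (induction K rule: infinite_finite_induct)
  case (insert x F)
  then show ?case using assms by (simp add: poly_mat_add[OF B] sq_add_index[of _ n])
qed (use assms in \<open>simp_all add: poly_mat_0[OF B]\<close>)

lemma poly_mat_mult:
  assumes B: "B \<in> carrier_mat n n"
  shows "poly_mat (p * q) B = poly_mat p B * poly_mat q B"
proof (induction p)
  case 0
  then show ?case using B left_mult_zero_mat[of "poly_mat q B" n n n] by (simp add: poly_mat_0[OF B])
next
  case (pCons a p)
  have c: "poly_mat p B \<in> carrier_mat n n" "poly_mat q B \<in> carrier_mat n n" using B by auto
  have "poly_mat (pCons a p * q) B = a \<cdot>\<^sub>m poly_mat q B + (0 \<cdot>\<^sub>m 1\<^sub>m n + B * (poly_mat p B * poly_mat q B))"
    using pCons B by (simp add: poly_mat_add[OF B] poly_mat_smult[OF B] poly_mat_pCons[OF B])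
  also have "0 \<cdot>\<^sub>m 1\<^sub>m n + B * (poly_mat p B * poly_mat q B) = (B * poly_mat p B) * poly_mat q B"
    unfolding assoc_mult_mat[OF B c]
    using B c by (intro sq_eqI[of _ n]) (auto simp: sq_add_index[of _ n] sq_smult_index[of _ n] simp del: index_mult_mat(1))
  also have "a \<cdot>\<^sub>m poly_mat q B = (a \<cdot>\<^sub>m 1\<^sub>m n) * poly_mat q B"
    using c by auto
  also have "(a \<cdot>\<^sub>m 1\<^sub>m n) * poly_mat q B + (B * poly_mat p B) * poly_mat q B =
      (a \<cdot>\<^sub>m 1\<^sub>m n + B * poly_mat p B) * poly_mat q B"
    using B c by (intro add_mult_distrib_mat[symmetric, of _ n n _ _ n]) auto
  finally show ?case by (simp only: poly_mat_pCons[OF B])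
qed

lemma poly_mat_X:
  assumes B: "B \<in> carrier_mat n n"
  shows "poly_mat [:0, 1:] B = B"
  using B by (auto simp: poly_mat_pCons[OF B] poly_mat_0[OF B] intro!: eq_matI)

lemma poly_mat_commute:
  assumes B: "B \<in> carrier_mat n n"
  shows "poly_mat p B * poly_mat q B = poly_mat q B * poly_mat p B"
  by (simp add: poly_mat_mult[OF B, symmetric] mult.commute)

lemma commute_poly_mat:
  assumes B: "B \<in> carrier_mat n n" and W: "W \<in> carrier_mat n n" and WB: "W * B = B * W"
  shows "W * poly_mat p B = poly_mat p B * W"
proof (induction p)
  case (pCons a p)
  have c: "poly_mat p B \<in> carrier_mat n n" using B by auto
  have "W * poly_mat (pCons a p) B = W * (a \<cdot>\<^sub>m 1\<^sub>m n) + W * (B * poly_mat p B)"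
    using B W c by (simp add: poly_mat_pCons[OF B] mult_add_distrib_mat[of _ n n _ n])
  also have "W * (B * poly_mat p B) = B * (W * poly_mat p B)"
    unfolding assoc_mult_mat[OF W B c, symmetric] assoc_mult_mat[OF B W c, symmetric] WB ..
  also have "\<dots> = (B * poly_mat p B) * W"
    unfolding pCons assoc_mult_mat[OF B c W] ..
  also have "W * (a \<cdot>\<^sub>m 1\<^sub>m n) = (a \<cdot>\<^sub>m 1\<^sub>m n) * W"
    using W by auto
  also have "(a \<cdot>\<^sub>m 1\<^sub>m n) * W + (B * poly_mat p B) * W = poly_mat (pCons a p) B * W"
    using B W c by (simp add: poly_mat_pCons[OF B] add_mult_distrib_mat[of _ n n _ _ n])
  finally show ?case .
qed (use B W in \<open>simp add: poly_mat_0\<close>)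

section \<open>Annihilating products of distinct linear factors\<close>

lemma prod_linear_factors_dvd:
  fixes z :: "'a \<Rightarrow> 'b :: field"
  assumes "finite J" "inj_on z J" "\<And>j. j \<in> J \<Longrightarrow> poly q (z j) = 0"
  shows "(\<Prod>j\<in>J. [:- z j, 1:]) dvd q"
  using assms
proof (induction J)
  case (insert a J)
  then obtain r where r: "q = (\<Prod>j\<in>J. [:- z j, 1:]) * r"
    by (auto simp: dvd_def)
  have "poly (\<Prod>j\<in>J. [:- z j, 1:]) (z a) \<noteq> 0"
    using insert by (auto simp: poly_prod)
  moreover have "poly q (z a) = 0" using insert by simp
  ultimately have "poly r (z a) = 0" using r by simp
  then have "[:- z a, 1:] dvd r" by (simp add: poly_eq_0_iff_dvd)
  then have "[:- z a, 1:] * (\<Prod>j\<in>J. [:- z j, 1:]) dvd r * (\<Prod>j\<in>J. [:- z j, 1:])"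
    by (rule mult_dvd_mono) simp
  then show ?case unfolding r prod.insert[OF insert(1,2)] by (simp only: mult.commute)
qed simp

text \<open>The nodes are distinct, so \<open>p - q\<close> is a multiple of the annihilating
  product. A polynomial in \<open>B\<close> thus depends only on its values at the nodes, which is
  the entire functional calculus used below.\<close>

lemma poly_mat_cong:
  assumes B: "B \<in> carrier_mat n n" and J: "finite J" "inj_on z J"
    and ann: "poly_mat (\<Prod>j\<in>J. [:- z j, 1:]) B = 0\<^sub>m n n"
    and eq: "\<And>j. j \<in> J \<Longrightarrow> poly p (z j) = poly q (z j)"
  shows "poly_mat p B = poly_mat q B"
proof -
  have "(\<Prod>j\<in>J. [:- z j, 1:]) dvd p - q"
    using J eq by (intro prod_linear_factors_dvd) auto
  then obtain r where "p - q = (\<Prod>j\<in>J. [:- z j, 1:]) * r" by (auto simp: dvd_def)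
  then have "poly_mat (p - q) B = 0\<^sub>m n n"
    using B left_mult_zero_mat[of "poly_mat r B" n n n] by (simp add: poly_mat_mult[OF B] ann)
  then have e: "poly_mat p B - poly_mat q B = 0\<^sub>m n n" by (simp add: poly_mat_diff[OF B])
  show ?thesis
  proof (rule eq_matI)
    fix i j assume "i < dim_row (poly_mat q B)" "j < dim_col (poly_mat q B)"
    then have "i < n" "j < n" using B by (auto simp: poly_mat_def)
    then show "poly_mat p B $$ (i, j) = poly_mat q B $$ (i, j)"
      using arg_cong[OF e, of "\<lambda>M. M $$ (i, j)"] B by (auto simp: poly_mat_def)
  qed (auto simp: poly_mat_def)
qed

subsection \<open>Derivatives of matrix-valued functions\<close>

text \<open>Taken entrywise, so that the rules for complex-valued functions of a real variable apply
  to each entry.\<close>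

definition has_mat_deriv :: "nat \<Rightarrow> (real \<Rightarrow> complex mat) \<Rightarrow> complex mat \<Rightarrow> real \<Rightarrow> bool" where
  "has_mat_deriv n F F' t \<longleftrightarrow>
     (\<forall>i<n. \<forall>j<n. ((\<lambda>s. F s $$ (i, j)) has_vector_derivative F' $$ (i, j)) (at t))"

lemma has_mat_deriv_mult:
  assumes F: "\<And>s. F s \<in> carrier_mat n n" "F' \<in> carrier_mat n n" "has_mat_deriv n F F' t"
    and G: "\<And>s. G s \<in> carrier_mat n n" "G' \<in> carrier_mat n n" "has_mat_deriv n G G' t"
  shows "has_mat_deriv n (\<lambda>s. F s * G s) (F' * G t + F t * G') t"
  unfolding has_mat_deriv_def
proof (intro allI impI)
  fix i j assume ij: "i < n" "j < n"
  have "((\<lambda>s. \<Sum>k<n. F s $$ (i, k) * G s $$ (k, j)) has_vector_derivative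
      (\<Sum>k<n. F t $$ (i, k) * G' $$ (k, j) + F' $$ (i, k) * G t $$ (k, j))) (at t)"
    using F(3) G(3) ij unfolding has_mat_deriv_def
    by (intro has_vector_derivative_sum has_vector_derivative_mult) auto
  moreover have "(\<Sum>k<n. F t $$ (i, k) * G' $$ (k, j) + F' $$ (i, k) * G t $$ (k, j)) =
      (F' * G t + F t * G') $$ (i, j)"
    using ij mult_mat_index_sum[OF F(2) G(1)[of t] ij] mult_mat_index_sum[OF F(1)[of t] G(2) ij]
      carrier_matD[OF F(1)[of t]] carrier_matD[OF G(2)]
    by (simp add: sum.distrib del: index_mult_mat(1))
  ultimately show "((\<lambda>s. (F s * G s) $$ (i, j)) has_vector_derivative (F' * G t + F t * G') $$ (i, j)) (at t)"
    by (simp add: mult_mat_index_sum[OF F(1) G(1) ij] del: index_mult_mat(1))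
qed

lemma has_mat_deriv_adjoint:
  assumes F: "\<And>s. F s \<in> carrier_mat n n" "F' \<in> carrier_mat n n" "has_mat_deriv n F F' t"
  shows "has_mat_deriv n (\<lambda>s. mat_adjoint (F s)) (mat_adjoint F') t"
  using F unfolding has_mat_deriv_def
  by (auto simp: mat_adjoint_index[of _ n] intro!: has_vector_derivative_cnj)

lemma has_mat_deriv_poly_mat_pCons:
  assumes C: "\<And>s. C s \<in> carrier_mat n n"
    and d: "has_mat_deriv n (\<lambda>s. C s * poly_mat p (C s)) D t"
  shows "has_mat_deriv n (\<lambda>s. poly_mat (pCons a p) (C s)) D t"
  unfolding has_mat_deriv_def
proof (intro allI impI)
  fix i j assume ij: "i < n" "j < n"
  have "((\<lambda>s. a * 1\<^sub>m n $$ (i, j) + (C s * poly_mat p (C s)) $$ (i, j)) has_vector_derivative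
      0 + D $$ (i, j)) (at t)"
    using d ij unfolding has_mat_deriv_def by (intro has_vector_derivative_add) auto
  moreover have "poly_mat (pCons a p) (C s) $$ (i, j) =
      a * 1\<^sub>m n $$ (i, j) + (C s * poly_mat p (C s)) $$ (i, j)" for s
    using ij C[of s] by (simp add: poly_mat_pCons[OF C] sq_add_index[of _ n] del: index_mult_mat(1))
  ultimately show "((\<lambda>s. poly_mat (pCons a p) (C s) $$ (i, j)) has_vector_derivative D $$ (i, j)) (at t)"
    by simp
qed

text \<open>\<open>A\<close> is a fixed matrix here, since only the derivative at the single time
  \<open>t\<close> is asserted. In the induction the scalar part of \<open>pCons a p\<close>
  commutes with \<open>A\<close>, and the remaining product is covered by the derivation
  property.\<close>

lemma has_mat_deriv_poly_commutator:
  assumes C: "\<And>s. C s \<in> carrier_mat n n" and A: "A \<in> carrier_mat n n"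
    and d: "has_mat_deriv n C (A * C t - C t * A) t"
  shows "has_mat_deriv n (\<lambda>s. poly_mat p (C s)) (A * poly_mat p (C t) - poly_mat p (C t) * A) t"
proof (induction p)
  case 0
  show ?case using A by (auto simp: poly_mat_0[OF C] has_mat_deriv_def)
next
  case (pCons a p)
  define P where "P = poly_mat p (C t)"
  define B where "B = C t"
  have c [simp]: "P \<in> carrier_mat n n" "B \<in> carrier_mat n n" "A \<in> carrier_mat n n"
    using C A by (auto simp: P_def B_def)
  have "has_mat_deriv n (\<lambda>s. C s * poly_mat p (C s)) ((A * B - B * A) * P + B * (A * P - P * A)) t"
    unfolding P_def B_def
    by (rule has_mat_deriv_mult[OF C _ d _ _ pCons.IH]) (auto intro!: minus_carrier_mat simp: C A)
  moreover have "A * (a \<cdot>\<^sub>m 1\<^sub>m n + B * P) - (a \<cdot>\<^sub>m 1\<^sub>m n + B * P) * A = A * (B * P) - (B * P) * A"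
  proof -
    have 1: "A * (a \<cdot>\<^sub>m 1\<^sub>m n + B * P) = a \<cdot>\<^sub>m A + A * (B * P)"
      by (subst mult_add_distrib_mat[of _ n n _ n]) (auto simp: mult_smult_distrib[of _ n n _ n] right_mult_one_mat[of _ n n])
    have 2: "(a \<cdot>\<^sub>m 1\<^sub>m n + B * P) * A = a \<cdot>\<^sub>m A + (B * P) * A"
      by (subst add_mult_distrib_mat[of _ n n _ _ n]) (auto simp: mult_smult_assoc_mat[of _ n n _ n] left_mult_one_mat[of _ n n])
    show ?thesis unfolding 1 2 by (intro sq_eqI[of _ n])
      (auto simp: sq_add_index[of _ n] sq_minus_index[of _ n] intro!: minus_carrier_mat simp del: index_mult_mat(1))
  qed
  ultimately have h: "has_mat_deriv n (\<lambda>s. C s * poly_mat p (C s))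
      (A * poly_mat (pCons a p) B - poly_mat (pCons a p) B * A) t"
    using sq_commutator_mult[OF c(3,2,1)] poly_mat_pCons[OF c(2), of a p] by (simp add: P_def B_def)
  show ?case using has_mat_deriv_poly_mat_pCons[OF C h] unfolding B_def .
qed

text \<open>
  As \<open>A\<close> is skew-adjoint, the adjoint of \<open>F\<close>, and hence \<open>F\<^sup>\<dagger> F\<close>, satisfies the same Lax equation,
  so the trace of \<open>F\<^sup>\<dagger> F\<close> is constant.
\<close>

lemma lax_skew_preserves_zero:
  assumes F: "\<And>s. F s \<in> carrier_mat n n" and A: "\<And>s. A s \<in> skew_mats n"
    and d: "\<And>t. has_mat_deriv n F (A t * F t - F t * A t) t" and F0: "F 0 = 0\<^sub>m n n"
  shows "F t = 0\<^sub>m n n"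
proof -
  define G where "G s = mat_adjoint (F s)" for s
  have Ac [simp]: "A s \<in> carrier_mat n n" for s using A by (auto simp: skew_mats_def)
  have Fc [simp]: "F s \<in> carrier_mat n n" and Gc [simp]: "G s \<in> carrier_mat n n" for s
    using F by (auto simp: G_def)
  have adjA: "mat_adjoint (A s) = - A s" for s
  proof -
    have "A s = - mat_adjoint (A s)" using A[of s] unfolding skew_mats_def by blast
    then have "- A s = - (- mat_adjoint (A s))" by simp
    then show ?thesis by simp
  qed
  have dG: "has_mat_deriv n G (A s * G s - G s * A s) s" for s
  proof -
    \<comment> \<open>The adjoint reverses both products and each reversed product picks up a sign
      from \<open>A\<close>; the two effects cancel, so the equation keeps its form.\<close>
    have "mat_adjoint (A s * F s - F s * A s) = A s * G s - G s * A s"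
    proof (rule eq_matI)
      fix i j assume "i < dim_row (A s * G s - G s * A s)" "j < dim_col (A s * G s - G s * A s)"
      then have ij: "i < n" "j < n" using carrier_matD[OF Ac[of s]] carrier_matD[OF Gc[of s]] by auto
      have c: "A s * F s - F s * A s \<in> carrier_mat n n" by (auto intro!: minus_carrier_mat)
      have skew: "cnj (A s $$ (k, l)) = - A s $$ (l, k)" if "k < n" "l < n" for k l
        using mat_adjoint_index[OF Ac that(2,1), of s] that carrier_matD[OF Ac[of s]] by (simp add: adjA)
      have g: "G s $$ (k, l) = cnj (F s $$ (l, k))" if "k < n" "l < n" for k l
        using that by (simp add: G_def mat_adjoint_index[OF Fc])
      show "mat_adjoint (A s * F s - F s * A s) $$ (i, j) = (A s * G s - G s * A s) $$ (i, j)"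
        using ij carrier_matD[OF Ac[of s]] carrier_matD[OF Gc[of s]] carrier_matD[OF Fc[of s]]
        by (simp add: mat_adjoint_index[OF c] mult_mat_index_sum[OF Ac Fc] mult_mat_index_sum[OF Fc Ac]
            mult_mat_index_sum[OF Ac Gc] mult_mat_index_sum[OF Gc Ac] skew g sum_negf mult.commute
            del: index_mult_mat(1))
    qed (auto simp: carrier_matD[OF Ac] carrier_matD[OF Gc] carrier_matD[OF Fc] mat_adjoint_def)
    moreover have "has_mat_deriv n G (mat_adjoint (A s * F s - F s * A s)) s"
      unfolding G_def by (rule has_mat_deriv_adjoint[OF F _ d]) (auto intro!: minus_carrier_mat)
    ultimately show ?thesis by simp
  qed
  have dH: "has_mat_deriv n (\<lambda>s. G s * F s) (A s * (G s * F s) - (G s * F s) * A s) s" for s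
  proof -
    have "has_mat_deriv n (\<lambda>s. G s * F s)
        ((A s * G s - G s * A s) * F s + G s * (A s * F s - F s * A s)) s"
      by (rule has_mat_deriv_mult[OF Gc _ dG Fc _ d]) (auto intro!: minus_carrier_mat)
    then show ?thesis unfolding sq_commutator_mult[OF Ac Gc Fc] .
  qed
  have GF: "G s * F s \<in> carrier_mat n n" for s by simp
  have "((\<lambda>s. Re (mtrace (G s * F s))) has_real_derivative 0) (at s)" for s
  proof -
    have "((\<lambda>s. \<Sum>i<n. (G s * F s) $$ (i, i)) has_vector_derivative
        (\<Sum>i<n. (A s * (G s * F s) - (G s * F s) * A s) $$ (i, i))) (at s)"
      using dH[of s] unfolding has_mat_deriv_def by (intro has_vector_derivative_sum) auto
    moreover have "(\<Sum>i<n. (A s * (G s * F s) - (G s * F s) * A s) $$ (i, i)) =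
        mtrace (A s * (G s * F s)) - mtrace ((G s * F s) * A s)"
      using carrier_matD[OF Ac[of s]] carrier_matD[OF GF[of s]]
      by (simp add: mtrace_def sum_subtractf del: index_mult_mat(1))
    ultimately have "((\<lambda>s. mtrace (G s * F s)) has_vector_derivative 0) (at s)"
      by (simp add: mtrace_mult_commute[OF Ac GF] mtrace_carrier[OF GF])
    then show ?thesis by (simp add: has_vector_derivative_complex_iff)
  qed
  then have "Re (mtrace (G t * F t)) = Re (mtrace (G 0 * F 0))"
    using DERIV_isconst_all[of "\<lambda>s. Re (mtrace (G s * F s))"] by blast
  also have "\<dots> = 0"
    using right_mult_zero_mat[OF Gc[of 0], of n] by (simp add: F0 mtrace_carrier[of _ n])
  finally have "mtrace (mat_adjoint (F t) * F t) = 0"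
    unfolding G_def mtrace_adjoint_mult_self[OF F] by simp
  then show ?thesis by (rule mtrace_adjoint_mult_self_eq_0[OF F])
qed

subsection \<open>The Hamiltonian flow in Lax form\<close>

lemma proj_a_props:
  assumes B: "B \<in> carrier_mat n n"
  shows "proj_a n B \<in> skew_mats n" "B - proj_a n B \<in> lower_mats n"
  using theI'[OF decomposition_ex1[OF B]] by (auto simp: proj_a_def)

lemma skew_index:
  assumes A: "A \<in> skew_mats n" and ij: "i < n" "j < n"
  shows "cnj (A $$ (i, j)) = - A $$ (j, i)"
proof -
  have c: "A \<in> carrier_mat n n" and s: "A = - mat_adjoint A"
    using A by (auto simp: skew_mats_def)
  have "A $$ (j, i) = (- mat_adjoint A) $$ (j, i)" using s by simp
  also have "\<dots> = - (mat_adjoint A $$ (j, i))"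
    using ij c by (auto simp: mat_adjoint_def)
  finally show ?thesis using mat_adjoint_index[OF c ij(2,1)] by simp
qed

text \<open>For any admissible lower part \<open>L\<close>, the matrix \<open>B - L\<close> is an
  admissible skew part and hence equals \<open>proj_a n B\<close> by uniqueness. This ties the two
  separately described projections together.\<close>

lemma proj_l_eq:
  assumes B: "B \<in> carrier_mat n n"
  shows "proj_l n B = B - proj_a n B"
  unfolding proj_l_def
proof (rule the_equality)
  note p = proj_a_props[OF B]
  have c: "proj_a n B \<in> carrier_mat n n" using p by (auto simp: skew_mats_def)
  have "B - (B - proj_a n B) = proj_a n B"
    using B c by (auto intro!: eq_matI)
  then show "B - proj_a n B \<in> lower_mats n \<and> B - (B - proj_a n B) \<in> skew_mats n"
    using p by simp
  fix L assume L: "L \<in> lower_mats n \<and> B - L \<in> skew_mats n"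
  then have cL: "L \<in> carrier_mat n n" by (auto simp: lower_mats_def)
  have "B - (B - L) = L" using B cL by (auto intro!: eq_matI)
  then have "proj_a n B = B - L"
    using decomposition_ex1[OF B] p L by (metis (no_types, lifting))
  then show "L = B - proj_a n B" using \<open>B - (B - L) = L\<close> by simp
qed

lemma pairing_commute:
  assumes "X \<in> carrier_mat n n" "Y \<in> carrier_mat n n"
  shows "pairing X Y = pairing Y X"
  using mtrace_mult_commute[OF assms] by (simp add: pairing_def)

definition unit_mat :: "nat \<Rightarrow> complex \<Rightarrow> nat \<Rightarrow> nat \<Rightarrow> complex mat" where
  "unit_mat n c i j = Matrix.mat n n (\<lambda>(a, b). if a = i \<and> b = j then c else 0)"

lemma unit_mat_carrier [simp]: "unit_mat n c i j \<in> carrier_mat n n"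
  by (simp add: unit_mat_def)

text \<open>The indices of the unit matrix are swapped because the trace of a product pairs position
  (j, i) with position (i, j).\<close>

lemma pairing_unit_mat:
  assumes X: "X \<in> carrier_mat n n" and ij: "i < n" "j < n"
  shows "pairing (unit_mat n c j i) X = Im (c * X $$ (i, j))"
proof -
  have "mtrace (unit_mat n c j i * X) =
      (\<Sum>a<n. \<Sum>b<n. (if a = j \<and> b = i then c else 0) * X $$ (b, a))"
    using X by (simp add: mtrace_carrier[of _ n] mult_mat_index_sum[of _ n] unit_mat_def
        del: index_mult_mat(1))
  also have "\<dots> = (\<Sum>a<n. if a = j then c * X $$ (i, a) else 0)"
  proof (rule sum.cong[OF refl])
    fix a
    have "(\<Sum>b<n. (if a = j \<and> b = i then c else 0) * X $$ (b, a)) =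
        (\<Sum>b<n. if b = i then (if a = j then c * X $$ (i, a) else 0) else 0)"
      by (rule sum.cong) auto
    then show "(\<Sum>b<n. (if a = j \<and> b = i then c else 0) * X $$ (b, a)) =
        (if a = j then c * X $$ (i, a) else 0)"
      using ij by simp
  qed
  also have "\<dots> = c * X $$ (i, j)" using ij by simp
  finally show ?thesis by (simp add: pairing_def)
qed

text \<open>Nondegeneracy of the pairing: unit matrices with \<open>c\<close> equal to 1 and to the
  imaginary unit recover the imaginary and the real part of every entry.\<close>

lemma grad_eqI:
  assumes X: "is_grad n \<phi> B X"
  shows "grad n \<phi> B = X"
  unfolding grad_def
proof (rule the_equality)
  show "is_grad n \<phi> B X" by (rule X)
  fix Y assume Y: "is_grad n \<phi> B Y"
  have c: "X \<in> carrier_mat n n" "Y \<in> carrier_mat n n"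
    using X Y by (auto simp: is_grad_def)
  have eq: "pairing X Z = pairing Y Z" if "Z \<in> carrier_mat n n" for Z
    using X Y that unfolding is_grad_def by (blast intro: DERIV_unique)
  show "Y = X"
  proof (rule sq_eqI[OF c(2,1)])
    fix i j assume ij: "i < n" "j < n"
    have "Im (d * X $$ (i, j)) = Im (d * Y $$ (i, j))" for d
      using eq[of "unit_mat n d j i"] c ij
      by (simp add: pairing_commute[of _ n "unit_mat n d j i"] pairing_unit_mat)
    from this[of 1] this[of \<i>] show "Y $$ (i, j) = X $$ (i, j)"
      by (simp add: complex_eq_iff)
  qed
qed

text \<open>
  The weight \<open>W\<close> makes the induction work: the step from \<open>p\<close> to \<open>pCons a p\<close> replaces \<open>W\<close> by
  \<open>W * B\<close>. Only \<open>W = 1\<close> is of interest.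
\<close>

lemma trace_poly_mat_deriv:
  assumes B: "B \<in> carrier_mat n n" and D: "D \<in> carrier_mat n n"
  shows "\<exists>G \<in> carrier_mat n n. has_mat_deriv n (\<lambda>t. poly_mat p (B + complex_of_real t \<cdot>\<^sub>m D)) G 0 \<and>
    (\<forall>W\<in>carrier_mat n n. W * B = B * W \<longrightarrow> mtrace (W * G) = mtrace (W * (poly_mat (pderiv p) B * D)))"
proof (induction p)
  case 0
  have H: "B + complex_of_real t \<cdot>\<^sub>m D \<in> carrier_mat n n" for t using B D by simp
  show ?case
    using B D left_mult_zero_mat[OF D, of n]
    by (intro bexI[of _ "0\<^sub>m n n"]) (auto simp: poly_mat_0[OF H] poly_mat_0[OF B] has_mat_deriv_def)
next
  case (pCons a p)
  then obtain G where G [simp]: "G \<in> carrier_mat n n"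
    and dG: "has_mat_deriv n (\<lambda>t. poly_mat p (B + complex_of_real t \<cdot>\<^sub>m D)) G 0"
    and tr: "\<And>W. W \<in> carrier_mat n n \<Longrightarrow> W * B = B * W \<Longrightarrow>
      mtrace (W * G) = mtrace (W * (poly_mat (pderiv p) B * D))"
    by blast
  define H where "H t = B + complex_of_real t \<cdot>\<^sub>m D" for t
  have H [simp]: "H t \<in> carrier_mat n n" for t using B D by (simp add: H_def)
  have H0: "H 0 = B" using B D by (intro sq_eqI[of _ n]) (auto simp: H_def)
  have [simp]: "B \<in> carrier_mat n n" "D \<in> carrier_mat n n" using B D by auto
  define P where "P = poly_mat p B"
  define P' where "P' = poly_mat (pderiv p) B"
  have [simp]: "P \<in> carrier_mat n n" "P' \<in> carrier_mat n n" by (auto simp: P_def P'_def)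
  have dH: "has_mat_deriv n H D 0"
    unfolding has_mat_deriv_def
  proof (intro allI impI)
    fix i j assume ij: "i < n" "j < n"
    have "((\<lambda>t. B $$ (i, j) + complex_of_real t * D $$ (i, j)) has_vector_derivative
        0 + (of_real 0 * 0 + of_real 1 * D $$ (i, j))) (at 0)"
      by (intro derivative_intros has_vector_derivative_mult has_vector_derivative_of_real)
    then show "((\<lambda>s. H s $$ (i, j)) has_vector_derivative D $$ (i, j)) (at 0)"
      using ij by (simp add: H_def sq_add_index[of _ n] sq_smult_index[of _ n])
  qed
  have dHp: "has_mat_deriv n (\<lambda>t. H t * poly_mat p (H t)) (D * poly_mat p (H 0) + H 0 * G) 0"
    by (rule has_mat_deriv_mult[OF H _ dH _ _ dG[folded H_def]]) auto
  have d: "has_mat_deriv n (\<lambda>t. poly_mat (pCons a p) (H t)) (D * P + B * G) 0"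
    using has_mat_deriv_poly_mat_pCons[OF H dHp] unfolding P_def H0 .
  have "mtrace (W * (D * P + B * G)) = mtrace (W * (poly_mat (pderiv (pCons a p)) B * D))"
    if W [simp]: "W \<in> carrier_mat n n" and WB: "W * B = B * W" for W
  proof -
    have WP: "W * P = P * W"
      unfolding P_def by (rule commute_poly_mat[OF B W WB])
    have "mtrace (W * (D * P + B * G)) = mtrace (W * (D * P)) + mtrace (W * (B * G))"
      by (subst mult_add_distrib_mat[of _ n n _ n]) (auto intro!: mtrace_add[of _ n])
    also have "mtrace (W * (D * P)) = mtrace (P * (W * D))"
      by (simp add: assoc_mult_mat[of _ n n _ n _ n, symmetric] mtrace_mult_commute[of _ n P])
    also have "P * (W * D) = W * (P * D)"
      by (simp add: assoc_mult_mat[of _ n n _ n _ n, symmetric] WP)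
    also have "mtrace (W * (B * G)) = mtrace ((W * B) * G)"
      by (simp add: assoc_mult_mat[of _ n n _ n _ n])
    also have "\<dots> = mtrace ((W * B) * (P' * D))"
      unfolding P'_def
    proof (rule tr)
      show "W * B * B = B * (W * B)"
        by (simp add: WB assoc_mult_mat[of _ n n _ n _ n])
    qed simp
    also have "(W * B) * (P' * D) = W * ((B * P') * D)"
      by (simp add: assoc_mult_mat[of _ n n _ n _ n])
    also have "mtrace (W * (P * D)) + mtrace (W * ((B * P') * D)) = mtrace (W * (P * D) + W * ((B * P') * D))"
      by (rule mtrace_add[of _ n, symmetric]) auto
    also have "W * (P * D) + W * ((B * P') * D) = W * ((P + B * P') * D)"
      by (simp add: add_mult_distrib_mat[of _ n n _ _ n] mult_add_distrib_mat[of _ n n _ n])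
    also have "P + B * P' = poly_mat (pderiv (pCons a p)) B"
      by (simp add: pderiv_pCons poly_mat_add[OF B] poly_mat_pCons_0[OF B] P_def P'_def)
    finally show ?thesis .
  qed
  then show ?case
    using d by (intro bexI[of _ "D * P + B * G"]) (auto simp: H_def)
qed

text \<open>Differentiating a power inserts the direction \<open>D\<close> at every position of the
  word; cyclicity of the trace moves all of them to the end, where they add up to the formal
  derivative. This is the weighted statement at weight 1.\<close>

lemma is_grad_im_tr:
  assumes B: "B \<in> carrier_mat n n"
  shows "is_grad n (im_tr f) B (poly_mat (pderiv f) B)"
  unfolding is_grad_def
proof (intro conjI ballI)
  fix D :: "complex mat" assume D: "D \<in> carrier_mat n n"
  obtain G where G: "G \<in> carrier_mat n n"
    and dG: "has_mat_deriv n (\<lambda>t. poly_mat f (B + complex_of_real t \<cdot>\<^sub>m D)) G 0"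
    and tr: "\<And>W. W \<in> carrier_mat n n \<Longrightarrow> W * B = B * W \<Longrightarrow>
      mtrace (W * G) = mtrace (W * (poly_mat (pderiv f) B * D))"
    using trace_poly_mat_deriv[OF B D, of f] by blast
  have tr1: "mtrace G = mtrace (poly_mat (pderiv f) B * D)"
    using tr[of "1\<^sub>m n"] B D G by (simp add: left_mult_one_mat[of _ n n] right_mult_one_mat[of _ n n])
  have H: "B + complex_of_real t \<cdot>\<^sub>m D \<in> carrier_mat n n" for t using B D by simp
  have "((\<lambda>t. \<Sum>i<n. poly_mat f (B + complex_of_real t \<cdot>\<^sub>m D) $$ (i, i)) has_vector_derivative
      (\<Sum>i<n. G $$ (i, i))) (at 0)"
    using dG unfolding has_mat_deriv_def by (intro has_vector_derivative_sum) auto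
  then have "((\<lambda>t. mtrace (poly_mat f (B + complex_of_real t \<cdot>\<^sub>m D))) has_vector_derivative
      mtrace (poly_mat (pderiv f) B * D)) (at 0)"
    using G H by (simp add: mtrace_carrier[of _ n] flip: tr1)
  then have "((\<lambda>t. Im (mtrace (poly_mat f (B + complex_of_real t \<cdot>\<^sub>m D)))) has_vector_derivative
      Im (mtrace (poly_mat (pderiv f) B * D))) (at 0)"
    by (rule bounded_linear.has_vector_derivative[OF bounded_linear_Im])
  then show "((\<lambda>t. im_tr f (B + complex_of_real t \<cdot>\<^sub>m D)) has_real_derivative
      pairing (poly_mat (pderiv f) B) D) (at 0)"
    by (simp add: im_tr_def pairing_def has_real_derivative_iff_has_vector_derivative)
qed (use B in simp)

lemma Ck_mat_const: "Ck_mat n k (\<lambda>B. c)"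
proof (induction k arbitrary: c)
  case 0
  show ?case by (auto simp: cont_mat_def intro: exI[of _ 1])
next
  case (Suc k)
  have "is_grad n (\<lambda>B. c) B (0\<^sub>m n n)" for B
    using left_mult_zero_mat by (auto simp: is_grad_def pairing_def mtrace_def)
  then show ?case using Suc by (auto intro!: exI[of _ "\<lambda>B. 0\<^sub>m n n"])
qed

lemma is_grad_entry:
  assumes "B \<in> carrier_mat n n" "i < n" "j < n"
  shows "is_grad n (\<lambda>B. Im (c * B $$ (i, j))) B (unit_mat n c j i)"
  unfolding is_grad_def
proof (intro conjI ballI)
  fix D :: "complex mat" assume D: "D \<in> carrier_mat n n"
  have "((\<lambda>t. Im (c * B $$ (i, j)) + t * Im (c * D $$ (i, j))) has_real_derivative
      Im (c * D $$ (i, j))) (at 0)"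
    by (auto intro!: derivative_eq_intros)
  moreover have "Im (c * (B + complex_of_real t \<cdot>\<^sub>m D) $$ (i, j)) =
      Im (c * B $$ (i, j)) + t * Im (c * D $$ (i, j))" for t
    using assms D by (simp add: algebra_simps)
  ultimately show "((\<lambda>t. Im (c * (B + complex_of_real t \<cdot>\<^sub>m D) $$ (i, j))) has_real_derivative
      pairing (unit_mat n c j i) D) (at 0)"
    using assms D by (simp only: pairing_unit_mat)
qed simp

text \<open>The function is real linear, so its gradient is a constant matrix and every higher
  smoothness condition concerns constants. These are the test functions that extract the matrix
  equation from the Hamiltonian flow.\<close>

lemma smooth_mat_entry:
  assumes "i < n" "j < n"
  shows "smooth_mat n (\<lambda>B. Im (c * B $$ (i, j)))"
  unfolding smooth_mat_def
proof
  fix k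
  show "Ck_mat n k (\<lambda>B. Im (c * B $$ (i, j)))"
  proof (cases k)
    case 0
    \<comment> \<open>The summand 1 in the denominator keeps the radius well defined when
      \<open>c\<close> is 0.\<close>
    have bound: "\<bar>Im (c * B' $$ (i, j)) - Im (c * B $$ (i, j))\<bar> < \<epsilon>"
      if "\<epsilon> > 0" "cmod (B' $$ (i, j) - B $$ (i, j)) < \<epsilon> / (cmod c + 1)" for \<epsilon> and B B' :: "complex mat"
    proof -
      have "\<bar>Im (c * B' $$ (i, j)) - Im (c * B $$ (i, j))\<bar> \<le> cmod c * cmod (B' $$ (i, j) - B $$ (i, j))"
        using abs_Im_le_cmod[of "c * (B' $$ (i, j) - B $$ (i, j))"]
        unfolding right_diff_distrib minus_complex.sel(2)[symmetric]
        by (simp only: norm_mult flip: right_diff_distrib)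
      also have "\<dots> \<le> (cmod c + 1) * cmod (B' $$ (i, j) - B $$ (i, j))"
        by (intro mult_right_mono) auto
      also have "\<dots> < \<epsilon>"
        using that(2) by (simp add: pos_less_divide_eq add_nonneg_pos mult.commute)
      finally show ?thesis .
    qed
    then have "cont_mat n (\<lambda>B. Im (c * B $$ (i, j)))"
      unfolding cont_mat_def
    proof (intro ballI allI impI)
      fix \<epsilon> :: real and B :: "complex mat" assume "\<epsilon> > 0"
      then show "\<exists>\<delta>>0. \<forall>B'\<in>carrier_mat n n. (\<forall>i<n. \<forall>j<n. cmod (B' $$ (i, j) - B $$ (i, j)) < \<delta>) \<longrightarrow>
          \<bar>Im (c * B' $$ (i, j)) - Im (c * B $$ (i, j))\<bar> < \<epsilon>"
        using assms bound by (intro exI[of _ "\<epsilon> / (cmod c + 1)"]) (auto simp: add_nonneg_pos simp del: times_complex.sel)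
    qed
    then show ?thesis using 0 by simp
  next
    case (Suc k')
    then show ?thesis using is_grad_entry[OF _ assms, of _ c]
      by (auto intro!: exI[of _ "\<lambda>B. unit_mat n c j i"] Ck_mat_const)
  qed
qed

text \<open>The gradient \<open>X\<close> is a polynomial in \<open>B\<close>, so
  \<open>X * B\<close> and \<open>B * X\<close> are the same matrix \<open>Z\<close>, and both
  R-matrix terms share one \<open>R\<close>, equal to \<open>Z\<close> minus twice \<open>A\<close>.
  Since \<open>Z\<close> commutes with \<open>B\<close>, it drops out of the commutator of
  \<open>B\<close> with \<open>R\<close>; the remaining factor 2 cancels the 1/2 of the
  bracket.\<close>

lemma poisson_im_tr_entry:
  assumes B: "B \<in> carrier_mat n n" and ij: "i < n" "j < n"
    and A_def: "A = proj_a n (B * poly_mat (pderiv f) B)"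
  shows "poisson n (im_tr f) (\<lambda>B. Im (c * B $$ (i, j))) B = Im (c * (A * B - B * A) $$ (i, j))"
proof -
  define X where "X = poly_mat (pderiv f) B"
  define Z where "Z = B * X"
  define Y where "Y = unit_mat n c j i"
  define R where "R = Rmat n Z"
  have [simp]: "B \<in> carrier_mat n n" "X \<in> carrier_mat n n" "Z \<in> carrier_mat n n" "Y \<in> carrier_mat n n"
    using B by (auto simp: X_def Z_def Y_def)
  have XB: "X * B = Z"
    using commute_poly_mat[OF B B refl, of "pderiv f"] by (simp add: X_def Z_def)
  have A [simp]: "A \<in> carrier_mat n n"
    using proj_a_props(1)[of "B * poly_mat (pderiv f) B" n] B by (auto simp: A_def skew_mats_def)
  have R: "R = Z - A - A"
    by (simp add: R_def Rmat_def proj_l_eq[of _ n]) (simp add: A_def Z_def X_def)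
  have Rc [simp]: "R \<in> carrier_mat n n" unfolding R by (auto intro!: minus_carrier_mat)
  have BR: "B * R = B * Z - B * A - B * A"
    unfolding R by (simp add: mult_minus_distrib_mat[of _ n n _ n] minus_carrier_mat)
  have RB: "R * B = Z * B - A * B - A * B"
    unfolding R by (simp add: minus_mult_distrib_mat[of _ n n _ _ n] minus_carrier_mat)
  have BZ: "Z * B = B * Z"
    unfolding Z_def by (simp add: assoc_mult_mat[of _ n n _ n _ n] XB Z_def)
  have g: "grad n (im_tr f) B = X" "grad n (\<lambda>B. Im (c * B $$ (i, j))) B = Y"
    unfolding X_def Y_def by (intro grad_eqI is_grad_im_tr is_grad_entry B ij)+
  have "pairing R (Y * B) = pairing (B * R) Y"
    unfolding pairing_def using mtrace_mult_commute[of "R * Y" n B]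
    by (simp add: assoc_mult_mat[of _ n n _ n _ n])
  also have "\<dots> = Im (c * (B * R) $$ (i, j))"
    unfolding Y_def using ij by (subst pairing_commute[of _ n]) (auto simp: pairing_unit_mat simp del: index_mult_mat(1))
  finally have 1: "pairing R (Y * B) = Im (c * (B * R) $$ (i, j))" .
  have "pairing R (B * Y) = pairing (R * B) Y"
    unfolding pairing_def by (simp add: assoc_mult_mat[of _ n n _ n _ n])
  also have "\<dots> = Im (c * (R * B) $$ (i, j))"
    unfolding Y_def using ij by (subst pairing_commute[of _ n]) (auto simp: pairing_unit_mat simp del: index_mult_mat(1))
  finally have 2: "pairing R (B * Y) = Im (c * (R * B) $$ (i, j))" .
  have "poisson n (im_tr f) (\<lambda>B. Im (c * B $$ (i, j))) B =
      1 / 2 * pairing R (Y * B) - 1 / 2 * pairing R (B * Y)"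
    unfolding poisson_def Let_def g XB R_def Z_def[symmetric] ..
  also have "\<dots> = 1 / 2 * Im (c * ((B * R) $$ (i, j) - (R * B) $$ (i, j)))"
    unfolding 1 2 by (simp add: algebra_simps)
  also have "(B * R) $$ (i, j) - (R * B) $$ (i, j) = 2 * (A * B - B * A) $$ (i, j)"
    unfolding BR RB BZ using ij
    by (simp add: sq_minus_index[of _ n] minus_carrier_mat del: index_mult_mat(1))
  finally show ?thesis by (simp add: algebra_simps)
qed

text \<open>Testing the flow on Im(c * entry) with \<open>c\<close> equal to 1 and to the imaginary
  unit yields the imaginary and real parts of the matrix equation.\<close>

lemma hamiltonian_flow_lax:
  assumes flow: "hamiltonian_flow n (im_tr f) C"
  defines "A \<equiv> \<lambda>t. proj_a n (C t * poly_mat (pderiv f) (C t))"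
  shows "has_mat_deriv n C (A t * C t - C t * A t) t"
  unfolding has_mat_deriv_def
proof (intro allI impI)
  fix i j assume ij: "i < n" "j < n"
  have C: "C s \<in> carrier_mat n n" for s using flow by (simp add: hamiltonian_flow_def)
  have d: "((\<lambda>s. Im (c * C s $$ (i, j))) has_real_derivative
      Im (c * (A t * C t - C t * A t) $$ (i, j))) (at t)" for c
    using flow[unfolded hamiltonian_flow_def, THEN conjunct2, THEN spec, THEN mp,
        OF smooth_mat_entry[OF ij, of c], THEN spec, of t]
    unfolding poisson_im_tr_entry[OF C[of t] ij refl, of f c] A_def .
  from d[of 1] d[of \<i>] show "((\<lambda>s. C s $$ (i, j)) has_vector_derivative (A t * C t - C t * A t) $$ (i, j)) (at t)"
    by (simp add: has_vector_derivative_complex_iff del: index_mult_mat(1))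
qed

subsection \<open>The Szego recursion for a CMV matrix\<close>

abbreviation rho :: "(int \<Rightarrow> complex) \<Rightarrow> nat \<Rightarrow> real" where
  "rho \<alpha> k \<equiv> sqrt (1 - (cmod (\<alpha> (int k)))\<^sup>2)"

text \<open>
  Entries of the block-diagonal factors: blocks start at the indices of parity \<open>p\<close>. The
  conventions \<open>\<alpha> (-1) = -1\<close> and \<open>\<bar>\<alpha> (n - 1)\<bar> = 1\<close> make the two one-dimensional blocks at the
  ends instances of the same formula.
\<close>

definition Theta :: "(int \<Rightarrow> complex) \<Rightarrow> bool \<Rightarrow> nat \<Rightarrow> nat \<Rightarrow> complex" where
  "Theta \<alpha> p i j =
     (if i = j then if even i = p then cnj (\<alpha> (int i)) else - \<alpha> (int i - 1)
      else if j = Suc i \<and> even i = p then rho \<alpha> i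
      else if i = Suc j \<and> even j = p then rho \<alpha> j else 0)"

definition Theta_mat :: "nat \<Rightarrow> (int \<Rightarrow> complex) \<Rightarrow> bool \<Rightarrow> complex mat" where
  "Theta_mat n \<alpha> p = Matrix.mat n n (\<lambda>(i, j). Theta \<alpha> p i j)"

lemma Theta_mat_carrier [simp]: "Theta_mat n \<alpha> p \<in> carrier_mat n n"
  by (simp add: Theta_mat_def)

text \<open>Each step peels off the block opening at \<open>a\<close> and continues at
  \<open>a + 2\<close>, since \<open>a + 1\<close> has the wrong parity for the filter. The
  induction ends either with no index left or with the truncated block at \<open>n - 1\<close>,
  which is one-dimensional.\<close>

lemma diag_block_Xi:
  assumes "a \<le> n" "even a = p"
  shows "diag_block_mat (map (Xi n \<alpha>) (filter (\<lambda>k. even k = p) [int a..int n - 1])) =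
    Matrix.mat (n - a) (n - a) (\<lambda>(i, j). Theta \<alpha> p (i + a) (j + a))"
  using assms
proof (induction "n - a" arbitrary: a rule: less_induct)
  case less
  consider "a = n" | "Suc a = n" | "Suc (Suc a) \<le> n" using less.prems by linarith
  then show ?case
  proof cases
    case 1
    then show ?thesis by (auto intro!: eq_matI)
  next
    case 2
    then have l: "[int a..int n - 1] = [int a]"
      by (simp add: upto_rec1)
    have X: "Xi n \<alpha> (int a) = mat_of_rows_list 1 [[cnj (\<alpha> (int a))]]"
      using 2 by (auto simp: Xi_def)
    show ?thesis using 2 less.prems unfolding l
      by (auto intro!: eq_matI simp: X mat_of_rows_list_def Theta_def)
  next
    case 3
    then have l: "[int a..int n - 1] = int a # int (Suc a) # [int (Suc (Suc a))..int n - 1]"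
      by (simp add: upto_rec1)
    have f: "filter (\<lambda>k. even k = p) (int a # int (Suc a) # xs) = int a # filter (\<lambda>k. even k = p) xs" for xs
      using less.prems by simp
    define D where "D = diag_block_mat (map (Xi n \<alpha>) (filter (\<lambda>k. even k = p) [int (Suc (Suc a))..int n - 1]))"
    have IH: "D = Matrix.mat (n - Suc (Suc a)) (n - Suc (Suc a))
        (\<lambda>(i, j). Theta \<alpha> p (i + Suc (Suc a)) (j + Suc (Suc a)))"
      unfolding D_def using 3 less.prems by (intro less.hyps) auto
    have X: "Xi n \<alpha> (int a) = mat_of_rows_list 2 [[cnj (\<alpha> (int a)), rho \<alpha> a], [rho \<alpha> a, - \<alpha> (int a)]]"
      using 3 by (auto simp: Xi_def Let_def)
    have dX: "dim_row (Xi n \<alpha> (int a)) = 2" "dim_col (Xi n \<alpha> (int a)) = 2"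
      unfolding X by (simp_all add: mat_of_rows_list_def)
    have Xij: "Xi n \<alpha> (int a) $$ (i, j) = Theta \<alpha> p (i + a) (j + a)" if "i < 2" "j < 2" for i j
    proof -
      have "i = 0 \<or> i = 1" "j = 0 \<or> j = 1" using that by auto
      then show ?thesis using less.prems unfolding X
        by (elim disjE) (auto simp: mat_of_rows_list_def Theta_def)
    qed
    have "diag_block_mat (map (Xi n \<alpha>) (filter (\<lambda>k. even k = p) [int a..int n - 1])) =
      four_block_mat (Xi n \<alpha> (int a)) (0\<^sub>m 2 (n - Suc (Suc a))) (0\<^sub>m (n - Suc (Suc a)) 2) D"
      unfolding l f list.map diag_block_mat.simps Let_def D_def[symmetric] by (simp add: IH dX)
    also have "\<dots> = Matrix.mat (n - a) (n - a) (\<lambda>(i, j). Theta \<alpha> p (i + a) (j + a))"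
    proof (rule eq_matI)
      fix i j
      assume "i < dim_row (Matrix.mat (n - a) (n - a) (\<lambda>(i, j). Theta \<alpha> p (i + a) (j + a)))"
        "j < dim_col (Matrix.mat (n - a) (n - a) (\<lambda>(i, j). Theta \<alpha> p (i + a) (j + a)))"
      then have ij: "i < n - a" "j < n - a" by auto
      have z1: "Theta \<alpha> p (i + a) (j + a) = 0" if "i < 2" "\<not> j < 2"
      proof -
        have "i = 0 \<or> i = 1" using that by auto
        then show ?thesis using that less.prems by (elim disjE) (auto simp: Theta_def)
      qed
      have z2: "Theta \<alpha> p (i + a) (j + a) = 0" if "\<not> i < 2" "j < 2"
      proof -
        have "j = 0 \<or> j = 1" using that by auto
        then show ?thesis using that less.prems by (elim disjE) (auto simp: Theta_def)
      qed
      have e: "Suc (Suc (x + a - 2)) = x + a" if "\<not> x < 2" for x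
        using that by simp
      show "four_block_mat (Xi n \<alpha> (int a)) (0\<^sub>m 2 (n - Suc (Suc a))) (0\<^sub>m (n - Suc (Suc a)) 2) D $$ (i, j) =
        Matrix.mat (n - a) (n - a) (\<lambda>(i, j). Theta \<alpha> p (i + a) (j + a)) $$ (i, j)"
        using ij 3 z1 z2 by (auto simp: IH dX Xij e)
    qed (use 3 in \<open>auto simp: IH dX\<close>)
    finally show ?thesis .
  qed
qed

lemma cmv_L_eq:
  assumes "n \<ge> 1"
  shows "cmv_L n \<alpha> = Theta_mat n \<alpha> True"
proof -
  have "[-1..int n - 1] = -1 # [int 0..int n - 1]" using assms by (subst upto_rec1) auto
  then show ?thesis using diag_block_Xi[of 0 n True \<alpha>]
    by (simp add: cmv_L_def Theta_mat_def)
qed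

lemma cmv_M_eq:
  assumes n: "n \<ge> 1" and \<alpha>: "\<alpha> (-1) = -1"
  shows "cmv_M n \<alpha> = Theta_mat n \<alpha> False"
proof -
  have l: "filter odd [-1..int n - 1] = -1 # filter (\<lambda>k. even k = False) [int 1..int n - 1]"
    using n by (subst upto_rec1; simp) (subst upto_rec1; simp)
  have X: "Xi n \<alpha> (-1) = mat_of_rows_list 1 [[1]]" by (simp add: Xi_def)
  have "cmv_M n \<alpha> = four_block_mat (Xi n \<alpha> (-1)) (0\<^sub>m 1 (n - 1)) (0\<^sub>m (n - 1) 1)
      (Matrix.mat (n - 1) (n - 1) (\<lambda>(i, j). Theta \<alpha> False (i + 1) (j + 1)))"
    using diag_block_Xi[of 1 n False \<alpha>] n unfolding cmv_M_def l
    by (simp add: Let_def X mat_of_rows_list_def)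
  also have "\<dots> = Theta_mat n \<alpha> False"
    using n \<alpha> by (auto intro!: eq_matI simp: Theta_mat_def X mat_of_rows_list_def Theta_def)
  finally show ?thesis .
qed

text \<open>A column of \<open>Theta\<close> has at most two nonzero entries. This formula and the
  next two multiply a row \<open>x\<close> by a column that opens a block, closes a block, or is the
  initial one-dimensional block.\<close>

lemma sum_Theta_start:
  assumes "i < n" "even i = p"
  shows "(\<Sum>k<n. x k * Theta \<alpha> p k i) =
    x i * cnj (\<alpha> (int i)) + (if Suc i < n then x (Suc i) * rho \<alpha> i else 0)"
proof -
  have "x k * Theta \<alpha> p k i = (if k = i then x i * cnj (\<alpha> (int i)) else 0) +
      (if k = Suc i then x (Suc i) * rho \<alpha> i else 0)" for k
    using assms by (auto simp: Theta_def)
  then show ?thesis using assms by (simp add: sum.distrib)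
qed

lemma sum_Theta_end:
  assumes "Suc i < n" "even i = p"
  shows "(\<Sum>k<n. x k * Theta \<alpha> p k (Suc i)) = x i * rho \<alpha> i - x (Suc i) * \<alpha> (int i)"
proof -
  have "x k * Theta \<alpha> p k (Suc i) = (if k = i then x i * rho \<alpha> i else 0) +
      (if k = Suc i then - x (Suc i) * \<alpha> (int i) else 0)" for k
    using assms by (auto simp: Theta_def)
  then show ?thesis using assms by (simp add: sum.distrib)
qed

lemma sum_Theta_0:
  assumes "0 < n" "\<alpha> (-1) = -1"
  shows "(\<Sum>k<n. x k * Theta \<alpha> False k 0) = x 0"
proof -
  have "x k * Theta \<alpha> False k 0 = (if k = 0 then x 0 else 0)" for k
    using assms by (auto simp: Theta_def)
  then show ?thesis using assms by simp
qed

text \<open>The factor appended to \<open>alt_prod n \<alpha> k\<close> has its blocks opening at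
  indices of the parity of \<open>k\<close>, starting with L. In particular one block opens at
  \<open>k\<close> itself, so this factor relates columns \<open>k\<close> and \<open>k + 1\<close>
  through \<alpha>_k alone.\<close>

primrec alt_prod :: "nat \<Rightarrow> (int \<Rightarrow> complex) \<Rightarrow> nat \<Rightarrow> complex mat" where
  "alt_prod n \<alpha> 0 = 1\<^sub>m n"
| "alt_prod n \<alpha> (Suc k) = alt_prod n \<alpha> k * Theta_mat n \<alpha> (even k)"

lemma alt_prod_carrier [simp]: "alt_prod n \<alpha> k \<in> carrier_mat n n"
  by (induction k) simp_all

context
  fixes n :: nat and \<alpha> :: "int \<Rightarrow> complex"
  assumes n: "n \<ge> 1" and v: "verblunsky n \<alpha>"
begin

lemma alpha_m1: "\<alpha> (-1) = -1"
  using v by (simp add: verblunsky_def)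

lemma rho_pos: "Suc k < n \<Longrightarrow> rho \<alpha> k > 0"
  using v by (auto simp: verblunsky_def power_less_one_iff abs_square_less_1)

lemma alpha_rho: 
  assumes "k < n"
  shows "\<alpha> (int k) * cnj (\<alpha> (int k)) + complex_of_real (rho \<alpha> k) * complex_of_real (rho \<alpha> k) = 1"
proof -
  have "cmod (\<alpha> (int k)) \<le> 1"
  proof (cases "Suc k < n")
    case True
    then show ?thesis using v by (auto simp: verblunsky_def intro!: less_imp_le)
  next
    case False
    then have "int k = int n - 1" using assms by simp
    then show ?thesis using v by (auto simp: verblunsky_def)
  qed
  then have "0 \<le> 1 - (cmod (\<alpha> (int k)))\<^sup>2" by (simp add: power_le_one)
  then have "rho \<alpha> k * rho \<alpha> k = 1 - (cmod (\<alpha> (int k)))\<^sup>2" by simp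
  then have "complex_of_real (rho \<alpha> k) * complex_of_real (rho \<alpha> k) = 1 - complex_of_real ((cmod (\<alpha> (int k)))\<^sup>2)"
    by (simp only: of_real_mult[symmetric] of_real_diff of_real_1)
  then show ?thesis unfolding complex_norm_square by simp
qed

lemma rho_last: "complex_of_real (rho \<alpha> (n - 1)) = 0"
  using v n by (simp add: verblunsky_def of_nat_diff)

text \<open>Full blocks are unitary since the squares of |\<alpha>_k| and rho_k add up to 1. A
  truncated final block is unitary because \<alpha>_{n-1} lies on the circle, and the initial one
  because \<alpha>_{-1} = -1.\<close>

lemma Theta_orthogonal:
  assumes ij: "i < n" "j < n"
  shows "(\<Sum>k<n. cnj (Theta \<alpha> p k j) * Theta \<alpha> p k i) = (if i = j then 1 else 0)"
proof -
  consider (start) "even i = p" | (zero) "even i \<noteq> p" "i = 0" | (fin) i' where "even i' = p" "i = Suc i'"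
    by (cases i) auto
  then show ?thesis
  proof cases
    case start
    have "(\<Sum>k<n. cnj (Theta \<alpha> p k j) * Theta \<alpha> p k i) =
        cnj (Theta \<alpha> p i j) * cnj (\<alpha> (int i)) + (if Suc i < n then cnj (Theta \<alpha> p (Suc i) j) * rho \<alpha> i else 0)"
      using start ij by (intro sum_Theta_start)
    also have "\<dots> = (if i = j then 1 else 0)"
    proof (cases "Suc i < n")
      case True
      then show ?thesis using start ij alpha_rho[of i] by (auto simp: Theta_def)
    next
      case False
      then have ni: "n = Suc i" using ij by simp
      have r: "complex_of_real (rho \<alpha> i) = 0" using rho_last unfolding ni diff_Suc_1 .
      have "\<alpha> (int i) * cnj (\<alpha> (int i)) = 1" using alpha_rho[of i] ij unfolding r by simp
      then show ?thesis using start ij ni by (auto simp: Theta_def)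
    qed
    finally show ?thesis .
  next
    case zero
    then have p: "p = False" by simp
    show ?thesis using zero n ij alpha_m1 unfolding p zero
      by (subst sum_Theta_0) (auto simp: Theta_def)
  next
    case (fin i')
    have "(\<Sum>k<n. cnj (Theta \<alpha> p k j) * Theta \<alpha> p k (Suc i')) =
        cnj (Theta \<alpha> p i' j) * rho \<alpha> i' - cnj (Theta \<alpha> p (Suc i') j) * \<alpha> (int i')"
      using fin ij by (intro sum_Theta_end) auto
    also have "\<dots> = (if i = j then 1 else 0)"
      using fin ij alpha_rho[of i'] by (auto simp: Theta_def algebra_simps)
    finally show ?thesis using fin by simp
  qed
qed

lemma Theta_mat_unitary: "mat_adjoint (Theta_mat n \<alpha> p) * Theta_mat n \<alpha> p = 1\<^sub>m n"
proof (rule sq_eqI[of _ n])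
  fix i j assume ij: "i < n" "j < n"
  then show "(mat_adjoint (Theta_mat n \<alpha> p) * Theta_mat n \<alpha> p) $$ (i, j) = 1\<^sub>m n $$ (i, j)"
    using Theta_orthogonal[OF ij(2,1), of p]
    by (simp add: mult_mat_index_sum[of _ n] mat_adjoint_index[of _ n] Theta_mat_def[of n] del: index_mult_mat(1))
qed simp_all

lemma cmv_eq: "cmv n \<alpha> = Theta_mat n \<alpha> True * Theta_mat n \<alpha> False"
  by (simp add: cmv_def cmv_L_eq[OF n] cmv_M_eq[of n \<alpha>, OF n alpha_m1])

lemma cmv_carrier [simp]: "cmv n \<alpha> \<in> carrier_mat n n"
  by (simp add: cmv_eq)

lemma alt_prod_unitary: "mat_adjoint (alt_prod n \<alpha> k) * alt_prod n \<alpha> k = 1\<^sub>m n"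
proof (induction k)
  case (Suc k)
  let ?T = "Theta_mat n \<alpha> (even k)"
  have "mat_adjoint (alt_prod n \<alpha> (Suc k)) * alt_prod n \<alpha> (Suc k) =
      mat_adjoint ?T * (mat_adjoint (alt_prod n \<alpha> k) * alt_prod n \<alpha> k * ?T)"
    by (simp add: mat_adjoint_mult[of _ n] assoc_mult_mat[of _ n n _ n _ n])
  also have "\<dots> = mat_adjoint ?T * ?T"
    unfolding Suc by (simp add: left_mult_one_mat[of _ n n])
  finally show ?case by (simp add: Theta_mat_unitary)
qed (simp add: mat_adjoint_one)

text \<open>Prefixing LM to an alternating word that begins with L gives the alternating word two
  letters longer.\<close>

lemma cmv_mult_alt_prod: "cmv n \<alpha> * alt_prod n \<alpha> k = alt_prod n \<alpha> (Suc (Suc k))"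
proof (induction k)
  case 0
  show ?case by (simp add: cmv_eq left_mult_one_mat[of _ n n] right_mult_one_mat[of _ n n])
next
  case (Suc k)
  have "cmv n \<alpha> * alt_prod n \<alpha> (Suc k) = (cmv n \<alpha> * alt_prod n \<alpha> k) * Theta_mat n \<alpha> (even k)"
    by (simp add: assoc_mult_mat[of _ n n _ n _ n])
  then show ?case unfolding Suc by simp
qed

lemma cmv_unitary: "mat_adjoint (cmv n \<alpha>) * cmv n \<alpha> = 1\<^sub>m n"
  "cmv n \<alpha> * mat_adjoint (cmv n \<alpha>) = 1\<^sub>m n"
proof -
  have "cmv n \<alpha> = alt_prod n \<alpha> 2"
    using cmv_mult_alt_prod[of 0] by (simp add: numeral_2_eq_2 right_mult_one_mat[of _ n n])
  then show "mat_adjoint (cmv n \<alpha>) * cmv n \<alpha> = 1\<^sub>m n"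
    using alt_prod_unitary[of 2] by simp
  then show "cmv n \<alpha> * mat_adjoint (cmv n \<alpha>) = 1\<^sub>m n"
    by (rule mat_mult_left_right_inverse[of _ n, rotated 2]) simp_all
qed

text \<open>For even \<open>k\<close> the alternating product is a power of the CMV matrix.\<close>

lemma alt_prod_even_commute:
  "even k \<Longrightarrow> alt_prod n \<alpha> k * cmv n \<alpha> = cmv n \<alpha> * alt_prod n \<alpha> k"
proof (induction k rule: less_induct)
  case (less k)
  show ?case
  proof (cases "k = 0")
    case True
    then show ?thesis by (simp add: left_mult_one_mat[of _ n n] right_mult_one_mat[of _ n n])
  next
    case False
    then obtain m where m: "k = Suc (Suc m)"
      using less.prems by (metis even_Suc not0_implies_Suc odd_Suc_minus_one)
    have "alt_prod n \<alpha> k * cmv n \<alpha> = cmv n \<alpha> * (alt_prod n \<alpha> m * cmv n \<alpha>)"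
      unfolding m cmv_mult_alt_prod[symmetric] by (simp add: assoc_mult_mat[of _ n n _ n _ n])
    also have "\<dots> = cmv n \<alpha> * alt_prod n \<alpha> k"
      using less.IH[of m] less.prems unfolding m cmv_mult_alt_prod[symmetric] by simp
    finally show ?thesis .
  qed
qed

lemma alt_prod_Suc_start:
  assumes "i < n" "k < n"
  shows "alt_prod n \<alpha> (Suc k) $$ (i, k) = alt_prod n \<alpha> k $$ (i, k) * cnj (\<alpha> (int k)) +
    (if Suc k < n then alt_prod n \<alpha> k $$ (i, Suc k) * rho \<alpha> k else 0)"
  using assms sum_Theta_start[of k n "even k" "\<lambda>j. alt_prod n \<alpha> k $$ (i, j)" \<alpha>]
  by (simp add: mult_mat_index_sum[of _ n] Theta_mat_def[of n] del: index_mult_mat(1))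

lemma alt_prod_Suc_end:
  assumes "i < n" "Suc k < n"
  shows "alt_prod n \<alpha> (Suc k) $$ (i, Suc k) =
    alt_prod n \<alpha> k $$ (i, k) * rho \<alpha> k - alt_prod n \<alpha> k $$ (i, Suc k) * \<alpha> (int k)"
  using assms sum_Theta_end[of k n "even k" "\<lambda>j. alt_prod n \<alpha> k $$ (i, j)" \<alpha>]
  by (simp add: mult_mat_index_sum[of _ n] Theta_mat_def[of n] del: index_mult_mat(1))

end

section \<open>Szego polynomials and the Krylov space of e_1\<close>

text \<open>\<open>szego\<close> is the monic Phi_k and \<open>szego_rev\<close> its reversed
  polynomial, with constant coefficient 1. In this normalisation the recursion has no division by
  rho, so it still makes sense in the last step to \<open>n\<close>, where rho vanishes.\<close>

fun szego :: "(nat \<Rightarrow> complex) \<Rightarrow> nat \<Rightarrow> complex poly" and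
    szego_rev :: "(nat \<Rightarrow> complex) \<Rightarrow> nat \<Rightarrow> complex poly" where
  "szego a 0 = 1"
| "szego a (Suc k) = pCons 0 (szego a k) - Polynomial.smult (cnj (a k)) (szego_rev a k)"
| "szego_rev a 0 = 1"
| "szego_rev a (Suc k) = szego_rev a k - Polynomial.smult (a k) (pCons 0 (szego a k))"

context
  fixes n :: nat and \<alpha> :: "int \<Rightarrow> complex"
  assumes n: "n \<ge> 1" and v: "verblunsky n \<alpha>"
begin

private abbreviation (input) "C \<equiv> cmv n \<alpha>"
private abbreviation (input) "a \<equiv> \<lambda>k. \<alpha> (int k)"
private abbreviation (input) "W \<equiv> alt_prod n \<alpha>"
private abbreviation (input) "R \<equiv> \<lambda>k. complex_of_real (\<Prod>j<k. rho \<alpha> j)"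

lemmas cmv_matrix_carrier [simp] = cmv_carrier[OF n v]

lemma poly_mat_shift_col:
  assumes "i < n" "j < n"
  shows "poly_mat (pCons 0 p) C $$ (i, j) = (\<Sum>l<n. C $$ (i, l) * poly_mat p C $$ (l, j))"
  using assms
  by (simp add: poly_mat_pCons_0[of _ n] mult_mat_index_sum[of _ n] del: index_mult_mat(1))

text \<open>Up to the product of the rho_j, the vectors obtained by applying the reversed
  polynomial, x Phi_k and Phi_k to e_1 are column \<open>k\<close> of three consecutive alternating
  products. All three identities go through one induction: the block of the next factor at
  \<open>k\<close> performs one step of the recursion, and applying the CMV matrix to the third
  identity gives the second.\<close>

lemma szego_columns:
  assumes "k < n" "i < n"
  shows "poly_mat (szego_rev a k) C $$ (i, 0) = R k * W k $$ (i, k)"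
    and "poly_mat (pCons 0 (szego a k)) C $$ (i, 0) = R k * W (Suc k) $$ (i, k)"
    and "k > 0 \<Longrightarrow> poly_mat (szego a k) C $$ (i, 0) = R k * W (k - 1) $$ (i, k)"
proof -
  have "\<forall>i<n. poly_mat (szego_rev a k) C $$ (i, 0) = R k * W k $$ (i, k) \<and>
    poly_mat (pCons 0 (szego a k)) C $$ (i, 0) = R k * W (Suc k) $$ (i, k) \<and>
    (k > 0 \<longrightarrow> poly_mat (szego a k) C $$ (i, 0) = R k * W (k - 1) $$ (i, k))"
    using assms(1)
  proof (induction k)
    case 0
    \<comment> \<open>The first column of M is e_1, so the first columns of LM and of L
      agree.\<close>
    have "poly_mat (pCons 0 1) C $$ (i, 0) = W (Suc 0) $$ (i, 0)" if i: "i < n" for i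
    proof -
      have "poly_mat (pCons 0 1) C $$ (i, 0) = C $$ (i, 0)"
        using i n by (simp add: one_pCons poly_mat_X[of _ n])
      also have "\<dots> = (\<Sum>k<n. Theta_mat n \<alpha> True $$ (i, k) * Theta_mat n \<alpha> False $$ (k, 0))"
        using i n by (simp add: cmv_eq[OF n v] mult_mat_index_sum[of _ n] del: index_mult_mat(1))
      also have "\<dots> = Theta_mat n \<alpha> True $$ (i, 0)"
        using i n sum_Theta_0[of n \<alpha> "\<lambda>k. Theta_mat n \<alpha> True $$ (i, k)"] alpha_m1[OF n v]
        by (simp add: Theta_mat_def)
      finally show ?thesis using left_mult_one_mat[OF Theta_mat_carrier[of n \<alpha> True]]
        by simp
    qed
    then show ?case using n by (simp add: poly_mat_1[of _ n] del: alt_prod.simps(2))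
  next
    case (Suc k)
    then have IH: "poly_mat (szego_rev a k) C $$ (i, 0) = R k * W k $$ (i, k)"
      "poly_mat (pCons 0 (szego a k)) C $$ (i, 0) = R k * W (Suc k) $$ (i, k)" if "i < n" for i
      using that by auto
    have ar: "a k * cnj (a k) + complex_of_real (rho \<alpha> k) * complex_of_real (rho \<alpha> k) = 1"
      using alpha_rho[OF n v, of k] Suc.prems by simp
    have S: "poly_mat (szego a (Suc k)) C $$ (i, 0) = R (Suc k) * W k $$ (i, Suc k)" if i: "i < n" for i
    proof -
      have "poly_mat (szego a (Suc k)) C $$ (i, 0) =
          R k * (W (Suc k) $$ (i, k) - cnj (a k) * W k $$ (i, k))"
        using i n IH[OF i] by (simp add: poly_mat_diff[of _ n] poly_mat_smult[of _ n] sq_minus_index[of _ n]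
            sq_smult_index[of _ n] algebra_simps del: alt_prod.simps smult_pCons)
      also have "\<dots> = R k * (W k $$ (i, Suc k) * rho \<alpha> k)"
        using Suc.prems i by (simp add: alt_prod_Suc_start[OF n v] del: alt_prod.simps)
      finally show ?thesis by (simp del: alt_prod.simps)
    qed
    have R: "poly_mat (szego_rev a (Suc k)) C $$ (i, 0) = R (Suc k) * W (Suc k) $$ (i, Suc k)"
      if i: "i < n" for i
    proof -
      have "poly_mat (szego_rev a (Suc k)) C $$ (i, 0) =
          R k * (W k $$ (i, k) - a k * W (Suc k) $$ (i, k))"
        using i n IH[OF i] by (simp add: poly_mat_diff[of _ n] poly_mat_smult[of _ n] sq_minus_index[of _ n]
            sq_smult_index[of _ n] algebra_simps del: alt_prod.simps smult_pCons)
      also have "W k $$ (i, k) - a k * W (Suc k) $$ (i, k) =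
          W k $$ (i, k) * (1 - a k * cnj (a k)) - a k * W k $$ (i, Suc k) * rho \<alpha> k"
        using Suc.prems i by (simp add: alt_prod_Suc_start[OF n v] algebra_simps del: alt_prod.simps)
      \<comment> \<open>This supplies the second factor rho_k; one of the two completes the product
        \<open>R (Suc k)\<close>, the other enters column \<open>Suc k\<close> of the next
        alternating product.\<close>
      also have "1 - a k * cnj (a k) = complex_of_real (rho \<alpha> k) * complex_of_real (rho \<alpha> k)"
        using ar by (simp add: algebra_simps)
      also have "W k $$ (i, k) * (complex_of_real (rho \<alpha> k) * complex_of_real (rho \<alpha> k)) -
          a k * W k $$ (i, Suc k) * rho \<alpha> k = rho \<alpha> k * W (Suc k) $$ (i, Suc k)"
        using Suc.prems i by (simp add: alt_prod_Suc_end[OF n v] algebra_simps del: alt_prod.simps)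
      finally show ?thesis by (simp del: alt_prod.simps)
    qed
    \<comment> \<open>Multiplying the identity for Phi_{k+1} by the CMV matrix lengthens the
      alternating product by two letters.\<close>
    have Z: "poly_mat (pCons 0 (szego a (Suc k))) C $$ (i, 0) = R (Suc k) * W (Suc (Suc k)) $$ (i, Suc k)"
      if i: "i < n" for i
    proof -
      have "poly_mat (pCons 0 (szego a (Suc k))) C $$ (i, 0) =
          (\<Sum>l<n. C $$ (i, l) * (R (Suc k) * W k $$ (l, Suc k)))"
        using i n by (subst poly_mat_shift_col) (auto simp: S simp del: szego.simps prod.lessThan_Suc)
      also have "\<dots> = R (Suc k) * (C * W k) $$ (i, Suc k)"
        using Suc.prems i by (simp add: mult_mat_index_sum[of _ n] sum_distrib_left mult.left_commute
            del: index_mult_mat(1) prod.lessThan_Suc of_real_prod of_real_mult)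
      finally show ?thesis by (simp only: cmv_mult_alt_prod[OF n v])
    qed
    show ?case using S R Z by (simp del: szego.simps szego_rev.simps alt_prod.simps prod.lessThan_Suc)
  qed
  then show "poly_mat (szego_rev a k) C $$ (i, 0) = R k * W k $$ (i, k)"
    and "poly_mat (pCons 0 (szego a k)) C $$ (i, 0) = R k * W (Suc k) $$ (i, k)"
    and "k > 0 \<Longrightarrow> poly_mat (szego a k) C $$ (i, 0) = R k * W (k - 1) $$ (i, k)"
    using assms(2) by blast+
qed

text \<open>At the last index no column \<open>Suc k\<close> remains, so the combination that would
  produce the next Szego vector vanishes: Phi_n(C) kills e_1.\<close>

lemma szego_n_col:
  assumes i: "i < n"
  shows "poly_mat (szego a n) C $$ (i, 0) = 0"
proof -
  obtain k where k: "n = Suc k" using n by (cases n) auto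
  have kn: "k < n" using k by simp
  have "poly_mat (szego a (Suc k)) C $$ (i, 0) =
      R k * (W (Suc k) $$ (i, k) - cnj (a k) * W k $$ (i, k))"
    using i n szego_columns(1,2)[OF kn i]
    by (simp add: poly_mat_diff[of _ n] poly_mat_smult[of _ n] sq_minus_index[of _ n]
        sq_smult_index[of _ n] algebra_simps del: alt_prod.simps)
  also have "\<dots> = 0"
    using alt_prod_Suc_start[OF n v i kn] k by (simp del: alt_prod.simps)
  finally show ?thesis by (simp only: k)
qed

text \<open>The inner product of p(C) e_1 and q(C) e_1, that is, of \<open>p\<close> and
  \<open>q\<close> in L^2 of the spectral measure, before any spectral decomposition is
  available.\<close>

definition krylov_ip :: "complex poly \<Rightarrow> complex poly \<Rightarrow> complex" where
  "krylov_ip p q = (\<Sum>i<n. cnj (poly_mat p C $$ (i, 0)) * poly_mat q C $$ (i, 0))"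

text \<open>The columns of each alternating product are orthonormal. For the mixed product, column
  \<open>k\<close> of the longer word is a combination of columns \<open>k\<close> and
  \<open>k + 1\<close> of the shorter one, and the coefficient of column \<open>k\<close> is the
  conjugate of \<alpha>_k.\<close>

lemma szego_krylov_ip:
  assumes k: "k < n"
  shows "krylov_ip (szego_rev a k) (pCons 0 (szego a k)) = (R k)\<^sup>2 * cnj (a k)"
    and "krylov_ip (szego_rev a k) (szego_rev a k) = (R k)\<^sup>2"
    and "krylov_ip (pCons 0 (szego a k)) (pCons 0 (szego a k)) = (R k)\<^sup>2"
proof -
  have unit: "(\<Sum>i<n. cnj (W m $$ (i, k)) * W m $$ (i, j)) = 1\<^sub>m n $$ (k, j)" if "j < n" for m j
    using arg_cong[OF alt_prod_unitary[OF n v, of m], of "\<lambda>A. A $$ (k, j)"] k that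
    by (simp add: mult_mat_index_sum[of _ n] mat_adjoint_index[of _ n] del: index_mult_mat(1) index_one_mat(1))
  have "(\<Sum>i<n. cnj (c * x i) * (c * y i)) = cnj c * c * (\<Sum>i<n. cnj (x i) * y i)" for c x y
    by (simp add: sum_distrib_left algebra_simps)
  from this[of "R k"]
  have scale: "(\<Sum>i<n. cnj (R k * x i) * (R k * y i)) = (R k)\<^sup>2 * (\<Sum>i<n. cnj (x i) * y i)" for x y
    by (simp only: complex_cnj_complex_of_real power2_eq_square)
  show "krylov_ip (szego_rev a k) (szego_rev a k) = (R k)\<^sup>2"
    "krylov_ip (pCons 0 (szego a k)) (pCons 0 (szego a k)) = (R k)\<^sup>2"
    using unit[OF k, of k] unit[OF k, of "Suc k"] k
    by (simp_all add: krylov_ip_def szego_columns[OF k] scale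
        del: alt_prod.simps of_real_prod complex_cnj_mult)
  have "(\<Sum>i<n. cnj (W k $$ (i, k)) * W (Suc k) $$ (i, k)) =
      (\<Sum>i<n. cnj (W k $$ (i, k)) * (W k $$ (i, k) * cnj (a k) +
        (if Suc k < n then W k $$ (i, Suc k) * rho \<alpha> k else 0)))"
    using k by (intro sum.cong refl) (simp add: alt_prod_Suc_start[OF n v] del: alt_prod.simps)
  also have "\<dots> = (\<Sum>i<n. cnj (W k $$ (i, k)) * W k $$ (i, k)) * cnj (a k) +
      (if Suc k < n then (\<Sum>i<n. cnj (W k $$ (i, k)) * W k $$ (i, Suc k)) * rho \<alpha> k else 0)"
    by (auto simp: sum.distrib distrib_left sum_distrib_right mult.assoc simp del: alt_prod.simps)
  also have "\<dots> = cnj (a k)"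
    using unit[OF k, of k] unit[of "Suc k" k] k by (simp del: alt_prod.simps)
  finally show "krylov_ip (szego_rev a k) (pCons 0 (szego a k)) = (R k)\<^sup>2 * cnj (a k)"
    by (simp add: krylov_ip_def szego_columns[OF k] scale
        del: alt_prod.simps of_real_prod complex_cnj_mult)
qed

lemma prod_rho_nonzero:
  assumes "k < n"
  shows "R k \<noteq> 0"
proof -
  have "(\<Prod>j<k. rho \<alpha> j) > 0"
    using assms by (intro prod_pos rho_pos[OF n v]) auto
  then show ?thesis by (simp only: of_real_eq_0_iff)
qed

text \<open>\<open>Q\<close> commutes with polynomials in the CMV matrix, so it kills every p(C)
  e_1, and these include column \<open>k\<close> of the alternating product of length
  \<open>k\<close>, or \<open>k - 1\<close> when \<open>k\<close> is odd. That length is even, so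
  the product is a power of C, commutes with \<open>Q\<close> and is invertible; hence column
  \<open>k\<close> of \<open>Q\<close> itself is zero.\<close>

lemma cmv_cyclic:
  assumes q: "\<And>i. i < n \<Longrightarrow> poly_mat q C $$ (i, 0) = 0"
  shows "poly_mat q C = 0\<^sub>m n n"
proof -
  define Q where "Q = poly_mat q C"
  have Q [simp]: "Q \<in> carrier_mat n n" by (simp add: Q_def)
  have col0: "(Q * poly_mat p C) $$ (i, 0) = 0" if "i < n" for i p
    using that n q unfolding Q_def poly_mat_commute[OF cmv_matrix_carrier, of q p]
    by (simp add: mult_mat_index_sum[of _ n] del: index_mult_mat(1))
  have even: "Q $$ (i, k) = 0"
    if k: "k < n" and m: "even m" and i: "i < n"
      and p: "\<And>i. i < n \<Longrightarrow> poly_mat p C $$ (i, 0) = R k * W m $$ (i, k)" for k m p i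
  proof -
    have z: "(Q * W m) $$ (j, k) = 0" if j: "j < n" for j
    proof -
      have "R k * (Q * W m) $$ (j, k) = (Q * poly_mat p C) $$ (j, 0)"
        using j k n by (simp add: mult_mat_index_sum[of _ n] p sum_distrib_left mult.left_commute
          del: index_mult_mat(1) of_real_prod)
      then show ?thesis using col0[OF j] prod_rho_nonzero[OF k] by simp
    qed
    have "W m * Q = Q * W m"
      unfolding Q_def by (rule commute_poly_mat[OF cmv_matrix_carrier alt_prod_carrier alt_prod_even_commute[OF n v m]])
    then have "mat_adjoint (W m) * (Q * W m) = (mat_adjoint (W m) * W m) * Q"
      by (simp add: assoc_mult_mat[of _ n n _ n _ n])
    also have "\<dots> = Q"
      unfolding alt_prod_unitary[OF n v] by (simp add: left_mult_one_mat[of _ n n])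
    finally have "Q $$ (i, k) = (\<Sum>l<n. mat_adjoint (W m) $$ (i, l) * (Q * W m) $$ (l, k))"
      using i k mult_mat_index_sum[of "mat_adjoint (W m)" n "Q * W m" i k] by simp
    also have "\<dots> = 0" using z by (simp del: index_mult_mat(1))
    finally show ?thesis .
  qed
  have "Q $$ (i, k) = 0" if "i < n" "k < n" for i k
  proof (cases "even k")
    case True
    then show ?thesis using even[OF that(2) True that(1) szego_columns(1)] that by blast
  next
    case False
    then have "k > 0" "even (k - 1)" by (auto simp: odd_pos)
    then show ?thesis using even[OF that(2) _ that(1) szego_columns(3)] that by blast
  qed
  then show ?thesis unfolding Q_def[symmetric] by (intro sq_eqI[of _ n]) auto
qed

end

subsection \<open>Orthogonal polynomials of a finite measure on the unit circle\<close>

lemma degree_szego: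
  "degree (szego a k) \<le> k" "degree (szego_rev a k) \<le> k"
proof (induction k)
  case (Suc k)
  {
    case 1
    show ?case unfolding szego.simps
      using Suc by (intro degree_diff_le order_trans[OF degree_pCons_le] order_trans[OF degree_smult_le]) auto
  next
    case 2
    show ?case unfolding szego_rev.simps
      using Suc by (intro degree_diff_le order_trans[OF degree_smult_le] order_trans[OF degree_pCons_le]) auto
  }
qed auto

lemma szego_monic: "coeff (szego a k) k = 1"
  using degree_szego(2)[of a] by (induction k) (auto simp: coeff_eq_0 less_Suc_eq_le)

lemma szego_rev_coeff_0: "coeff (szego_rev a k) 0 = 1"
  by (induction k) auto

lemma szego_Suc_coeff_0: "coeff (szego a (Suc k)) 0 = - cnj (a k)"
  by (simp add: szego_rev_coeff_0)

definition circle_ip :: "'j set \<Rightarrow> ('j \<Rightarrow> real) \<Rightarrow> ('j \<Rightarrow> complex) \<Rightarrow> complex poly \<Rightarrow> complex poly \<Rightarrow> complex" where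
  "circle_ip J \<mu> z p q = (\<Sum>j\<in>J. of_real (\<mu> j) * cnj (poly p (z j)) * poly q (z j))"

lemma circle_ip_diff_right: "circle_ip J \<mu> z p (q - r) = circle_ip J \<mu> z p q - circle_ip J \<mu> z p r"
  by (simp add: circle_ip_def algebra_simps sum_subtractf)

lemma circle_ip_smult_right: "circle_ip J \<mu> z p (Polynomial.smult c q) = c * circle_ip J \<mu> z p q"
  by (simp add: circle_ip_def algebra_simps sum_distrib_left)

lemma circle_ip_cnj: "cnj (circle_ip J \<mu> z p q) = circle_ip J \<mu> z q p"
  by (simp add: circle_ip_def algebra_simps)

text \<open>Multiplication by x is an isometry for a measure carried by the unit circle.\<close>

lemma circle_ip_shift:
  assumes "\<And>j. j \<in> J \<Longrightarrow> cmod (z j) = 1"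
  shows "circle_ip J \<mu> z (pCons 0 p) (pCons 0 q) = circle_ip J \<mu> z p q"
proof -
  have "cnj (z j) * z j = 1" if "j \<in> J" for j
    using assms[OF that] complex_norm_square[of "z j"] by (simp add: mult.commute)
  moreover have "cnj (z j * x) * (z j * y) = (cnj (z j) * z j) * (cnj x * y)" for j x y
    by simp
  ultimately have "cnj (z j * x) * (z j * y) = cnj x * y" if "j \<in> J" for j x y
    using that by simp
  then show ?thesis
    unfolding circle_ip_def by (intro sum.cong refl) (simp add: mult.assoc)
qed

lemma circle_ip_expand:
  assumes "degree p \<le> N"
  shows "circle_ip J \<mu> z p q = (\<Sum>i\<le>N. cnj (coeff p i) * circle_ip J \<mu> z (monom 1 i) q)"
proof -
  have p: "poly p x = (\<Sum>i\<le>N. coeff p i * x ^ i)" for x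
  proof -
    have "poly p x = (\<Sum>i\<le>degree p. coeff p i * x ^ i)" by (rule poly_altdef)
    also have "\<dots> = (\<Sum>i\<le>N. coeff p i * x ^ i)"
      using assms by (intro sum.mono_neutral_left) (auto simp: coeff_eq_0)
    finally show ?thesis .
  qed
  show ?thesis
    unfolding circle_ip_def p poly_monom
    by (simp add: sum_distrib_left sum_distrib_right algebra_simps) (rule sum.swap)
qed

text \<open>The matrix side supplies only three inner products per index. The shift isometry and the
  induction hypothesis settle the middle monomials for both new polynomials; each then has one
  exceptional monomial, of exponent 0 and \<open>Suc k\<close> respectively, where the given inner
  products are spent.\<close>

lemma szego_orthogonal:
  assumes circ: "\<And>j. j \<in> J \<Longrightarrow> cmod (z j) = 1"
    and ip1: "\<And>k. k < K \<Longrightarrow> circle_ip J \<mu> z (szego_rev a k) (pCons 0 (szego a k)) = of_real (r k) * cnj (a k)"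
    and ip2: "\<And>k. k < K \<Longrightarrow> circle_ip J \<mu> z (szego_rev a k) (szego_rev a k) = of_real (r k)"
    and ip3: "\<And>k. k < K \<Longrightarrow> circle_ip J \<mu> z (pCons 0 (szego a k)) (pCons 0 (szego a k)) = of_real (r k)"
    and "k \<le> K"
  shows "(\<forall>i<k. circle_ip J \<mu> z (monom 1 i) (szego a k) = 0) \<and>
    (\<forall>i\<in>{1..k}. circle_ip J \<mu> z (monom 1 i) (szego_rev a k) = 0)"
  using \<open>k \<le> K\<close>
proof (induction k)
  case (Suc k)
  then have k: "k < K" and P: "\<And>i. i < k \<Longrightarrow> circle_ip J \<mu> z (monom 1 i) (szego a k) = 0"
    and S: "\<And>i. 1 \<le> i \<Longrightarrow> i \<le> k \<Longrightarrow> circle_ip J \<mu> z (monom 1 i) (szego_rev a k) = 0"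
    by auto
  have zP: "circle_ip J \<mu> z (monom 1 i) (pCons 0 (szego a k)) = 0" if i: "1 \<le> i" "i \<le> k" for i
  proof -
    obtain i' where "i = Suc i'" using i by (cases i) auto
    with i show ?thesis by (simp add: monom_Suc circle_ip_shift[OF circ] P)
  qed
  have P': "circle_ip J \<mu> z (monom 1 i) (szego a (Suc k)) = 0" if "1 \<le> i" "i \<le> k" for i
    using zP[OF that] S[OF that] by (simp add: circle_ip_diff_right circle_ip_smult_right)
  have S': "circle_ip J \<mu> z (monom 1 i) (szego_rev a (Suc k)) = 0" if "1 \<le> i" "i \<le> k" for i
    using zP[OF that] S[OF that] by (simp add: circle_ip_diff_right circle_ip_smult_right del: smult_pCons)
  \<comment> \<open>Expanded in monomials, the reversed polynomial has constant coefficient 1, and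
    all its other monomials are already orthogonal to Phi_{k+1}; only the monomial of exponent 0
    survives.\<close>
  have "circle_ip J \<mu> z (szego_rev a k) (szego a (Suc k)) = 0"
    using ip1[OF k] ip2[OF k] by (simp add: circle_ip_diff_right circle_ip_smult_right mult.commute)
  also have "circle_ip J \<mu> z (szego_rev a k) (szego a (Suc k)) =
      (\<Sum>i\<le>k. if i = 0 then circle_ip J \<mu> z (monom 1 0) (szego a (Suc k)) else 0)"
    unfolding circle_ip_expand[OF degree_szego(2)]
    by (intro sum.cong refl) (auto simp: szego_rev_coeff_0 P' simp del: szego.simps)
  finally have P0: "circle_ip J \<mu> z (monom 1 0) (szego a (Suc k)) = 0" by simp
  have "circle_ip J \<mu> z (pCons 0 (szego a k)) (szego_rev a k) = of_real (r k) * a k"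
    using ip1[OF k] circle_ip_cnj[of J \<mu> z "szego_rev a k" "pCons 0 (szego a k)"] by simp
  then have "circle_ip J \<mu> z (pCons 0 (szego a k)) (szego_rev a (Suc k)) = 0"
    using ip3[OF k] by (simp add: circle_ip_diff_right circle_ip_smult_right mult.commute del: smult_pCons)
  \<comment> \<open>Dually, x Phi_k has no constant term and leading coefficient 1, so only the top
    monomial survives.\<close>
  also have "circle_ip J \<mu> z (pCons 0 (szego a k)) (szego_rev a (Suc k)) =
      (\<Sum>i\<le>Suc k. if i = Suc k then circle_ip J \<mu> z (monom 1 (Suc k)) (szego_rev a (Suc k)) else 0)"
  proof (subst circle_ip_expand[of _ "Suc k"])
    show "degree (pCons 0 (szego a k)) \<le> Suc k"
      using degree_szego(1)[of a k] by (intro order_trans[OF degree_pCons_le]) simp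
    have "coeff (pCons 0 (szego a k)) i = 0 \<or> (1 \<le> i \<and> i \<le> k)" if "i \<le> Suc k" "i \<noteq> Suc k" for i
      using that by (cases i) auto
    then show "(\<Sum>i\<le>Suc k. cnj (coeff (pCons 0 (szego a k)) i) * circle_ip J \<mu> z (monom 1 i) (szego_rev a (Suc k))) =
      (\<Sum>i\<le>Suc k. if i = Suc k then circle_ip J \<mu> z (monom 1 (Suc k)) (szego_rev a (Suc k)) else 0)"
      using S' by (intro sum.cong refl) (force simp: szego_monic simp del: szego_rev.simps)
  qed
  finally have Sk: "circle_ip J \<mu> z (monom 1 (Suc k)) (szego_rev a (Suc k)) = 0" by simp
  have "circle_ip J \<mu> z (monom 1 i) (szego a (Suc k)) = 0" if "i < Suc k" for i
    using that P0 P'[of i] by (cases "i = 0") (auto simp del: szego.simps)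
  moreover have "circle_ip J \<mu> z (monom 1 i) (szego_rev a (Suc k)) = 0" if "1 \<le> i" "i \<le> Suc k" for i
    using that Sk S'[of i] by (cases "i = Suc k") (auto simp del: szego_rev.simps)
  ultimately show ?case by (auto simp del: szego.simps szego_rev.simps)
qed auto

subsection \<open>Lagrange interpolation and divided differences\<close>

lemma poly_eq_0_if_many_roots:
  fixes p :: "'a :: field poly"
  assumes J: "finite J" "inj_on z J" and roots: "\<And>j. j \<in> J \<Longrightarrow> poly p (z j) = 0"
    and deg: "degree p < card J"
  shows "p = 0"
proof (rule ccontr)
  assume "p \<noteq> 0"
  then have "card (z ` J) \<le> degree p"
    using roots poly_roots_degree[of p] card_mono[OF poly_roots_finite[of p], of "z ` J"] by force
  then show False using deg card_image[OF J(2)] by simp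
qed

definition lagrange :: "'j set \<Rightarrow> ('j \<Rightarrow> 'a :: field) \<Rightarrow> 'j \<Rightarrow> 'a poly" where
  "lagrange J z j = Polynomial.smult (inverse (\<Prod>i\<in>J - {j}. z j - z i)) (\<Prod>i\<in>J - {j}. [:- z i, 1:])"

lemma monic_prod_linear:
  fixes z :: "'j \<Rightarrow> 'a :: field"
  assumes "finite J"
  shows "degree (\<Prod>i\<in>J. [:- z i, 1:]) = card J" "coeff (\<Prod>i\<in>J. [:- z i, 1:]) (card J) = 1"
proof -
  show d: "degree (\<Prod>i\<in>J. [:- z i, 1:]) = card J"
    using assms by (induction J) (auto simp: degree_mult_eq simp del: mult_pCons_left)
  have "lead_coeff (\<Prod>i\<in>J. [:- z i, 1:]) = 1"
    by (simp add: lead_coeff_prod)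
  then show "coeff (\<Prod>i\<in>J. [:- z i, 1:]) (card J) = 1" by (simp only: d)
qed

lemma poly_lagrange:
  assumes J: "finite J" "inj_on z J" and ij: "i \<in> J" "j \<in> J"
  shows "poly (lagrange J z j) (z i) = (if i = j then 1 else 0)"
proof (cases "i = j")
  case True
  have "(\<Prod>i\<in>J - {j}. z j - z i) \<noteq> 0"
    using J ij by (auto dest: inj_onD)
  with True show ?thesis by (simp add: lagrange_def poly_prod)
next
  case False
  then have "(\<Prod>l\<in>J - {j}. poly [:- z l, 1:] (z i)) = 0"
    using J ij by (intro prod_zero) auto
  with False show ?thesis unfolding lagrange_def poly_smult poly_prod by simp
qed

lemma degree_lagrange:
  assumes "finite J" "j \<in> J"
  shows "degree (lagrange J z j) < card J"
proof -
  have "degree (lagrange J z j) \<le> card (J - {j})"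
    unfolding lagrange_def using monic_prod_linear(1)[of "J - {j}" z] assms
    by (metis degree_smult_le finite_Diff)
  also have "\<dots> < card J" using assms by (rule card_Diff1_less)
  finally show ?thesis .
qed

text \<open>The sum is the coefficient of exponent \<open>card J - 1\<close> in the Lagrange
  interpolant of \<open>p\<close>. The interpolant is \<open>p\<close> itself, whose degree is
  smaller.\<close>

lemma divided_difference_eq_0:
  fixes z :: "'j \<Rightarrow> 'a :: field"
  assumes J: "finite J" "inj_on z J" and deg: "Suc (degree p) < card J"
  shows "(\<Sum>j\<in>J. poly p (z j) / (\<Prod>i\<in>J - {j}. z j - z i)) = 0"
proof -
  define q where "q = (\<Sum>j\<in>J. Polynomial.smult (poly p (z j)) (lagrange J z j))"
  have dl: "degree (lagrange J z j) \<le> card J - 1" if "j \<in> J" for j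
    using degree_lagrange[OF J(1) that, of z] by linarith
  have "degree q \<le> card J - 1"
    unfolding q_def
    by (intro degree_sum_le[OF J(1)] order_trans[OF degree_smult_le]) (rule dl)
  then have "degree (p - q) \<le> card J - 1" using deg by (intro degree_diff_le) auto
  then have d: "degree (p - q) < card J" using deg by linarith
  have "p - q = 0"
  proof (rule poly_eq_0_if_many_roots[OF J _ d])
    fix i assume i: "i \<in> J"
    have "poly q (z i) = (\<Sum>j\<in>J. if j = i then poly p (z i) else 0)"
      unfolding q_def poly_sum poly_smult
      by (intro sum.cong refl) (auto simp: poly_lagrange[OF J i])
    then show "poly (p - q) (z i) = 0" using i J by simp
  qed
  then have "q = p" by simp
  then have "0 = coeff q (card J - 1)" using deg by (simp add: coeff_eq_0)
  also have "\<dots> = (\<Sum>j\<in>J. poly p (z j) / (\<Prod>i\<in>J - {j}. z j - z i))"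
    unfolding q_def coeff_sum
  proof (intro sum.cong refl)
    fix j assume j: "j \<in> J"
    have "coeff (\<Prod>i\<in>J - {j}. [:- z i, 1:]) (card J - 1) = 1"
      using monic_prod_linear(2)[of "J - {j}" z] J j by (simp add: card_Diff_singleton)
    then show "coeff (Polynomial.smult (poly p (z j)) (lagrange J z j)) (card J - 1) =
        poly p (z j) / (\<Prod>i\<in>J - {j}. z j - z i)"
      by (simp add: lagrange_def divide_inverse)
  qed
  finally show ?thesis by simp
qed

subsection \<open>Heine's formula\<close>

text \<open>The inner product runs over ordered pairs, so every unordered pair contributes |z_i -
  z_j| twice. This gives the squared Vandermonde modulus without an order on the index type.\<close>

definition vdm_weight :: "('j \<Rightarrow> real) \<Rightarrow> ('j \<Rightarrow> complex) \<Rightarrow> 'j set \<Rightarrow> real" where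
  "vdm_weight \<mu> z I = (\<Prod>i\<in>I. \<mu> i * (\<Prod>j\<in>I - {i}. cmod (z i - z j)))"

lemma vdm_weight_insert:
  assumes I: "finite I" "a \<notin> I"
  shows "vdm_weight \<mu> z (insert a I) = vdm_weight \<mu> z I * \<mu> a * (\<Prod>i\<in>I. (cmod (z a - z i))\<^sup>2)"
proof -
  have "(\<Prod>j\<in>insert a I - {i}. cmod (z i - z j)) = cmod (z a - z i) * (\<Prod>j\<in>I - {i}. cmod (z i - z j))"
    if "i \<in> I" for i
  proof -
    have "insert a I - {i} = insert a (I - {i})" using that I by auto
    then show ?thesis using I by (simp add: norm_minus_commute)
  qed
  then have "vdm_weight \<mu> z (insert a I) = \<mu> a * (\<Prod>j\<in>I. cmod (z a - z j)) *
      (\<Prod>i\<in>I. \<mu> i * (cmod (z a - z i) * (\<Prod>j\<in>I - {i}. cmod (z i - z j))))"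
    using I by (simp add: vdm_weight_def)
  also have "\<dots> = vdm_weight \<mu> z I * \<mu> a * (\<Prod>i\<in>I. (cmod (z a - z i))\<^sup>2)"
    by (simp add: vdm_weight_def prod.distrib power2_eq_square algebra_simps)
  finally show ?thesis .
qed

lemma vdm_weight_pos:
  assumes "finite J" "I \<subseteq> J" "inj_on z J" "\<And>j. j \<in> J \<Longrightarrow> \<mu> j > 0"
  shows "vdm_weight \<mu> z I > 0"
  unfolding vdm_weight_def
  using assms by (intro prod_pos ballI mult_pos_pos) (auto dest: inj_onD)

definition heine :: "'j set \<Rightarrow> ('j \<Rightarrow> real) \<Rightarrow> ('j \<Rightarrow> complex) \<Rightarrow> nat \<Rightarrow> complex poly" where
  "heine J \<mu> z k = (\<Sum>I | I \<subseteq> J \<and> card I = k.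
     Polynomial.smult (of_real (vdm_weight \<mu> z I)) (\<Prod>i\<in>I. [:- z i, 1:]))"

text \<open>Only pairs (I, j) with j outside I contribute, because the product over I vanishes at
  its own nodes. Grouping by L = I + {j} extracts the weight of L and leaves, for each L, the
  conjugate of the divided difference of x^m over its k + 1 nodes.\<close>

lemma heine_orthogonal:
  assumes J: "finite J" "inj_on z J" and m: "m < k"
  shows "circle_ip J \<mu> z (monom 1 m) (heine J \<mu> z k) = 0"
proof -
  define S where "S k = {I. I \<subseteq> J \<and> card I = k}" for k
  have finS: "finite (S k)" for k
    using J by (auto simp: S_def intro: finite_subset[of _ "Pow J"])
  have finI: "finite I" if "I \<in> S k" for I k
    using that J by (auto simp: S_def intro: finite_subset)
  define F where "F I j = of_real (\<mu> j) * cnj (z j ^ m) * (of_real (vdm_weight \<mu> z I) * (\<Prod>i\<in>I. z j - z i))"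
    for I j
  have "circle_ip J \<mu> z (monom 1 m) (heine J \<mu> z k) = (\<Sum>j\<in>J. \<Sum>I\<in>S k. F I j)"
    unfolding circle_ip_def heine_def S_def[symmetric] F_def
    by (simp add: poly_sum poly_prod poly_monom sum_distrib_left)
  also have "\<dots> = (\<Sum>I\<in>S k. \<Sum>j\<in>J. F I j)" by (rule sum.swap)
  also have "\<dots> = (\<Sum>I\<in>S k. \<Sum>j\<in>J - I. F I j)"
  proof (rule sum.cong[OF refl])
    fix I assume I: "I \<in> S k"
    have "F I j = 0" if "j \<in> J - (J - I)" for j
    proof -
      have "(\<Prod>i\<in>I. z j - z i) = 0" using that finI[OF I] by (intro prod_zero) auto
      then show "F I j = 0" by (simp add: F_def)
    qed
    then show "sum (F I) J = sum (F I) (J - I)"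
      using J(1) by (intro sum.mono_neutral_right) auto
  qed
  also have "\<dots> = (\<Sum>(I, j)\<in>Sigma (S k) (\<lambda>I. J - I). F I j)"
    using finS J by (intro sum.Sigma) auto
  also have "\<dots> = (\<Sum>(L, j)\<in>Sigma (S (Suc k)) (\<lambda>L. L). F (L - {j}) j)"
  proof -
    have up: "insert j I \<in> S (Suc k)" "insert j I - {j} = I" if "I \<in> S k" "j \<in> J" "j \<notin> I" for I j
      using that finI[OF that(1)] by (simp_all add: S_def)
    have down: "L - {j} \<in> S k" "j \<in> J" "insert j (L - {j}) = L" if "L \<in> S (Suc k)" "j \<in> L" for L j
      using that finI[OF that(1)] by (auto simp: S_def)
    show ?thesis
      by (rule sum.reindex_bij_witness[of _ "\<lambda>(L, j). (L - {j}, j)" "\<lambda>(I, j). (insert j I, j)"])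
        (auto simp: up down(1) insert_absorb dest: down(2))
  qed
  also have "\<dots> = (\<Sum>L\<in>S (Suc k). \<Sum>j\<in>L. F (L - {j}) j)"
    using finS finI by (intro sum.Sigma[symmetric]) auto
  also have "\<dots> = (\<Sum>L\<in>S (Suc k). 0)"
  proof (intro sum.cong refl)
    fix L assume L: "L \<in> S (Suc k)"
    have injL: "inj_on z L" using L J by (auto simp: S_def intro: inj_on_subset)
    \<comment> \<open>The weight of L exceeds that of L - {j} by mu_j times Q times its conjugate;
      the factor Q already present in \<open>F\<close> leaves the conjugate of 1/Q.\<close>
    have "F (L - {j}) j = of_real (vdm_weight \<mu> z L) * cnj (poly (monom 1 m) (z j) / (\<Prod>i\<in>L - {j}. z j - z i))"
      if j: "j \<in> L" for j
    proof -
      define Q where "Q = (\<Prod>i\<in>L - {j}. z j - z i)"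
      have Q: "Q \<noteq> 0"
        using injL j finI[OF L] by (auto simp: Q_def dest: inj_onD)
      have "L = insert j (L - {j})" using j by auto
      then have "vdm_weight \<mu> z L = vdm_weight \<mu> z (L - {j}) * \<mu> j * (\<Prod>i\<in>L - {j}. (cmod (z j - z i))\<^sup>2)"
        using vdm_weight_insert[of "L - {j}" j \<mu> z] finI[OF L] by auto
      moreover have "complex_of_real (\<Prod>i\<in>L - {j}. (cmod (z j - z i))\<^sup>2) = Q * cnj Q"
        unfolding Q_def of_real_prod cnj_prod prod.distrib[symmetric] complex_norm_square ..
      ultimately have "complex_of_real (vdm_weight \<mu> z L) = of_real (vdm_weight \<mu> z (L - {j})) * of_real (\<mu> j) * (Q * cnj Q)"
        by (simp only: of_real_mult)
      then show ?thesis using Q unfolding F_def Q_def[symmetric] poly_monom by (simp add: divide_simps)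
    qed
    then have "(\<Sum>j\<in>L. F (L - {j}) j) = of_real (vdm_weight \<mu> z L) *
        cnj (\<Sum>j\<in>L. poly (monom 1 m) (z j) / (\<Prod>i\<in>L - {j}. z j - z i))"
      by (simp add: sum_distrib_left)
    also have "(\<Sum>j\<in>L. poly (monom 1 m) (z j) / (\<Prod>i\<in>L - {j}. z j - z i)) = 0"
      using L m by (intro divided_difference_eq_0 finI[OF L] injL) (auto simp: S_def degree_monom_eq)
    finally show "(\<Sum>j\<in>L. F (L - {j}) j) = 0" by simp
  qed
  finally show ?thesis by simp
qed

lemma circle_ip_self_eq_0:
  assumes J: "finite J" and \<mu>: "\<And>j. j \<in> J \<Longrightarrow> \<mu> j > 0" and 0: "circle_ip J \<mu> z p p = 0" and j: "j \<in> J"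
  shows "poly p (z j) = 0"
proof -
  have *: "circle_ip J \<mu> z p p = of_real (\<Sum>j\<in>J. \<mu> j * (cmod (poly p (z j)))\<^sup>2)"
    unfolding circle_ip_def of_real_sum of_real_mult complex_norm_square
    by (intro sum.cong refl) (simp add: algebra_simps)
  then have "(\<Sum>j\<in>J. \<mu> j * (cmod (poly p (z j)))\<^sup>2) = 0"
    using 0 * by (metis of_real_eq_0_iff)
  then have "\<mu> j * (cmod (poly p (z j)))\<^sup>2 = 0"
    using J \<mu> j by (subst (asm) sum_nonneg_eq_0_iff) (auto simp: less_imp_le)
  then show ?thesis using \<mu>[OF j] by simp
qed

text \<open>The leading terms cancel in the difference \<open>d\<close>, so it is a combination of
  lower monomials, to all of which it is orthogonal. Hence it has norm zero and vanishes at every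
  node.\<close>

lemma szego_heine:
  assumes J: "finite J" "inj_on z J" and \<mu>: "\<And>j. j \<in> J \<Longrightarrow> \<mu> j > 0" and k: "k \<le> card J"
    and orth: "\<And>i. i < k \<Longrightarrow> circle_ip J \<mu> z (monom 1 i) (szego a k) = 0"
  shows "Polynomial.smult (of_real (\<Sum>I | I \<subseteq> J \<and> card I = k. vdm_weight \<mu> z I)) (szego a k) = heine J \<mu> z k"
proof -
  define S where "S = {I. I \<subseteq> J \<and> card I = k}"
  define D where "D = (\<Sum>I\<in>S. vdm_weight \<mu> z I)"
  define d where "d = Polynomial.smult (of_real D) (szego a k) - heine J \<mu> z k"
  have finI: "finite I" if "I \<in> S" for I
    using that J by (auto simp: S_def intro: finite_subset)
  have dh: "degree (heine J \<mu> z k) \<le> k"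
    unfolding heine_def S_def[symmetric]
  proof (rule degree_sum_le)
    show "finite S" using J by (auto simp: S_def intro: finite_subset[of _ "Pow J"])
    fix I assume I: "I \<in> S"
    have "degree (\<Prod>i\<in>I. [:- z i, 1:]) = k"
      using monic_prod_linear(1)[OF finI[OF I], of z] I by (simp add: S_def)
    then show "degree (Polynomial.smult (of_real (vdm_weight \<mu> z I)) (\<Prod>i\<in>I. [:- z i, 1:])) \<le> k"
      using degree_smult_le by metis
  qed
  have "coeff (heine J \<mu> z k) k = (\<Sum>I\<in>S. of_real (vdm_weight \<mu> z I))"
    unfolding heine_def S_def[symmetric] coeff_sum
  proof (intro sum.cong refl)
    fix I assume I: "I \<in> S"
    have "coeff (\<Prod>i\<in>I. [:- z i, 1:]) k = 1"
      using monic_prod_linear(2)[OF finI[OF I], of z] I by (simp add: S_def)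
    then show "coeff (Polynomial.smult (of_real (vdm_weight \<mu> z I)) (\<Prod>i\<in>I. [:- z i, 1:])) k =
        of_real (vdm_weight \<mu> z I)" by simp
  qed
  then have ck: "coeff d k = 0" by (simp add: d_def szego_monic D_def)
  have dd: "degree d \<le> k"
    unfolding d_def using dh degree_szego(1)[of a k]
    by (intro degree_diff_le order_trans[OF degree_smult_le]) auto
  have orth_d: "circle_ip J \<mu> z (monom 1 i) d = 0" if "i < k" for i
    unfolding d_def circle_ip_diff_right circle_ip_smult_right
    using orth[OF that] heine_orthogonal[OF J that, of \<mu>] by simp
  have "circle_ip J \<mu> z d d = 0"
    unfolding circle_ip_expand[OF dd]
  proof (rule sum.neutral, rule ballI)
    fix i assume "i \<in> {..k}"
    then show "cnj (coeff d i) * circle_ip J \<mu> z (monom 1 i) d = 0"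
      using ck orth_d[of i] by (cases "i = k") auto
  qed
  then have roots: "poly d (z j) = 0" if "j \<in> J" for j
    using circle_ip_self_eq_0[of J \<mu> z d j] J \<mu> that by blast
  have "d = 0"
  proof (rule ccontr)
    assume "d \<noteq> 0"
    \<comment> \<open>The drop in degree is what admits the case \<open>k = card J\<close>, where a
      polynomial of degree \<open>k\<close> may vanish at all nodes.\<close>
    then have "degree d \<noteq> k" using ck by auto
    then have "degree d < card J" using dd k by simp
    then show False using poly_eq_0_if_many_roots[OF J roots] \<open>d \<noteq> 0\<close> by simp
  qed
  then show ?thesis by (simp add: d_def D_def S_def)
qed

text \<open>Evaluation of the explicit polynomial at 0. The \<open>Suc k\<close> factors -z_i and
  the sign in Phi_{k+1}(0) = - cnj \<alpha>_k combine to (-1)^k, and a final conjugation moves the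
  bars to the nodes.\<close>

lemma verblunsky_heine:
  assumes J: "finite J" "inj_on z J" and \<mu>: "\<And>j. j \<in> J \<Longrightarrow> \<mu> j > 0" and k: "Suc k \<le> card J"
    and orth: "\<And>i. i < Suc k \<Longrightarrow> circle_ip J \<mu> z (monom 1 i) (szego a (Suc k)) = 0"
  shows "a k = (-1) ^ k * (\<Sum>I | I \<subseteq> J \<and> card I = Suc k. of_real (vdm_weight \<mu> z I) * (\<Prod>i\<in>I. cnj (z i))) /
    of_real (\<Sum>I | I \<subseteq> J \<and> card I = Suc k. vdm_weight \<mu> z I)"
proof -
  define S where "S = {I. I \<subseteq> J \<and> card I = Suc k}"
  define D where "D = (\<Sum>I\<in>S. vdm_weight \<mu> z I)"
  have "finite S" using J by (auto simp: S_def intro: finite_subset[of _ "Pow J"])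
  moreover have "S \<noteq> {}" using obtain_subset_with_card_n[OF k] by (auto simp: S_def)
  moreover have "vdm_weight \<mu> z I > 0" if "I \<in> S" for I
    using that by (intro vdm_weight_pos[OF J(1) _ J(2) \<mu>]) (auto simp: S_def)
  ultimately have D: "D > 0" unfolding D_def by (intro sum_pos) auto
  have "coeff (Polynomial.smult (of_real D) (szego a (Suc k))) 0 = coeff (heine J \<mu> z (Suc k)) 0"
    using szego_heine[OF J \<mu> k orth] by (simp only: D_def S_def)
  then have "- of_real D * cnj (a k) = (\<Sum>I\<in>S. of_real (vdm_weight \<mu> z I) * (\<Prod>i\<in>I. - z i))"
    unfolding heine_def coeff_sum coeff_smult szego_Suc_coeff_0 S_def[symmetric]
    by (simp add: poly_0_coeff_0[symmetric] poly_prod)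
  also have "\<dots> = (\<Sum>I\<in>S. (-1) ^ Suc k * (of_real (vdm_weight \<mu> z I) * (\<Prod>i\<in>I. z i)))"
  proof (intro sum.cong refl)
    fix I assume "I \<in> S"
    then have "(\<Prod>i\<in>I. - z i) = (-1) ^ Suc k * (\<Prod>i\<in>I. z i)"
      using prod.distrib[of "\<lambda>_. -1" z I] by (simp add: S_def)
    then show "of_real (vdm_weight \<mu> z I) * (\<Prod>i\<in>I. - z i) =
      (-1) ^ Suc k * (of_real (vdm_weight \<mu> z I) * (\<Prod>i\<in>I. z i))" by simp
  qed
  also have "\<dots> = - ((-1) ^ k * (\<Sum>I\<in>S. of_real (vdm_weight \<mu> z I) * (\<Prod>i\<in>I. z i)))"
    by (simp add: sum_distrib_left sum_negf)
  finally have "of_real D * cnj (a k) = (-1) ^ k * (\<Sum>I\<in>S. of_real (vdm_weight \<mu> z I) * (\<Prod>i\<in>I. z i))"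
    by simp
  then have "cnj (of_real D * cnj (a k)) = cnj ((-1) ^ k * (\<Sum>I\<in>S. of_real (vdm_weight \<mu> z I) * (\<Prod>i\<in>I. z i)))"
    by simp
  then have "of_real D * a k = (-1) ^ k * (\<Sum>I\<in>S. of_real (vdm_weight \<mu> z I) * (\<Prod>i\<in>I. cnj (z i)))"
    by simp
  then show ?thesis using D unfolding S_def[symmetric] D_def[symmetric]
    by (simp add: nonzero_eq_divide_eq mult.commute)
qed

subsection \<open>Spectral projections of a unitary matrix\<close>

lemma poly_mat_eigen:
  assumes U: "U \<in> carrier_mat n n" and X: "X \<in> carrier_mat n n" and eig: "U * X = c \<cdot>\<^sub>m X"
  shows "poly_mat g U * X = poly g c \<cdot>\<^sub>m X"
proof (induction g)
  case 0
  then show ?case using U X left_mult_zero_mat[OF X, of n]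
    by (auto simp: poly_mat_0[OF U] intro!: sq_eqI[of _ n])
next
  case (pCons a g)
  have gU: "poly_mat g U * U = U * poly_mat g U"
    using poly_mat_commute[OF U, of g "[:0, 1:]"] by (simp only: poly_mat_X[OF U])
  have "poly_mat (pCons a g) U * X = (a \<cdot>\<^sub>m 1\<^sub>m n) * X + (poly_mat g U * U) * X"
    using U X unfolding poly_mat_pCons[OF U] gU by (simp add: add_mult_distrib_mat[of _ n n _ _ n])
  also have "(poly_mat g U * U) * X = poly_mat g U * (c \<cdot>\<^sub>m X)"
    using U X by (simp add: assoc_mult_mat[of _ n n _ n _ n] eig)
  also have "\<dots> = c \<cdot>\<^sub>m (poly g c \<cdot>\<^sub>m X)"
    using U X pCons by (simp add: mult_smult_distrib[of _ n n _ n])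
  also have "(a \<cdot>\<^sub>m 1\<^sub>m n) * X = a \<cdot>\<^sub>m X"
    using X by (simp add: mult_smult_assoc_mat[of _ n n _ n] left_mult_one_mat[of _ n n])
  also have "a \<cdot>\<^sub>m X + c \<cdot>\<^sub>m (poly g c \<cdot>\<^sub>m X) = poly (pCons a g) c \<cdot>\<^sub>m X"
    using X by (intro sq_eqI[of _ n]) (auto simp: algebra_simps)
  finally show ?case .
qed

text \<open>Eigenvectors are traded for square matrices whose nonzero columns are eigenvectors, so
  that later arguments stay in one matrix algebra. The witness repeats the eigenvector in every
  column.\<close>

lemma eigenvalue_iff_matrix:
  fixes U :: "complex mat"
  assumes U: "U \<in> carrier_mat n n"
  shows "eigenvalue U c \<longleftrightarrow> (\<exists>X\<in>carrier_mat n n. X \<noteq> 0\<^sub>m n n \<and> U * X = c \<cdot>\<^sub>m X)"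
proof
  assume "eigenvalue U c"
  then obtain v where v: "v \<in> carrier_vec n" "v \<noteq> 0\<^sub>v n" "U *\<^sub>v v = c \<cdot>\<^sub>v v"
    using U by (auto simp: eigenvalue_def eigenvector_def)
  define X where "X = Matrix.mat n n (\<lambda>(i, j). v $ i)"
  have X: "X \<in> carrier_mat n n" by (simp add: X_def)
  have col: "col X j = v" if "j < n" for j using v that by (auto simp: X_def col_def)
  have "X \<noteq> 0\<^sub>m n n"
  proof
    assume 0: "X = 0\<^sub>m n n"
    have "v $ i = 0" if "i < n" for i
      using that arg_cong[OF 0, of "\<lambda>M. M $$ (i, i)"] by (simp add: X_def)
    then have "v = 0\<^sub>v n" using v(1) by (intro eq_vecI) auto
    then show False using v by simp
  qed
  moreover have "U * X = c \<cdot>\<^sub>m X"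
  proof (rule sq_eqI[of _ n])
    fix i j assume ij: "i < n" "j < n"
    have "(U * X) $$ (i, j) = (U *\<^sub>v v) $ i" using ij U X by (simp add: col)
    also have "\<dots> = (c \<cdot>\<^sub>m X) $$ (i, j)" using ij v by (simp add: X_def)
    finally show "(U * X) $$ (i, j) = (c \<cdot>\<^sub>m X) $$ (i, j)" .
  qed (use U X in auto)
  ultimately show "\<exists>X\<in>carrier_mat n n. X \<noteq> 0\<^sub>m n n \<and> U * X = c \<cdot>\<^sub>m X" using X by blast
next
  assume "\<exists>X\<in>carrier_mat n n. X \<noteq> 0\<^sub>m n n \<and> U * X = c \<cdot>\<^sub>m X"
  then obtain X where X: "X \<in> carrier_mat n n" "X \<noteq> 0\<^sub>m n n" "U * X = c \<cdot>\<^sub>m X" by blast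
  have "\<exists>i<n. \<exists>j<n. X $$ (i, j) \<noteq> 0"
  proof (rule ccontr)
    assume "\<not> (\<exists>i<n. \<exists>j<n. X $$ (i, j) \<noteq> 0)"
    then have "X = 0\<^sub>m n n" using X(1) by (intro sq_eqI[of _ n]) auto
    then show False using X(2) by simp
  qed
  then obtain i j where ij: "i < n" "j < n" "X $$ (i, j) \<noteq> 0" by blast
  define v where "v = col X j"
  have "v \<in> carrier_vec n" using X(1) by (intro carrier_vecI) (simp add: v_def)
  moreover have "v $ i \<noteq> 0" using ij X by (simp add: v_def)
  then have "v \<noteq> 0\<^sub>v n" using ij by auto
  moreover have "U *\<^sub>v v = c \<cdot>\<^sub>v v"
  proof (rule eq_vecI)
    fix r assume "r < dim_vec (c \<cdot>\<^sub>v v)"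
    then have r: "r < n" using X by (simp add: v_def)
    have "(U *\<^sub>v v) $ r = (U * X) $$ (r, j)" using r ij U X(1) by (simp add: v_def)
    also have "\<dots> = (c \<cdot>\<^sub>v v) $ r" unfolding X(3) using r ij X by (simp add: v_def)
    finally show "(U *\<^sub>v v) $ r = (c \<cdot>\<^sub>v v) $ r" .
  qed (use U X in \<open>simp add: v_def\<close>)
  ultimately show "eigenvalue U c" using U by (auto simp: eigenvalue_def eigenvector_def)
qed

lemma smult_mat_eq_0_iff:
  fixes X :: "'a :: field mat"
  assumes X: "X \<in> carrier_mat n n"
  shows "c \<cdot>\<^sub>m X = 0\<^sub>m n n \<longleftrightarrow> c = 0 \<or> X = 0\<^sub>m n n"
proof
  assume "c \<cdot>\<^sub>m X = 0\<^sub>m n n"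
  then have "(c \<cdot>\<^sub>m X) $$ (i, j) = 0" if "i < n" "j < n" for i j
    using that by simp
  then have "c * X $$ (i, j) = 0" if "i < n" "j < n" for i j
    using that sq_smult_index[OF X, of i j c] by simp
  then have "c = 0 \<or> (\<forall>i<n. \<forall>j<n. X $$ (i, j) = 0)" by auto
  then show "c = 0 \<or> X = 0\<^sub>m n n" using X sq_eqI[OF X zero_carrier_mat] by auto
qed (use X in \<open>auto intro!: sq_eqI[of _ n]\<close>)

lemma eigenvalue_root:
  assumes U: "U \<in> carrier_mat n n" and "eigenvalue U c" and "poly_mat g U = 0\<^sub>m n n"
  shows "poly g c = 0"
proof -
  obtain X where X: "X \<in> carrier_mat n n" "X \<noteq> 0\<^sub>m n n" "U * X = c \<cdot>\<^sub>m X"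
    using assms eigenvalue_iff_matrix[OF U] by blast
  then have "poly g c \<cdot>\<^sub>m X = 0\<^sub>m n n"
    using poly_mat_eigen[OF U X(1,3), of g] assms(3) by simp
  then show ?thesis using X smult_mat_eq_0_iff[OF X(1)] by blast
qed

lemma mat_adjoint_smult:
  assumes "X \<in> carrier_mat n n"
  shows "mat_adjoint (c \<cdot>\<^sub>m X) = cnj c \<cdot>\<^sub>m mat_adjoint X"
  using assms by (intro sq_eqI[of _ n]) (auto simp: mat_adjoint_index[of _ n] sq_smult_index[of _ n])

lemma unitary_eigenvalue_norm:
  assumes U: "U \<in> carrier_mat n n" and un: "mat_adjoint U * U = 1\<^sub>m n" and "eigenvalue U c"
  shows "cmod c = 1"
proof -
  obtain X where X [simp]: "X \<in> carrier_mat n n" and X0: "X \<noteq> 0\<^sub>m n n" and eig: "U * X = c \<cdot>\<^sub>m X"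
    using assms eigenvalue_iff_matrix[OF U] by blast
  have [simp]: "U \<in> carrier_mat n n" by (rule U)
  have "mat_adjoint (U * X) * (U * X) = mat_adjoint X * ((mat_adjoint U * U) * X)"
    by (simp add: mat_adjoint_mult[of _ n] assoc_mult_mat[of _ n n _ n _ n])
  also have "\<dots> = mat_adjoint X * X" unfolding un by (simp add: left_mult_one_mat[of _ n n])
  finally have "mtrace (mat_adjoint (c \<cdot>\<^sub>m X) * (c \<cdot>\<^sub>m X)) = mtrace (mat_adjoint X * X)" by (simp add: eig)
  then have "(\<Sum>i<n. \<Sum>k<n. (cmod ((c \<cdot>\<^sub>m X) $$ (k, i)))\<^sup>2) = (\<Sum>i<n. \<Sum>k<n. (cmod (X $$ (k, i)))\<^sup>2)"
    by (simp only: mtrace_adjoint_mult_self[of _ n] X smult_carrier_mat of_real_eq_iff)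
  moreover have "(\<Sum>i<n. \<Sum>k<n. (cmod ((c \<cdot>\<^sub>m X) $$ (k, i)))\<^sup>2) = (cmod c)\<^sup>2 * (\<Sum>i<n. \<Sum>k<n. (cmod (X $$ (k, i)))\<^sup>2)"
    by (simp add: sq_smult_index[of _ n] norm_mult power_mult_distrib sum_distrib_left)
  moreover have "(\<Sum>i<n. \<Sum>k<n. (cmod (X $$ (k, i)))\<^sup>2) \<noteq> 0"
  proof
    assume "(\<Sum>i<n. \<Sum>k<n. (cmod (X $$ (k, i)))\<^sup>2) = 0"
    then have "mtrace (mat_adjoint X * X) = 0" by (simp only: mtrace_adjoint_mult_self[of X n] X of_real_0)
    then show False using mtrace_adjoint_mult_self_eq_0[of X n] X0 by simp
  qed
  ultimately have "(cmod c)\<^sup>2 = 1" by auto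
  then show ?thesis using power2_eq_iff_nonneg[of "cmod c" 1] by simp
qed

section \<open>Spectral projections as Lagrange polynomials in a unitary matrix\<close>

context
  fixes n :: nat and U :: "complex mat" and J :: "'j set" and z :: "'j \<Rightarrow> complex"
  assumes U [simp]: "U \<in> carrier_mat n n" and n: "n \<ge> 1"
    and un: "mat_adjoint U * U = 1\<^sub>m n" "U * mat_adjoint U = 1\<^sub>m n"
    and J: "finite J" "inj_on z J" and circ: "\<And>j. j \<in> J \<Longrightarrow> cmod (z j) = 1"
    and ann: "poly_mat (\<Prod>j\<in>J. [:- z j, 1:]) U = 0\<^sub>m n n"
begin

private abbreviation (input) "P j \<equiv> poly_mat (lagrange J z j) U"

text \<open>The polynomials x L_j(x) and z_j L_j(x) agree at all nodes.\<close>

lemma spectral_proj_eigen: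
  assumes j: "j \<in> J"
  shows "U * P j = z j \<cdot>\<^sub>m P j"
proof -
  have "U * P j = poly_mat (pCons 0 (lagrange J z j)) U"
    by (simp only: poly_mat_pCons_0[OF U])
  also have "\<dots> = poly_mat (Polynomial.smult (z j) (lagrange J z j)) U"
    using j by (intro poly_mat_cong[OF U J ann]) (auto simp: poly_lagrange[OF J])
  also have "\<dots> = z j \<cdot>\<^sub>m P j" by (rule poly_mat_smult[OF U])
  finally show ?thesis .
qed

lemma poly_mat_spectral_proj:
  "j \<in> J \<Longrightarrow> poly_mat g U * P j = poly g (z j) \<cdot>\<^sub>m P j"
  by (intro poly_mat_eigen[of _ n] spectral_proj_eigen) auto

text \<open>Multiplying E U = z_j E by the adjoint of U and taking adjoints shows that the adjoint
  of E satisfies the same eigenvalue equation. Applying E = L_j(U) to it gives that E times its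
  adjoint equals its adjoint; the left side is self-adjoint, hence so is E.\<close>

lemma spectral_proj_adjoint:
  assumes j: "j \<in> J"
  shows "mat_adjoint (P j) = P j"
proof -
  define E where "E = P j"
  have E [simp]: "E \<in> carrier_mat n n" by (simp add: E_def)
  have zz: "cnj (z j) * z j = 1"
    using circ[OF j] complex_norm_square[of "z j"] by (simp add: mult.commute)
  have "E * U = z j \<cdot>\<^sub>m E"
    using spectral_proj_eigen[OF j] poly_mat_commute[OF U, of "lagrange J z j" "[:0, 1:]"]
    unfolding poly_mat_X[OF U] E_def by simp
  then have "(E * U) * mat_adjoint U = (z j \<cdot>\<^sub>m E) * mat_adjoint U" by simp
  then have "E = z j \<cdot>\<^sub>m (E * mat_adjoint U)"
    using un(2) by (simp add: assoc_mult_mat[of _ n n _ n _ n] right_mult_one_mat[of _ n n]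
        mult_smult_assoc_mat[of _ n n _ n])
  then have "cnj (z j) \<cdot>\<^sub>m E = cnj (z j) \<cdot>\<^sub>m (z j \<cdot>\<^sub>m (E * mat_adjoint U))" by simp
  also have "\<dots> = E * mat_adjoint U"
    by (intro sq_eqI[of _ n]) (auto simp: sq_smult_index[of _ n] zz simp flip: mult.assoc simp del: index_mult_mat(1))
  finally have "mat_adjoint (cnj (z j) \<cdot>\<^sub>m E) = mat_adjoint (E * mat_adjoint U)" by simp
  then have "U * mat_adjoint E = z j \<cdot>\<^sub>m mat_adjoint E"
    by (simp add: mat_adjoint_mult[of _ n] mat_adjoint_adjoint[of _ n] mat_adjoint_smult[of _ n])
  then have "E * mat_adjoint E = poly (lagrange J z j) (z j) \<cdot>\<^sub>m mat_adjoint E"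
    unfolding E_def by (intro poly_mat_eigen[of _ n]) auto
  also have "\<dots> = mat_adjoint E"
    by (intro sq_eqI[of _ n]) (auto simp: poly_lagrange[OF J j j] sq_smult_index[of _ n])
  finally have idem: "E * mat_adjoint E = mat_adjoint E" .
  have "mat_adjoint (E * mat_adjoint E) = E * mat_adjoint E"
    by (simp add: mat_adjoint_mult[of _ n] mat_adjoint_adjoint[of _ n])
  then have "E = mat_adjoint E" unfolding idem by (simp add: mat_adjoint_adjoint[of _ n])
  then show ?thesis by (simp add: E_def)
qed

lemma spectral_proj_hermitian:
  assumes "j \<in> J" "a < n" "b < n"
  shows "cnj (P j $$ (a, b)) = P j $$ (b, a)"
  using mat_adjoint_index[of "P j" n b a] assms spectral_proj_adjoint[OF assms(1)] by simp

lemma spectral_proj_mult: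
  assumes "i \<in> J" "j \<in> J"
  shows "P i * P j = (if i = j then 1 else 0) \<cdot>\<^sub>m P j"
  using poly_mat_spectral_proj[OF assms(2), of "lagrange J z i"] poly_lagrange[OF J assms(2,1)] by auto

text \<open>The mass at z_j of the spectral measure of (U, e_1). The corner entry of the projection
  is real, so \<open>Re\<close> discards nothing.\<close>

definition spectral_weight :: "'j \<Rightarrow> real" where
  "spectral_weight j = Re (P j $$ (0, 0))"

lemma spectral_proj_columns:
  assumes ij: "i \<in> J" "j \<in> J"
  shows "(\<Sum>a<n. cnj (P i $$ (a, 0)) * P j $$ (a, 0)) = (if i = j then of_real (spectral_weight j) else 0)"
proof -
  have "(\<Sum>a<n. cnj (P i $$ (a, 0)) * P j $$ (a, 0)) = (P i * P j) $$ (0, 0)"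
    using n ij by (simp add: spectral_proj_hermitian mult_mat_index_sum[of _ n] del: index_mult_mat(1))
  also have "\<dots> = (if i = j then P j $$ (0, 0) else 0)"
    unfolding spectral_proj_mult[OF ij] using n by (simp add: sq_smult_index[of _ n])
  also have "P j $$ (0, 0) = of_real (spectral_weight j)"
    using spectral_proj_hermitian[OF ij(2), of 0 0] n by (simp add: spectral_weight_def complex_eq_iff)
  finally show ?thesis .
qed

lemma spectral_weight_eq: "j \<in> J \<Longrightarrow> P j $$ (0, 0) = of_real (spectral_weight j)"
  using spectral_proj_hermitian[of j 0 0] n by (simp add: spectral_weight_def complex_eq_iff)

lemma spectral_weight_norm:
  assumes "j \<in> J"
  shows "spectral_weight j = (\<Sum>a<n. (cmod (P j $$ (a, 0)))\<^sup>2)"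
proof -
  have "complex_of_real (spectral_weight j) = of_real (\<Sum>a<n. (cmod (P j $$ (a, 0)))\<^sup>2)"
    using spectral_proj_columns[OF assms assms] unfolding of_real_sum complex_norm_square
    by (simp add: mult.commute)
  then show ?thesis by (simp only: of_real_eq_iff)
qed

lemma poly_mat_spectral_sum:
  assumes "a < n" "b < n"
  shows "poly_mat g U $$ (a, b) = (\<Sum>j\<in>J. poly g (z j) * P j $$ (a, b))"
proof -
  have "poly_mat g U = poly_mat (\<Sum>j\<in>J. Polynomial.smult (poly g (z j)) (lagrange J z j)) U"
  proof (rule poly_mat_cong[OF U J ann])
    fix i assume i: "i \<in> J"
    have "poly (\<Sum>j\<in>J. Polynomial.smult (poly g (z j)) (lagrange J z j)) (z i) =
        (\<Sum>j\<in>J. if j = i then poly g (z i) else 0)"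
      unfolding poly_sum poly_smult by (intro sum.cong refl) (auto simp: poly_lagrange[OF J i])
    then show "poly g (z i) = poly (\<Sum>j\<in>J. Polynomial.smult (poly g (z j)) (lagrange J z j)) (z i)"
      using i J by simp
  qed
  then show ?thesis
    using assms by (simp add: poly_mat_sum_index[of _ n] poly_mat_smult[of _ n] sq_smult_index[of _ n])
qed

lemma sum_spectral_weight: "(\<Sum>j\<in>J. spectral_weight j) = 1"
proof -
  have "complex_of_real (\<Sum>j\<in>J. spectral_weight j) = poly_mat 1 U $$ (0, 0)"
    using n by (subst poly_mat_spectral_sum) (auto simp: spectral_weight_eq)
  also have "\<dots> = of_real 1" using n by (simp add: poly_mat_1[of _ n])
  finally show ?thesis by (simp only: of_real_eq_iff)
qed

text \<open>Both vectors are expanded in the first columns of the spectral projections, which are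
  mutually orthogonal and have squared norms mu_j.\<close>

lemma column_ip_eq_circle_ip:
  "(\<Sum>a<n. cnj (poly_mat p U $$ (a, 0)) * poly_mat q U $$ (a, 0)) = circle_ip J spectral_weight z p q"
proof -
  have "(\<Sum>a<n. cnj (poly_mat p U $$ (a, 0)) * poly_mat q U $$ (a, 0)) =
      (\<Sum>a<n. \<Sum>i\<in>J. \<Sum>j\<in>J. cnj (poly p (z i)) * poly q (z j) * (cnj (P i $$ (a, 0)) * P j $$ (a, 0)))"
  proof (rule sum.cong[OF refl])
    fix a assume "a \<in> {..<n}"
    then have a: "a < n" "0 < n" using n by auto
    show "cnj (poly_mat p U $$ (a, 0)) * poly_mat q U $$ (a, 0) =
        (\<Sum>i\<in>J. \<Sum>j\<in>J. cnj (poly p (z i)) * poly q (z j) * (cnj (P i $$ (a, 0)) * P j $$ (a, 0)))"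
      unfolding poly_mat_spectral_sum[OF a, of p] poly_mat_spectral_sum[OF a, of q] cnj_sum sum_product
      by (intro sum.cong refl) simp
  qed
  also have "\<dots> = (\<Sum>i\<in>J. \<Sum>j\<in>J. \<Sum>a<n. cnj (poly p (z i)) * poly q (z j) * (cnj (P i $$ (a, 0)) * P j $$ (a, 0)))"
    by (subst sum.swap) (rule sum.cong[OF refl], rule sum.swap)
  also have "\<dots> = (\<Sum>i\<in>J. \<Sum>j\<in>J. if j = i then cnj (poly p (z i)) * poly q (z i) * of_real (spectral_weight i) else 0)"
    by (intro sum.cong refl) (auto simp: spectral_proj_columns simp flip: sum_distrib_left)
  also have "\<dots> = circle_ip J spectral_weight z p q"
    using J by (simp add: circle_ip_def algebra_simps)
  finally show ?thesis .
qed

text \<open>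
  In its first row, \<open>A\<close> agrees with \<open>Z = U g(U)\<close> up to the real part of the diagonal entry, and the
  first column of \<open>A\<close> is minus the adjoint of the first row.
\<close>

lemma commutator_spectral_weight:
  assumes A: "A \<in> skew_mats n" and low: "poly_mat (pCons 0 g) U - A \<in> lower_mats n" and j: "j \<in> J"
  shows "(A * P j - P j * A) $$ (0, 0) =
    of_real ((2 * Re (z j * poly g (z j)) - 2 * Re (poly_mat (pCons 0 g) U $$ (0, 0))) * spectral_weight j)"
proof -
  define Z where "Z = poly_mat (pCons 0 g) U"
  define s where "s = Re (Z $$ (0, 0))"
  have n0: "0 < n" using n by simp
  have Ac [simp]: "A \<in> carrier_mat n n" using A by (simp add: skew_mats_def)
  have Zc [simp]: "Z \<in> carrier_mat n n" by (simp add: Z_def)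
  have A00: "A $$ (0, 0) = Z $$ (0, 0) - s"
  proof -
    have "Im (Z $$ (0, 0) - A $$ (0, 0)) = 0"
      using low n by (auto simp: lower_mats_def complex_is_Real_iff sq_minus_index[of _ n] simp flip: Z_def)
    moreover have "Re (A $$ (0, 0)) = 0"
      using skew_index[OF A, of 0 0] n by (simp add: complex_eq_iff)
    ultimately show ?thesis by (simp add: complex_eq_iff s_def)
  qed
  have A0: "A $$ (0, k) = Z $$ (0, k) - (if k = 0 then of_real s else 0)" if "k < n" for k
  proof (cases "k = 0")
    case False
    then have "(Z - A) $$ (0, k) = 0"
      using low that n by (auto simp: lower_mats_def simp flip: Z_def)
    then show ?thesis using False that n by (simp add: sq_minus_index[of _ n])
  qed (simp add: A00)
  have Ak: "A $$ (k, 0) = - cnj (Z $$ (0, k)) + (if k = 0 then of_real s else 0)" if "k < n" for k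
    using skew_index[OF A, of 0 k] that n unfolding A0[OF that] by (auto simp: algebra_simps)
  define E where "E = P j"
  have Ec [simp]: "E \<in> carrier_mat n n" by (simp add: E_def)
  have herm: "E $$ (0, k) = cnj (E $$ (k, 0))" if "k < n" for k
    unfolding E_def using spectral_proj_hermitian[OF j that, of 0] n by simp
  have E00: "E $$ (0, 0) = of_real (spectral_weight j)"
    by (simp add: E_def spectral_weight_eq[OF j])
  have ZE: "(\<Sum>k<n. Z $$ (0, k) * E $$ (k, 0)) = z j * poly g (z j) * of_real (spectral_weight j)"
  proof -
    have "(Z * E) $$ (0, 0) = z j * poly g (z j) * of_real (spectral_weight j)"
      unfolding Z_def E_def poly_mat_spectral_proj[OF j] using n
      by (simp add: sq_smult_index[of _ n] spectral_weight_eq[OF j])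
    then show ?thesis using n by (simp add: mult_mat_index_sum[of _ n] del: index_mult_mat(1))
  qed
  have 1: "(A * E) $$ (0, 0) = z j * poly g (z j) * of_real (spectral_weight j) - of_real (s * spectral_weight j)"
  proof -
    have "(A * E) $$ (0, 0) = (\<Sum>k<n. Z $$ (0, k) * E $$ (k, 0) - (if k = 0 then of_real s * E $$ (0, 0) else 0))"
      unfolding mult_mat_index_sum[OF Ac Ec n0 n0]
      by (intro sum.cong refl) (auto simp: A0 algebra_simps)
    also have "\<dots> = (\<Sum>k<n. Z $$ (0, k) * E $$ (k, 0)) - of_real s * E $$ (0, 0)"
      using n by (simp add: sum_subtractf)
    finally show ?thesis unfolding ZE by (simp add: E_def spectral_weight_eq[OF j])
  qed
  have 2: "(E * A) $$ (0, 0) = - cnj (z j * poly g (z j) * of_real (spectral_weight j)) + of_real (s * spectral_weight j)"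
  proof -
    have "(E * A) $$ (0, 0) = (\<Sum>k<n. - cnj (Z $$ (0, k) * E $$ (k, 0)) + (if k = 0 then of_real s * E $$ (0, 0) else 0))"
      unfolding mult_mat_index_sum[OF Ec Ac n0 n0]
    proof (rule sum.cong[OF refl])
      fix k assume "k \<in> {..<n}"
      then have k: "k < n" by simp
      show "E $$ (0, k) * A $$ (k, 0) =
          - cnj (Z $$ (0, k) * E $$ (k, 0)) + (if k = 0 then of_real s * E $$ (0, 0) else 0)"
        unfolding Ak[OF k] herm[OF k] using E00 by (auto simp: algebra_simps)
    qed
    also have "\<dots> = - cnj (\<Sum>k<n. Z $$ (0, k) * E $$ (k, 0)) + of_real s * E $$ (0, 0)"
      unfolding sum.distrib sum_negf cnj_sum using n0 by simp
    finally show ?thesis unfolding ZE by (simp add: E_def spectral_weight_eq[OF j])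
  qed
  \<comment> \<open>With x = z_j g(z_j) mu_j, the two products are x - s mu_j and minus its
    conjugate, which yields twice the real part.\<close>
  have "(A * E - E * A) $$ (0, 0) = (A * E) $$ (0, 0) - (E * A) $$ (0, 0)"
    using n by (intro sq_minus_index[of _ n]) auto
  also have "\<dots> = of_real ((2 * Re (z j * poly g (z j)) - 2 * s) * spectral_weight j)"
    unfolding 1 2 by (simp add: complex_eq_iff algebra_simps)
  finally show ?thesis by (simp add: E_def s_def Z_def)
qed

end

subsection \<open>Evolution of the spectral weights\<close>

text \<open>A Gronwall argument that uses only the bound on \<open>a\<close>: the square of
  \<open>G\<close> times exp(-2 K t) is nonincreasing, nonnegative and starts at 0. Negative times
  follow by reflection.\<close>

lemma linear_ode_zero:
  fixes G a :: "real \<Rightarrow> real"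
  assumes d: "\<And>t. (G has_real_derivative a t * G t) (at t)" and a: "\<And>t. \<bar>a t\<bar> \<le> K" and G0: "G 0 = 0"
  shows "G t = 0"
proof -
  have "G t = 0" if t: "t \<ge> 0" and d: "\<And>t. (G has_real_derivative a t * G t) (at t)" and a: "\<And>t. \<bar>a t\<bar> \<le> K"
    and G0: "G 0 = 0" for G a :: "real \<Rightarrow> real" and t
  proof -
    define H where "H s = (G s)\<^sup>2 * exp (- 2 * K * s)" for s
    have dH: "(H has_real_derivative 2 * (a s - K) * H s) (at s)" for s
      unfolding H_def
      by (rule derivative_eq_intros d refl | simp)+ (simp add: algebra_simps power2_eq_square)
    have "H t \<le> H 0"
    proof (rule DERIV_nonpos_imp_nonincreasing[OF t])
      fix s
      have "2 * (a s - K) * H s \<le> 0"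
        using abs_le_D1[OF a[of s]] by (intro mult_nonpos_nonneg[of "2 * (a s - K)"]) (auto simp: H_def)
      then show "\<exists>y. (H has_real_derivative y) (at s) \<and> y \<le> 0" using dH by blast
    qed
    then have "(G t)\<^sup>2 * exp (- 2 * K * t) \<le> 0" using G0 by (simp add: H_def)
    then show ?thesis by (simp add: mult_le_0_iff not_less)
  qed note pos = this
  show ?thesis
  proof (cases "t \<ge> 0")
    case True
    then show ?thesis using pos[OF _ d a G0] by blast
  next
    case False
    have "((\<lambda>s. G (- s)) has_real_derivative a (- s) * G (- s) * - 1) (at s)" for s
      by (rule DERIV_chain2[OF d]) (auto intro!: derivative_eq_intros)
    then have "((\<lambda>s. G (- s)) has_real_derivative - a (- s) * G (- s)) (at s)" for s
      by simp
    then have "G (- (- t)) = 0"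
      using pos[of "- t" "\<lambda>s. G (- s)" "\<lambda>s. - a (- s)"] a G0 False by auto
    then show ?thesis by simp
  qed
qed

text \<open>Total mass 1 determines the unknown rate as the mean of the \<open>l j\<close>, hence
  bounds it. After the factors exp(l_j t) are removed, all weights solve the same linear equation
  with coefficient -s, so a cross difference of two of them that starts at 0 stays 0.\<close>

lemma weights_evolution:
  fixes \<mu> :: "real \<Rightarrow> 'j \<Rightarrow> real" and l :: "'j \<Rightarrow> real"
  assumes J: "finite J" "J \<noteq> {}"
    and d: "\<And>t j. j \<in> J \<Longrightarrow> ((\<lambda>t. \<mu> t j) has_real_derivative (l j - s t) * \<mu> t j) (at t)"
    and nonneg: "\<And>t j. j \<in> J \<Longrightarrow> \<mu> t j \<ge> 0" and sum1: "\<And>t. (\<Sum>j\<in>J. \<mu> t j) = 1"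
    and pos: "\<And>j. j \<in> J \<Longrightarrow> \<mu> 0 j > 0"
  shows "\<exists>c>0. \<forall>j\<in>J. \<mu> t j = c * exp (t * l j) * \<mu> 0 j"
proof -
  have le1: "\<mu> t j \<le> 1" if "j \<in> J" for t j
    using member_le_sum[of j J "\<mu> t"] nonneg J that sum1 by auto
  have s: "s t = (\<Sum>j\<in>J. l j * \<mu> t j)" for t
  proof -
    have "((\<lambda>t. \<Sum>j\<in>J. \<mu> t j) has_real_derivative (\<Sum>j\<in>J. (l j - s t) * \<mu> t j)) (at t)"
      by (intro DERIV_sum d)
    then have "(\<Sum>j\<in>J. (l j - s t) * \<mu> t j) = 0"
      unfolding sum1 using DERIV_unique[OF _ DERIV_const] by blast
    then have "(\<Sum>j\<in>J. l j * \<mu> t j) = s t * (\<Sum>j\<in>J. \<mu> t j)"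
      by (simp add: left_diff_distrib sum_subtractf sum_distrib_left)
    then show ?thesis by (simp add: sum1)
  qed
  have sb: "\<bar>- s t\<bar> \<le> (\<Sum>j\<in>J. \<bar>l j\<bar>)" for t
  proof -
    have "\<bar>- s t\<bar> \<le> (\<Sum>j\<in>J. \<bar>l j * \<mu> t j\<bar>)" unfolding s by (simp add: sum_abs)
    also have "\<dots> \<le> (\<Sum>j\<in>J. \<bar>l j\<bar>)"
      using nonneg le1 by (intro sum_mono) (simp add: abs_mult mult_left_le)
    finally show ?thesis .
  qed
  obtain i where i: "i \<in> J" using J by blast
  have eq: "\<mu> t j * exp (- l j * t) * \<mu> 0 i = \<mu> t i * exp (- l i * t) * \<mu> 0 j" if j: "j \<in> J" for j t
  proof -
    define G where "G t = \<mu> t j * exp (- l j * t) * \<mu> 0 i - \<mu> t i * exp (- l i * t) * \<mu> 0 j" for t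
    have "G t = 0"
    proof (rule linear_ode_zero[of G "\<lambda>t. - s t", OF _ sb])
      show "(G has_real_derivative - s t * G t) (at t)" for t
        unfolding G_def by (rule derivative_eq_intros d i j refl | simp)+ (simp add: algebra_simps)
    qed (simp add: G_def)
    then show ?thesis by (simp add: G_def)
  qed
  define c where "c = \<mu> t i * exp (- l i * t) / \<mu> 0 i"
  have m: "\<mu> t j = c * exp (t * l j) * \<mu> 0 j" if "j \<in> J" for j
  proof -
    have "\<mu> t j * exp (- l j * t) = c * \<mu> 0 j"
      using eq[OF that, of t] pos[OF i] by (simp add: c_def field_simps)
    then have "\<mu> t j * (exp (- l j * t) * exp (t * l j)) = c * exp (t * l j) * \<mu> 0 j" by (simp add: algebra_simps)
    then show ?thesis by (simp add: mult.commute flip: exp_add)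
  qed
  have "c \<ge> 0" using nonneg[OF i] pos[OF i] by (simp add: c_def)
  \<comment> \<open>If the reference weight vanished at time \<open>t\<close>, proportionality would
    make all weights vanish there, against total mass 1.\<close>
  moreover have "c \<noteq> 0"
  proof
    assume "c = 0"
    then have "(\<Sum>j\<in>J. \<mu> t j) = 0" using m by simp
    then show False using sum1 by simp
  qed
  ultimately show ?thesis using m by (intro exI[of _ c]) auto
qed

subsection \<open>Asymptotics of ratios of exponential sums\<close>

text \<open>Division by the dominant term turns the ratio into b_0 + B/(1 + D) with decaying B and
  D. The \<open>I1\<close> term of B is the correction; the error consists of the other terms of B
  and of B D/(1 + D), which is quadratically small.\<close>

lemma exp_sum_ratio_asymp:
  fixes e w :: "'i \<Rightarrow> real" and b :: "'i \<Rightarrow> complex"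
  assumes S: "finite S" and I0: "I0 \<in> S" and I1: "I1 \<in> S" and w: "\<And>I. I \<in> S \<Longrightarrow> w I > 0"
    and e1: "e I1 < e I0" and e: "\<And>I. I \<in> S \<Longrightarrow> I \<noteq> I0 \<Longrightarrow> I \<noteq> I1 \<Longrightarrow> e I < e I1"
  defines "q \<equiv> \<lambda>t. (\<Sum>I\<in>S. of_real (w I * exp (t * e I)) * b I) / of_real (\<Sum>I\<in>S. w I * exp (t * e I))"
  shows "\<exists>\<gamma> > e I0 - e I1. \<exists>K. \<forall>t\<ge>0.
    cmod (q t - b I0 - (b I1 - b I0) * of_real (w I1 / w I0 * exp (- (e I0 - e I1) * t))) \<le> K * exp (- \<gamma> * t)"
proof -
  define \<delta> where "\<delta> = e I0 - e I1"
  define R where "R = S - {I0, I1}"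
  \<comment> \<open>The rate 2 \<delta> belongs to the product B D, the other candidates to the
    remaining exponents; each of them exceeds \<delta>.\<close>
  define \<gamma> where "\<gamma> = Min (insert (2 * \<delta>) ((\<lambda>I. e I0 - e I) ` R))"
  have \<delta>: "\<delta> > 0" using e1 by (simp add: \<delta>_def)
  have finR: "finite R" using S by (simp add: R_def)
  have \<gamma>\<delta>: "\<gamma> > \<delta>"
    using \<delta> finR e unfolding \<gamma>_def by (subst Min_gr_iff) (auto simp: R_def \<delta>_def)
  have \<gamma>2: "\<gamma> \<le> 2 * \<delta>" using finR by (auto simp: \<gamma>_def)
  have \<gamma>R: "\<gamma> \<le> e I0 - e I" if "I \<in> R" for I using finR that by (auto simp: \<gamma>_def)
  define c where "c I = w I / w I0" for I
  define S' where "S' = S - {I0}"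
  have finS': "finite S'" using S by (simp add: S'_def)
  have S'R: "S' = insert I1 R" "I1 \<notin> R" using I1 e1 by (auto simp: S'_def R_def)
  have c: "c I \<ge> 0" if "I \<in> S" for I using w[OF that] w[OF I0] by (simp add: c_def)
  define u where "u I t = c I * exp (- (e I0 - e I) * t)" for I t
  define D where "D t = (\<Sum>I\<in>S'. u I t)" for t
  define B where "B t = (\<Sum>I\<in>S'. of_real (u I t) * (b I - b I0))" for t
  \<comment> \<open>The first sum bounds the remaining terms of B, the product bounds B D; the
    denominator 1 + D is at least 1.\<close>
  define K where "K = (\<Sum>I\<in>R. c I * cmod (b I - b I0)) +
    (\<Sum>I\<in>S'. c I * cmod (b I - b I0)) * (\<Sum>I\<in>S'. c I)"
  have u0: "u I t \<ge> 0" if "I \<in> S'" for I t using c that by (simp add: u_def S'_def)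
  have D0: "D t \<ge> 0" for t unfolding D_def by (intro sum_nonneg u0)
  have wu: "w I * exp (t * e I) = w I0 * exp (t * e I0) * u I t" if "I \<in> S" for I t
    using w[OF I0] by (simp add: u_def c_def algebra_simps flip: exp_add)
  have q: "q t = b I0 + B t / of_real (1 + D t)" for t
  proof -
    define W where "W = w I0 * exp (t * e I0)"
    have W: "W > 0" using w[OF I0] by (simp add: W_def)
    have u00: "u I0 t = 1" using w[OF I0] by (simp add: u_def c_def)
    have den: "(\<Sum>I\<in>S. w I * exp (t * e I)) = W * (1 + D t)"
    proof -
      have "(\<Sum>I\<in>S. w I * exp (t * e I)) = W * (\<Sum>I\<in>S. u I t)"
        unfolding sum_distrib_left W_def by (intro sum.cong refl wu)
      also have "(\<Sum>I\<in>S. u I t) = 1 + D t"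
        using I0 S by (subst sum.remove[of _ I0]) (auto simp: u00 D_def S'_def)
      finally show ?thesis .
    qed
    have num: "(\<Sum>I\<in>S. of_real (w I * exp (t * e I)) * b I) = of_real W * (b I0 * of_real (1 + D t) + B t)"
    proof -
      have "(\<Sum>I\<in>S. of_real (w I * exp (t * e I)) * b I) = of_real W * (\<Sum>I\<in>S. of_real (u I t) * b I)"
        unfolding sum_distrib_left W_def by (intro sum.cong refl) (simp only: wu of_real_mult mult.assoc)
      also have "(\<Sum>I\<in>S. of_real (u I t) * b I) = b I0 + (\<Sum>I\<in>S'. of_real (u I t) * b I)"
        using I0 S by (subst sum.remove[of _ I0]) (auto simp: u00 S'_def)
      also have "\<dots> = b I0 * of_real (1 + D t) + B t"
        by (simp add: B_def D_def algebra_simps sum_subtractf sum_distrib_left)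
      finally show ?thesis .
    qed
    have "complex_of_real (1 + D t) \<noteq> 0" using D0[of t] by (simp only: of_real_eq_0_iff)
    then show ?thesis
      unfolding q_def den num of_real_mult[of W "1 + D t"] using W
      by (simp add: add_divide_distrib del: of_real_add)
  qed
  have main: "cmod (q t - b I0 - (b I1 - b I0) * of_real (w I1 / w I0 * exp (- (e I0 - e I1) * t))) \<le> K * exp (- \<gamma> * t)"
    if t: "t \<ge> 0" for t
  proof -
    have u_le: "u I t \<le> c I * exp (- a * t)" if "I \<in> S" "a \<le> e I0 - e I" for I a
      unfolding u_def using mult_right_mono[OF that(2) t] c[OF that(1)]
      by (intro mult_left_mono) (auto simp: algebra_simps)
    have uR: "u I t \<le> c I * exp (- \<gamma> * t)" if "I \<in> R" for I
      using that \<gamma>R[OF that] by (intro u_le) (auto simp: R_def)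
    have uS: "u I t \<le> c I * exp (- \<delta> * t)" if "I \<in> S'" for I
    proof -
      have "\<delta> \<le> e I0 - e I" using that \<gamma>R[of I] \<gamma>\<delta> by (auto simp: S'R \<delta>_def)
      then show ?thesis using that by (intro u_le) (auto simp: S'_def)
    qed
    have u1: "of_real (u I1 t) * (b I1 - b I0) = (b I1 - b I0) * of_real (w I1 / w I0 * exp (- (e I0 - e I1) * t))"
      by (simp add: u_def c_def)
    have Bsplit: "B t = of_real (u I1 t) * (b I1 - b I0) + (\<Sum>I\<in>R. of_real (u I t) * (b I - b I0))"
      unfolding B_def S'R(1) using S'R(2) finR by simp
    have "q t - b I0 - of_real (u I1 t) * (b I1 - b I0) =
        (\<Sum>I\<in>R. of_real (u I t) * (b I - b I0)) - B t * of_real (D t) / of_real (1 + D t)"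
    proof -
      have "complex_of_real (1 + D t) \<noteq> 0" using D0[of t] by (simp only: of_real_eq_0_iff)
      then have "B t / of_real (1 + D t) = B t - B t * of_real (D t) / of_real (1 + D t)"
        by (simp add: field_simps)
      then show ?thesis unfolding q using Bsplit by simp
    qed
    then have "cmod (q t - b I0 - of_real (u I1 t) * (b I1 - b I0)) \<le>
        cmod (\<Sum>I\<in>R. of_real (u I t) * (b I - b I0)) + cmod (B t * of_real (D t) / of_real (1 + D t))"
      by (simp only: norm_triangle_ineq4)
    also have "cmod (\<Sum>I\<in>R. of_real (u I t) * (b I - b I0)) \<le>
        (\<Sum>I\<in>R. c I * exp (- \<gamma> * t) * cmod (b I - b I0))"
    proof (rule order_trans[OF norm_sum], rule sum_mono)
      fix I assume "I \<in> R"
      then show "cmod (of_real (u I t) * (b I - b I0)) \<le> c I * exp (- \<gamma> * t) * cmod (b I - b I0)"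
        using uR[of I] u0[of I t] S'R by (simp add: norm_mult mult_right_mono)
    qed
    also have "cmod (B t * of_real (D t) / of_real (1 + D t)) \<le>
        (\<Sum>I\<in>S'. c I * exp (- \<delta> * t) * cmod (b I - b I0)) * (\<Sum>I\<in>S'. c I * exp (- \<delta> * t))"
    proof -
      have "cmod (B t * of_real (D t) / of_real (1 + D t)) = cmod (B t) * D t / (1 + D t)"
        using D0[of t] by (simp add: norm_mult norm_divide del: of_real_add)
      also have "\<dots> \<le> cmod (B t) * D t"
        using D0[of t] by (simp add: divide_le_eq mult_left_mono algebra_simps)
      also have "\<dots> \<le> (\<Sum>I\<in>S'. c I * exp (- \<delta> * t) * cmod (b I - b I0)) * (\<Sum>I\<in>S'. c I * exp (- \<delta> * t))"
      proof (intro mult_mono)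
        show "cmod (B t) \<le> (\<Sum>I\<in>S'. c I * exp (- \<delta> * t) * cmod (b I - b I0))"
          unfolding B_def
        proof (rule order_trans[OF norm_sum], rule sum_mono)
          fix I assume "I \<in> S'"
          then show "cmod (of_real (u I t) * (b I - b I0)) \<le> c I * exp (- \<delta> * t) * cmod (b I - b I0)"
            using uS[of I] u0[of I t] by (simp add: norm_mult mult_right_mono)
        qed
        show "D t \<le> (\<Sum>I\<in>S'. c I * exp (- \<delta> * t))"
          unfolding D_def by (intro sum_mono uS)
        show "0 \<le> (\<Sum>I\<in>S'. c I * exp (- \<delta> * t) * cmod (b I - b I0))"
          using c by (intro sum_nonneg) (auto simp: S'_def)
      qed (rule D0)
      finally show ?thesis .
    qed
    also have "(\<Sum>I\<in>S'. c I * exp (- \<delta> * t) * cmod (b I - b I0)) * (\<Sum>I\<in>S'. c I * exp (- \<delta> * t)) =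
        (\<Sum>I\<in>S'. c I * cmod (b I - b I0)) * (\<Sum>I\<in>S'. c I) * exp (- (2 * \<delta>) * t)"
    proof -
      have "(\<Sum>I\<in>S'. c I * exp (- \<delta> * t) * cmod (b I - b I0)) = (\<Sum>I\<in>S'. c I * cmod (b I - b I0)) * exp (- \<delta> * t)"
        "(\<Sum>I\<in>S'. c I * exp (- \<delta> * t)) = (\<Sum>I\<in>S'. c I) * exp (- \<delta> * t)"
        unfolding sum_distrib_right by (intro sum.cong refl; simp)+
      moreover have "exp (- (2 * \<delta>) * t) = exp (- \<delta> * t) * exp (- \<delta> * t)"
        by (simp flip: exp_add)
      ultimately show ?thesis by simp
    qed
    also have "\<dots> \<le> (\<Sum>I\<in>S'. c I * cmod (b I - b I0)) * (\<Sum>I\<in>S'. c I) * exp (- \<gamma> * t)"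
      using \<gamma>2 t c
      by (intro mult_left_mono) (auto simp: S'_def intro!: mult_right_mono mult_nonneg_nonneg sum_nonneg)
    also have "(\<Sum>I\<in>R. c I * exp (- \<gamma> * t) * cmod (b I - b I0)) = (\<Sum>I\<in>R. c I * cmod (b I - b I0)) * exp (- \<gamma> * t)"
      unfolding sum_distrib_right by (intro sum.cong refl) simp
    finally show ?thesis unfolding u1 K_def by (simp add: distrib_right)
  qed
  then show ?thesis using \<gamma>\<delta> unfolding \<delta>_def by blast
qed

text \<open>An exchange argument: I arises from {1..k} by replacing P with a set Q of equal size.
  Each exchanged pair costs at least the gap l_k - l_{k+1}; two or more pairs cost strictly more,
  and so does any single pair other than k for k + 1.\<close>

lemma sum_over_subset_less_second:
  fixes l :: "nat \<Rightarrow> real"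
  assumes l: "\<And>i j. 1 \<le> i \<Longrightarrow> i < j \<Longrightarrow> j \<le> n \<Longrightarrow> l j < l i"
    and k: "1 \<le> k" "k < n"
    and I: "I \<subseteq> {1..n}" "card I = k" "I \<noteq> {1..k}" "I \<noteq> insert (k + 1) {1..k - 1}"
  shows "sum l I < sum l (insert (k + 1) {1..k - 1})"
proof -
  define P where "P = {1..k} - I"
  define Q where "Q = I - {1..k}"
  have finI: "finite I" using I(1) by (rule finite_subset) simp
  have fin: "finite P" "finite Q" using finI by (auto simp: P_def Q_def)
  have "card P + card ({1..k} \<inter> I) = k"
    using card_Un_disjoint[of P "{1..k} \<inter> I"] fin by (simp add: P_def Un_Diff_Int disjoint_iff)
  moreover have "card Q + card ({1..k} \<inter> I) = k"
    using card_Un_disjoint[of Q "{1..k} \<inter> I"] fin I(2)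
    by (simp add: Q_def Int_commute[of _ I] Un_Diff_Int disjoint_iff)
  ultimately have cPQ: "card Q = card P" by simp
  have sPQ: "sum l {1..k} - sum l I = sum l P - sum l Q"
  proof -
    have "sum l {1..k} = sum l P + sum l ({1..k} \<inter> I)"
      using sum.union_disjoint[of P "{1..k} \<inter> I" l] fin by (simp add: P_def Un_Diff_Int disjoint_iff)
    moreover have "sum l I = sum l Q + sum l ({1..k} \<inter> I)"
      using sum.union_disjoint[of Q "{1..k} \<inter> I" l] fin
      by (simp add: Q_def Int_commute[of _ I] Un_Diff_Int disjoint_iff)
    ultimately show ?thesis by simp
  qed
  have lP: "l k \<le> l i" if "i \<in> P" for i
    using that l[of i k] k by (cases "i = k") (auto simp: P_def intro: less_imp_le)
  have lQ: "l i \<le> l (k + 1)" if "i \<in> Q" for i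
  proof -
    have "k < i" "i \<le> n" using that I(1) by (auto simp: Q_def)
    then show ?thesis using l[of "k + 1" i] by (cases "i = k + 1") auto
  qed
  have "P \<noteq> {}"
  proof
    assume "P = {}"
    then have "{1..k} \<subseteq> I" by (auto simp: P_def)
    then show False using card_subset_eq[OF finI, of "{1..k}"] I by simp
  qed
  then have m: "card P > 0" using fin by (simp add: card_gt_0_iff)
  have lk: "l (k + 1) < l k" using l[of k "k + 1"] k by simp
  have gt: "l k - l (k + 1) < sum l P - sum l Q"
  proof (cases "card P = 1")
    case True
    obtain a where a: "P = {a}" using card_1_singletonE[OF True] by blast
    obtain b where b: "Q = {b}" using card_1_singletonE[OF True[folded cPQ]] by blast
    note ab = a b
    have "\<not> (a = k \<and> b = k + 1)"
    proof
      assume "a = k \<and> b = k + 1"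
      then have "{1..k} - I = {k}" "I - {1..k} = {k + 1}" using ab by (auto simp: P_def Q_def)
      then have "I = insert (k + 1) ({1..k} - {k})" by blast
      also have "{1..k} - {k} = {1..k - 1}" by auto
      finally show False using I by simp
    qed
    moreover have "a \<in> P" "b \<in> Q" using ab by auto
    then have "1 \<le> a" "a \<le> k" "k + 1 \<le> b" "b \<le> n" using I(1) by (auto simp: P_def Q_def)
    ultimately have "a < k \<or> k + 1 < b" by linarith
    then have "l k < l a \<or> l b < l (k + 1)"
      using l[of a k] l[of "k + 1" b] k \<open>1 \<le> a\<close> \<open>b \<le> n\<close> by auto
    then show ?thesis using lP[of a] lQ[of b] ab by auto
  next
    case False
    have "of_nat (card P) * l k \<le> sum l P" using lP by (intro sum_bounded_below) auto
    moreover have "sum l Q \<le> of_nat (card Q) * l (k + 1)" using lQ by (intro sum_bounded_above) auto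
    moreover have "1 * (l k - l (k + 1)) < of_nat (card P) * (l k - l (k + 1))"
      using lk m False by (intro mult_strict_right_mono) auto
    ultimately show ?thesis using cPQ by (simp add: algebra_simps)
  qed
  have "sum l {1..k} = l k + sum l {1..k - 1}"
  proof -
    have "{1..k} = insert k {1..k - 1}" using k by auto
    then show ?thesis using k by simp
  qed
  moreover have "sum l (insert (k + 1) {1..k - 1}) = l (k + 1) + sum l {1..k - 1}" by simp
  ultimately show ?thesis using gt sPQ by linarith
qed

subsection \<open>Asymptotics of the Verblunsky coefficients\<close>

text \<open>The ratio giving \<alpha>_{k-1}, up to the sign (-1)^(k-1), for the weights exp(t l_j)
  mu_j. The argument \<open>k\<close> is the size of the subsets.\<close>

definition heine_coeff ::
  "'j set \<Rightarrow> ('j \<Rightarrow> real) \<Rightarrow> ('j \<Rightarrow> complex) \<Rightarrow> ('j \<Rightarrow> real) \<Rightarrow> nat \<Rightarrow> real \<Rightarrow> complex" where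
  "heine_coeff J \<mu> z l k t =
     (\<Sum>I | I \<subseteq> J \<and> card I = k. of_real (vdm_weight \<mu> z I * exp (t * sum l I)) * (\<Prod>i\<in>I. cnj (z i))) /
     of_real (\<Sum>I | I \<subseteq> J \<and> card I = k. vdm_weight \<mu> z I * exp (t * sum l I))"

text \<open>This is xi_{k-1}. With the labels of \<mu> and z reversed, the same expression is
  zeta_{k-1}.\<close>

definition leading_correction :: "(nat \<Rightarrow> real) \<Rightarrow> (nat \<Rightarrow> complex) \<Rightarrow> nat \<Rightarrow> complex" where
  "leading_correction \<mu> z k = (z k * cnj (z (k + 1)) - 1) *
     of_real (\<mu> (k + 1) / \<mu> k * (\<Prod>i=1..k - 1. (cmod ((z (k + 1) - z i) / (z k - z i)))\<^sup>2))"

text \<open>The two leading index sets share {1..k-1}, so the ratio of their weights reduces to the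
  factors at k and k + 1, and the ratio of their node products is z_k cnj(z_{k+1}) on the circle.
  Dividing by the limit, of modulus 1, leaves the constant \<open>K\<close> unchanged.\<close>

lemma heine_coeff_asymp:
  assumes l: "\<And>i j. 1 \<le> i \<Longrightarrow> i < j \<Longrightarrow> j \<le> n \<Longrightarrow> l j < l i"
    and z: "inj_on z {1..n}" "\<And>j. j \<in> {1..n} \<Longrightarrow> cmod (z j) = 1"
    and \<mu>: "\<And>j. j \<in> {1..n} \<Longrightarrow> \<mu> j > 0"
    and k: "1 \<le> k" "k < n"
  shows "\<exists>\<gamma> > l k - l (k + 1). \<exists>K. \<forall>t\<ge>0.
    cmod (heine_coeff {1..n} \<mu> z l k t / (\<Prod>i=1..k. cnj (z i)) - 1 -
      leading_correction \<mu> z k * of_real (exp (- (l k - l (k + 1)) * t))) \<le> K * exp (- \<gamma> * t)"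
proof -
  define S where "S = {I. I \<subseteq> {1..n} \<and> card I = k}"
  define I0 where "I0 = {1..k}"
  define H where "H = {1..k - 1}"
  define I1 where "I1 = insert (k + 1) H"
  define b where "b I = (\<Prod>i\<in>I. cnj (z i))" for I
  define w where "w = vdm_weight \<mu> z"
  have I0H: "I0 = insert k H" using k by (auto simp: I0_def H_def)
  have H: "finite H" "k \<notin> H" "k + 1 \<notin> H" using k by (auto simp: H_def)
  have S: "finite S" by (auto simp: S_def intro: finite_subset[of _ "Pow {1..n}"])
  have I0S: "I0 \<in> S" using k by (auto simp: S_def I0_def)
  have I1S: "I1 \<in> S" using k H by (auto simp: S_def I1_def card_insert_if) (auto simp: H_def)
  have w: "w I > 0" if "I \<in> S" for I
    using that z \<mu> unfolding w_def by (intro vdm_weight_pos[of "{1..n}"]) (auto simp: S_def)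
  have e01: "sum l I0 - sum l I1 = l k - l (k + 1)"
    using H by (simp add: I0H I1_def)
  have b0: "b I0 \<noteq> 0" and nb0: "cmod (b I0) = 1"
  proof -
    show "cmod (b I0) = 1" unfolding b_def prod_norm[symmetric]
      using z(2) k by (intro prod.neutral) (auto simp: I0_def)
    then show "b I0 \<noteq> 0" by auto
  qed
  obtain \<gamma> K where \<gamma>: "\<gamma> > l k - l (k + 1)" and K: "\<And>t. t \<ge> 0 \<Longrightarrow>
    cmod (heine_coeff {1..n} \<mu> z l k t - b I0 - (b I1 - b I0) * of_real (w I1 / w I0 * exp (- (l k - l (k + 1)) * t))) \<le>
      K * exp (- \<gamma> * t)"
  proof -
    have first: "sum l I1 < sum l I0" using e01 l[of k "k + 1"] k by simp
    have second: "sum l I < sum l I1" if "I \<in> S" "I \<noteq> I0" "I \<noteq> I1" for I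
      using sum_over_subset_less_second[OF l k, where I = I] that by (simp add: S_def I0_def I1_def H_def)
    have hc: "heine_coeff {1..n} \<mu> z l k t = (\<Sum>I\<in>S. of_real (w I * exp (t * sum l I)) * b I) /
        of_real (\<Sum>I\<in>S. w I * exp (t * sum l I))" for t
      unfolding heine_coeff_def S_def b_def w_def ..
    show thesis
      using exp_sum_ratio_asymp[of S I0 I1 w "sum l" b, OF S I0S I1S w first second] that unfolding e01 hc by blast
  qed
  have wr: "w I1 / w I0 = \<mu> (k + 1) / \<mu> k * (\<Prod>i\<in>H. (cmod ((z (k + 1) - z i) / (z k - z i)))\<^sup>2)"
  proof -
    have "w H > 0" unfolding w_def using z \<mu> k by (intro vdm_weight_pos[of "{1..n}"]) (auto simp: H_def)
    then have "w I1 / w I0 = \<mu> (k + 1) / \<mu> k *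
        ((\<Prod>i\<in>H. (cmod (z (k + 1) - z i))\<^sup>2) / (\<Prod>i\<in>H. (cmod (z k - z i))\<^sup>2))"
      unfolding I1_def I0H w_def vdm_weight_insert[OF H(1,2)] vdm_weight_insert[OF H(1,3)] by simp
    then show ?thesis by (simp add: norm_divide power_divide prod_dividef)
  qed
  have br: "b I1 / b I0 = z k * cnj (z (k + 1))"
  proof -
    have "b H \<noteq> 0" using b0 H by (simp add: I0H b_def)
    then have "b I1 / b I0 = cnj (z (k + 1)) / cnj (z k)" using H by (simp add: I0H I1_def b_def)
    moreover have zz: "z k * cnj (z k) = 1"
      using z(2)[of k] k by (simp flip: complex_norm_square)
    then have "cnj (z k) \<noteq> 0" by auto
    then have "z k * cnj (z (k + 1)) = (z k * cnj (z k)) * cnj (z (k + 1)) / cnj (z k)" by simp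
    ultimately show ?thesis unfolding zz by simp
  qed
  have "cmod (heine_coeff {1..n} \<mu> z l k t / b I0 - 1 -
      leading_correction \<mu> z k * of_real (exp (- (l k - l (k + 1)) * t))) \<le> K * exp (- \<gamma> * t)"
    if t: "t \<ge> 0" for t
  proof -
    have "leading_correction \<mu> z k = (b I1 / b I0 - 1) * of_real (w I1 / w I0)"
      unfolding leading_correction_def wr br H_def ..
    moreover have "h / c - 1 - (d / c - 1) * X * E = (h - c - (d - c) * (X * E)) / c" if "c \<noteq> 0" for h c d X E :: complex
      using that by (simp add: field_simps)
    ultimately have "heine_coeff {1..n} \<mu> z l k t / b I0 - 1 -
        leading_correction \<mu> z k * of_real (exp (- (l k - l (k + 1)) * t)) =
      (heine_coeff {1..n} \<mu> z l k t - b I0 - (b I1 - b I0) * of_real (w I1 / w I0 * exp (- (l k - l (k + 1)) * t))) / b I0"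
      using b0 by (simp only: of_real_mult)
    then show ?thesis using K[OF t] by (simp add: norm_divide nb0)
  qed
  then show ?thesis using \<gamma> unfolding b_def I0_def by blast
qed

text \<open>Summing over all k-subsets is insensitive to labels: a permutation of the indices
  permutes the subsets of a given size. Together with time reversal this transfers the expansion to
  minus infinity.\<close>

lemma heine_coeff_permute:
  assumes \<pi>: "bij_betw \<pi> J J"
  shows "heine_coeff J (\<mu> \<circ> \<pi>) (z \<circ> \<pi>) (l \<circ> \<pi>) k t = heine_coeff J \<mu> z l k t"
proof -
  define S where "S = {I. I \<subseteq> J \<and> card I = k}"
  have inj: "inj_on \<pi> I" if "I \<in> S" for I
    using that \<pi> by (auto simp: S_def bij_betw_def intro: inj_on_subset)
  have bij: "bij_betw ((`) \<pi>) S S"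
  proof -
    have pow: "bij_betw ((`) \<pi>) (Pow J) (Pow J)" using \<pi> by (rule bij_betw_Pow)
    have im: "(`) \<pi> ` S = S"
    proof -
      have c: "card (\<pi> ` I) = card I" if "I \<subseteq> J" for I
        using that \<pi> by (intro card_image) (auto simp: bij_betw_def intro: inj_on_subset)
      moreover have \<pi>J: "\<pi> ` J = J" using \<pi> by (simp add: bij_betw_def)
      ultimately have "\<pi> ` I \<in> S" if "I \<in> S" for I
        using that image_mono[of I J \<pi>] by (simp add: S_def)
      moreover have "I \<in> (`) \<pi> ` S" if I: "I \<in> S" for I
      proof -
        have "I \<subseteq> \<pi> ` J" using I by (simp add: \<pi>J S_def)
        then obtain I' where I': "I' \<subseteq> J" "I = \<pi> ` I'" by (rule subset_imageE)
        then have "I' \<in> S" using I c[OF I'(1)] by (simp add: S_def)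
        then show ?thesis unfolding I'(2) by (rule imageI)
      qed
      ultimately show ?thesis by blast
    qed
    have "S \<subseteq> Pow J" by (auto simp: S_def)
    from bij_betw_subset[OF pow this im] show ?thesis .
  qed
  have w: "vdm_weight (\<mu> \<circ> \<pi>) (z \<circ> \<pi>) I = vdm_weight \<mu> z (\<pi> ` I)" if "I \<in> S" for I
  proof -
    have "\<pi> ` I - {\<pi> i} = \<pi> ` (I - {i})" if "i \<in> I" for i
      using that inj_on_image_set_diff[OF inj[OF \<open>I \<in> S\<close>], of I "{i}"] by simp
    moreover have "inj_on \<pi> (I - {i})" for i using inj[OF that] by (rule inj_on_subset) auto
    ultimately show ?thesis
      unfolding vdm_weight_def prod.reindex[OF inj[OF that]]
      by (intro prod.cong refl) (simp add: prod.reindex)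
  qed
  have s: "sum (l \<circ> \<pi>) I = sum l (\<pi> ` I)" if "I \<in> S" for I
    using sum.reindex[OF inj[OF that], of l] by simp
  have p: "(\<Prod>i\<in>I. cnj ((z \<circ> \<pi>) i)) = (\<Prod>i\<in>\<pi> ` I. cnj (z i))" if "I \<in> S" for I
    using prod.reindex[OF inj[OF that], of "\<lambda>i. cnj (z i)"] by simp
  have "(\<Sum>I\<in>S. of_real (vdm_weight (\<mu> \<circ> \<pi>) (z \<circ> \<pi>) I * exp (t * sum (l \<circ> \<pi>) I)) * (\<Prod>i\<in>I. cnj ((z \<circ> \<pi>) i))) =
      (\<Sum>I\<in>S. (\<lambda>I. of_real (vdm_weight \<mu> z I * exp (t * sum l I)) * (\<Prod>i\<in>I. cnj (z i))) (\<pi> ` I))"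
    by (rule sum.cong[OF refl]) (simp only: w s p)
  also have "\<dots> = (\<Sum>I\<in>S. of_real (vdm_weight \<mu> z I * exp (t * sum l I)) * (\<Prod>i\<in>I. cnj (z i)))"
    by (rule sum.reindex_bij_betw[OF bij])
  finally have num: "(\<Sum>I\<in>S. of_real (vdm_weight (\<mu> \<circ> \<pi>) (z \<circ> \<pi>) I * exp (t * sum (l \<circ> \<pi>) I)) * (\<Prod>i\<in>I. cnj ((z \<circ> \<pi>) i))) =
      (\<Sum>I\<in>S. of_real (vdm_weight \<mu> z I * exp (t * sum l I)) * (\<Prod>i\<in>I. cnj (z i)))" .
  have "(\<Sum>I\<in>S. vdm_weight (\<mu> \<circ> \<pi>) (z \<circ> \<pi>) I * exp (t * sum (l \<circ> \<pi>) I)) =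
      (\<Sum>I\<in>S. (\<lambda>I. vdm_weight \<mu> z I * exp (t * sum l I)) (\<pi> ` I))"
    by (rule sum.cong[OF refl]) (simp only: w s)
  also have "\<dots> = (\<Sum>I\<in>S. vdm_weight \<mu> z I * exp (t * sum l I))"
    by (rule sum.reindex_bij_betw[OF bij])
  finally have den: "(\<Sum>I\<in>S. vdm_weight (\<mu> \<circ> \<pi>) (z \<circ> \<pi>) I * exp (t * sum (l \<circ> \<pi>) I)) =
      (\<Sum>I\<in>S. vdm_weight \<mu> z I * exp (t * sum l I))" .
  show ?thesis unfolding heine_coeff_def S_def[symmetric] num den ..
qed

lemma heine_coeff_time_reversal: "heine_coeff J \<mu> z (\<lambda>j. - l j) k (- t) = heine_coeff J \<mu> z l k t"
  by (simp add: heine_coeff_def sum_negf)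

section \<open>Exponential remainders and uniqueness of the leading correction\<close>

lemma tendsto_exp_decay:
  assumes "\<delta> > 0"
  shows "((\<lambda>t::real. exp (- \<delta> * t)) \<longlongrightarrow> 0) at_top"
proof -
  have "filterlim (\<lambda>t. - \<delta> * t) at_bot at_top"
    using assms by (intro filterlim_tendsto_neg_mult_at_bot[OF tendsto_const]) (auto simp: filterlim_ident)
  then show ?thesis using filterlim_compose[OF exp_at_bot] by blast
qed

lemma smallo_exp_decay:
  assumes "\<gamma> > \<delta>" and r: "r \<in> O[at_top](\<lambda>t. complex_of_real (exp (- \<gamma> * t)))"
  shows "r \<in> o[at_top](\<lambda>t. complex_of_real (exp (- \<delta> * t)))"
proof (rule landau_o.big_small_trans[OF r])
  have "((\<lambda>t. complex_of_real (exp (- (\<gamma> - \<delta>) * t))) \<longlongrightarrow> of_real 0) at_top"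
    using assms by (intro tendsto_of_real tendsto_exp_decay) simp
  moreover have "complex_of_real (exp (- (\<gamma> - \<delta>) * t)) =
      complex_of_real (exp (- \<gamma> * t)) / complex_of_real (exp (- \<delta> * t))" for t
    by (simp add: algebra_simps flip: of_real_divide exp_diff)
  ultimately have "((\<lambda>t. complex_of_real (exp (- \<gamma> * t)) / complex_of_real (exp (- \<delta> * t))) \<longlongrightarrow> 0) at_top"
    by simp
  then show "(\<lambda>t. complex_of_real (exp (- \<gamma> * t))) \<in> o[at_top](\<lambda>t. complex_of_real (exp (- \<delta> * t)))"
    by (intro smalloI_tendsto) auto
qed

lemma bigo_at_bot_mirror:
  "r \<in> O[at_bot](g) \<longleftrightarrow> (\<lambda>t. r (- t)) \<in> O[at_top](\<lambda>t::real. g (- t))"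
  unfolding bigo_def at_bot_mirror eventually_filtermap by simp

text \<open>The two remainders may decay at different rates, so both are weakened to little-o of
  exp(-\<delta> t). If x and y differed, exp(-\<delta> t) would be little-o of itself.\<close>

lemma correction_coeff_unique:
  fixes x y :: complex
  assumes eq: "\<And>t. x * complex_of_real (exp (- \<delta> * t)) + r t = y * complex_of_real (exp (- \<delta> * t)) + s t"
    and r: "r \<in> O[at_top](\<lambda>t. complex_of_real (exp (- \<gamma> * t)))" "\<gamma> > \<delta>"
    and s: "s \<in> O[at_top](\<lambda>t. complex_of_real (exp (- \<gamma>' * t)))" "\<gamma>' > \<delta>"
  shows "x = y"
proof (rule ccontr)
  assume xy: "x \<noteq> y"
  have "(\<lambda>t. s t - r t) \<in> o[at_top](\<lambda>t. complex_of_real (exp (- \<delta> * t)))"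
    by (intro sum_in_smallo smallo_exp_decay[OF r(2,1)] smallo_exp_decay[OF s(2,1)])
  moreover have "s t - r t = (x - y) * complex_of_real (exp (- \<delta> * t))" for t
    using eq[of t] by (simp add: algebra_simps)
  ultimately have "(\<lambda>t. complex_of_real (exp (- \<delta> * t))) \<in> o[at_top](\<lambda>t. complex_of_real (exp (- \<delta> * t)))"
    using xy by simp
  then show False by (simp add: landau_o.small_refl_iff)
qed

text \<open>
  The limits at plus infinity. Shifting the index by one makes the convention
  \<open>\<alpha> (-1) = -1\<close> the empty product.
\<close>

definition limit_coeff :: "(nat \<Rightarrow> complex) \<Rightarrow> int \<Rightarrow> complex" where
  "limit_coeff z j = - ((-1) ^ nat (j + 1) * (\<Prod>i=1..nat (j + 1). cnj (z i)))"

definition mirror :: "nat \<Rightarrow> nat \<Rightarrow> nat" where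
  "mirror n i = n + 1 - i"

lemma bij_mirror: "bij_betw (mirror n) {1..n} {1..n}"
  by (rule bij_betwI[of _ _ _ "mirror n"]) (auto simp: mirror_def)

lemma limit_coeff_nonzero:
  assumes "\<And>i. i \<in> {1..n} \<Longrightarrow> cmod (z i) = 1" "j < int n"
  shows "limit_coeff z j \<noteq> 0"
proof -
  have "nat (j + 1) \<le> n" using assms(2) by simp
  then have "z i \<noteq> 0" if "i \<in> {1..nat (j + 1)}" for i
    using assms(1)[of i] that by auto
  then show ?thesis by (simp add: limit_coeff_def)
qed

text \<open>Consecutive limits differ by the factor -cnj(z_j), whose inverse is -z_j on the circle.
  For \<open>j = 1\<close> the numerator contains the limit at index -1, equal to -1 as an empty
  product.\<close>

lemma limit_coeff_ratio:
  assumes z: "\<And>i. i \<in> {1..n} \<Longrightarrow> cmod (z i) = 1" and j: "j \<in> {1..n}"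
  shows "z j = - limit_coeff z (int j - 2) / limit_coeff z (int j - 1)"
proof -
  obtain k where k: "j = Suc k" using j by (cases j) auto
  have zj: "z j * cnj (z j) = 1"
    using z[OF j] by (simp flip: complex_norm_square)
  have "z i \<noteq> 0" if "i \<in> {1..k}" for i
    using z[of i] j k that by auto
  then have P: "(\<Prod>i=1..k. cnj (z i)) \<noteq> 0" by simp
  have "limit_coeff z (int j - 2) = - ((-1) ^ k * (\<Prod>i=1..k. cnj (z i)))"
    by (simp add: limit_coeff_def k nat_add_distrib)
  moreover have "limit_coeff z (int j - 1) = (-1) ^ k * ((\<Prod>i=1..k. cnj (z i)) * cnj (z j))"
    by (simp add: limit_coeff_def k nat_add_distrib)
  moreover have "cnj (z j) \<noteq> 0" using zj by auto
  moreover have "1 / cnj (z j) = z j" using zj \<open>cnj (z j) \<noteq> 0\<close> by (simp add: field_simps)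
  ultimately show ?thesis using P by simp
qed

text \<open>Reversing labels turns the first n - k factors into those with indices k + 1 to n, so
  the two products complete each other; the two leading minus signs cancel.\<close>

lemma limit_coeff_product:
  assumes k: "k \<le> n"
  shows "limit_coeff z (int k - 1) * limit_coeff (z \<circ> mirror n) (int n - int k - 1) =
    (-1) ^ n * (\<Prod>i=1..n. cnj (z i))"
proof -
  have "(\<Prod>i=1..n - k. cnj ((z \<circ> mirror n) i)) = (\<Prod>i=k + 1..n. cnj (z i))"
    by (rule prod.reindex_bij_witness[of _ "mirror n" "mirror n"]) (use k in \<open>auto simp: mirror_def\<close>)
  moreover have "(\<Prod>i=1..n. cnj (z i)) = (\<Prod>i=1..k. cnj (z i)) * (\<Prod>i=k + 1..n. cnj (z i))"
  proof -
    have "{1..n} = {1..k} \<union> {k + 1..n}" using k by auto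
    then show ?thesis by (simp add: prod.union_disjoint)
  qed
  moreover have "nat (int n - int k - 1 + 1) = n - k" "nat (int k - 1 + 1) = k" using k by auto
  moreover have "(-1 :: complex) ^ n = (-1) ^ k * (-1) ^ (n - k)" using k by (simp flip: power_add)
  ultimately show ?thesis unfolding limit_coeff_def by simp
qed

text \<open>Under reversal, the indices n - k and n - k + 1 become k + 1 and k. The weight ratios
  are then reciprocal and cancel, and the two prefactors are complex conjugates whose product is
  |z_{k+1} - z_k|^2, as z_{k+1} has modulus 1.\<close>

lemma leading_correction_product:
  assumes z: "\<And>i. i \<in> {1..n} \<Longrightarrow> cmod (z i) = 1" and \<mu>: "\<And>i. i \<in> {1..n} \<Longrightarrow> \<mu> i > 0"
    and k: "k \<in> {1..<n}"
  shows "leading_correction \<mu> z k * leading_correction (\<mu> \<circ> mirror n) (z \<circ> mirror n) (n - k) =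
    complex_of_real ((cmod (z (k + 1) - z k))\<^sup>2 *
      (\<Prod>i=1..k - 1. (cmod ((z (k + 1) - z i) / (z k - z i)))\<^sup>2) *
      (\<Prod>m=k + 2..n. (cmod ((z k - z m) / (z (k + 1) - z m)))\<^sup>2))"
proof -
  have f: "mirror n (n - k) = k + 1" "mirror n (n - k + 1) = k" using k by (auto simp: mirror_def)
  have p: "(\<Prod>i=1..n - k - 1. (cmod (((z \<circ> mirror n) (n - k + 1) - (z \<circ> mirror n) i) / ((z \<circ> mirror n) (n - k) - (z \<circ> mirror n) i)))\<^sup>2) =
      (\<Prod>m=k + 2..n. (cmod ((z k - z m) / (z (k + 1) - z m)))\<^sup>2)"
    by (rule prod.reindex_bij_witness[of _ "mirror n" "mirror n"]) (use k f in \<open>auto simp: mirror_def\<close>)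
  have \<mu>1: "\<mu> (k + 1) / \<mu> k * (\<mu> k / \<mu> (k + 1)) = 1"
    using \<mu>[of k] \<mu>[of "k + 1"] k by simp
  have "(z k * cnj (z (k + 1)) - 1) * (z (k + 1) * cnj (z k) - 1) = of_real ((cmod (z k * cnj (z (k + 1)) - 1))\<^sup>2)"
    unfolding complex_norm_square by (simp add: mult.commute)
  also have "cmod (z k * cnj (z (k + 1)) - 1) = cmod (z (k + 1) - z k)"
  proof -
    have "cnj (z (k + 1)) * z (k + 1) = 1"
      using z[of "k + 1"] k by (simp add: mult.commute flip: complex_norm_square)
    then have "(z k * cnj (z (k + 1)) - 1) * z (k + 1) = z k - z (k + 1)"
      by (simp add: algebra_simps)
    then have "cmod (z k * cnj (z (k + 1)) - 1) * cmod (z (k + 1)) = cmod (z k - z (k + 1))"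
      by (simp flip: norm_mult)
    then show ?thesis using z[of "k + 1"] k by (simp add: norm_minus_commute)
  qed
  finally have w: "(z k * cnj (z (k + 1)) - 1) * (z (k + 1) * cnj (z k) - 1) = of_real ((cmod (z (k + 1) - z k))\<^sup>2)" .
  define P where "P = (\<Prod>i=1..k - 1. (cmod ((z (k + 1) - z i) / (z k - z i)))\<^sup>2)"
  define Q where "Q = (\<Prod>m=k + 2..n. (cmod ((z k - z m) / (z (k + 1) - z m)))\<^sup>2)"
  have "leading_correction \<mu> z k * leading_correction (\<mu> \<circ> mirror n) (z \<circ> mirror n) (n - k) =
      ((z k * cnj (z (k + 1)) - 1) * (z (k + 1) * cnj (z k) - 1)) *
      of_real ((\<mu> (k + 1) / \<mu> k * (\<mu> k / \<mu> (k + 1))) * P * Q)"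
    unfolding leading_correction_def p P_def[symmetric] Q_def[symmetric]
    by (simp only: comp_apply f of_real_mult mult_ac)
  then show ?thesis unfolding w \<mu>1 P_def[symmetric] Q_def[symmetric] by simp
qed

text \<open>Only one index set has full size, so its weight and exponential cancel; this is why
  \<alpha>_{n-1} is constant in time.\<close>

lemma heine_coeff_full:
  assumes "finite J" "inj_on z J" "\<And>j. j \<in> J \<Longrightarrow> \<mu> j > 0"
  shows "heine_coeff J \<mu> z l (card J) t = (\<Prod>i\<in>J. cnj (z i))"
proof -
  have "{I. I \<subseteq> J \<and> card I = card J} = {J}"
    using card_subset_eq[OF assms(1)] by auto
  moreover have "vdm_weight \<mu> z J > 0" using assms by (intro vdm_weight_pos[of J]) auto
  ultimately show ?thesis by (simp add: heine_coeff_def)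
qed

context
  fixes n :: nat and \<mu> :: "nat \<Rightarrow> real" and z :: "nat \<Rightarrow> complex" and l :: "nat \<Rightarrow> real"
    and \<alpha> :: "real \<Rightarrow> int \<Rightarrow> complex"
  assumes l: "\<And>i j. 1 \<le> i \<Longrightarrow> i < j \<Longrightarrow> j \<le> n \<Longrightarrow> l j < l i"
    and z: "inj_on z {1..n}" "\<And>j. j \<in> {1..n} \<Longrightarrow> cmod (z j) = 1"
    and \<mu>: "\<And>j. j \<in> {1..n} \<Longrightarrow> \<mu> j > 0"
    and \<alpha>: "\<And>t. \<alpha> t (-1) = -1"
      "\<And>t k. k < n \<Longrightarrow> \<alpha> t (int k) = (-1) ^ k * heine_coeff {1..n} \<mu> z l (Suc k) t"
begin

text \<open>The family \<alpha> is only assumed to be given by \<open>heine_coeff\<close>, so the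
  result applies both to the flow and to its time reversal with reversed labels.\<close>

lemma verblunsky_expansion_at_top:
  assumes k: "k \<in> {1..<n}"
  shows "\<exists>\<gamma> > l k - l (k + 1). \<exists>r. r \<in> O[at_top](\<lambda>t. complex_of_real (exp (- \<gamma> * t))) \<and>
    (\<forall>t. \<alpha> t (int k - 1) = limit_coeff z (int k - 1) *
      (1 + leading_correction \<mu> z k * complex_of_real (exp (- (l k - l (k + 1)) * t)) + r t))"
proof -
  obtain \<gamma> K where \<gamma>: "\<gamma> > l k - l (k + 1)" and K: "\<And>t. t \<ge> 0 \<Longrightarrow>
    cmod (heine_coeff {1..n} \<mu> z l k t / (\<Prod>i=1..k. cnj (z i)) - 1 -
      leading_correction \<mu> z k * of_real (exp (- (l k - l (k + 1)) * t))) \<le> K * exp (- \<gamma> * t)"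
    using heine_coeff_asymp[of n l z \<mu> k, OF l z \<mu>] k by auto
  \<comment> \<open>The remainder is defined by the equation itself, which therefore holds for all
    \<open>t\<close>, although the bound is available only for \<open>t \<ge> 0\<close>.\<close>
  define r where "r t = heine_coeff {1..n} \<mu> z l k t / (\<Prod>i=1..k. cnj (z i)) - 1 -
      leading_correction \<mu> z k * of_real (exp (- (l k - l (k + 1)) * t))" for t
  have "r \<in> O[at_top](\<lambda>t. complex_of_real (exp (- \<gamma> * t)))"
    by (rule bigoI[of _ K]) (use K in \<open>auto simp: r_def eventually_at_top_linorder intro!: exI[of _ 0]\<close>)
  moreover have "\<alpha> t (int k - 1) = limit_coeff z (int k - 1) *
      (1 + leading_correction \<mu> z k * complex_of_real (exp (- (l k - l (k + 1)) * t)) + r t)" for t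
  proof -
    obtain k' where k': "k = Suc k'" using k by (cases k) auto
    have "\<alpha> t (int k - 1) = (-1) ^ k' * heine_coeff {1..n} \<mu> z l k t"
      using \<alpha>(2)[of k' t] k by (simp add: k')
    moreover have "limit_coeff z (int k - 1) = (-1) ^ k' * (\<Prod>i=1..k. cnj (z i))"
      by (simp add: limit_coeff_def k' nat_add_distrib)
    moreover have "limit_coeff z (int k - 1) \<noteq> 0"
      using k z(2) by (intro limit_coeff_nonzero[of n]) auto
    ultimately show ?thesis by (simp add: r_def)
  qed
  ultimately show ?thesis using \<gamma> by blast
qed

text \<open>The two end indices are constant in time and lie outside the range of the expansion, so
  they are treated separately.\<close>

lemma verblunsky_limit_at_top:
  assumes j: "j \<in> {-1..int n - 1}"
  shows "((\<lambda>t. \<alpha> t j) \<longlongrightarrow> limit_coeff z j) at_top"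
proof -
  consider "j = -1" | "j = int n - 1" "n \<ge> 1" | "0 \<le> j" "j < int n - 1" using j by force
  then show ?thesis
  proof cases
    case 1
    then show ?thesis by (simp add: \<alpha>(1) limit_coeff_def)
  next
    case 2
    then obtain n' where n': "n = Suc n'" by (cases n) auto
    have "\<alpha> t j = limit_coeff z j" for t
      using \<alpha>(2)[of n' t] heine_coeff_full[of "{1..n}" z \<mu> l t] z(1) \<mu> 2
      by (simp add: n' limit_coeff_def nat_add_distrib)
    then show ?thesis by simp
  next
    case 3
    define k where "k = nat (j + 1)"
    have k: "k \<in> {1..<n}" and jk: "j = int k - 1" using 3 by (auto simp: k_def)
    define \<delta> where "\<delta> = l k - l (k + 1)"
    have \<delta>: "\<delta> > 0" using l[of k "k + 1"] k by (simp add: \<delta>_def)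
    obtain \<gamma> r where \<gamma>: "\<gamma> > \<delta>" and r: "r \<in> O[at_top](\<lambda>t. complex_of_real (exp (- \<gamma> * t)))"
      and e: "\<And>t. \<alpha> t j = limit_coeff z j * (1 + leading_correction \<mu> z k * complex_of_real (exp (- \<delta> * t)) + r t)"
      using verblunsky_expansion_at_top[OF k] unfolding jk \<delta>_def by blast
    \<comment> \<open>Rate 0 in the comparison function makes this the statement that
      \<open>r\<close> tends to 0.\<close>
    have "r \<in> o[at_top](\<lambda>t. complex_of_real (exp (- 0 * t)))"
      using \<delta> \<gamma> by (intro smallo_exp_decay[OF _ r]) simp
    then have "(r \<longlongrightarrow> 0) at_top" using smalloD_tendsto by fastforce
    then have "((\<lambda>t. limit_coeff z j * (1 + leading_correction \<mu> z k * complex_of_real (exp (- \<delta> * t)) + r t)) \<longlongrightarrow>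
        limit_coeff z j * (1 + leading_correction \<mu> z k * of_real 0 + 0)) at_top"
      by (intro tendsto_intros tendsto_exp_decay \<delta>)
    then show ?thesis unfolding e by simp
  qed
qed

end

text \<open>The rates \<open>l'\<close>, reversed in label and negated, are again strictly
  decreasing, and their gap at k is l_{n-k} - l_{n-k+1}, exactly the rate required at minus
  infinity.\<close>

lemma asymptotic_data_heine:
  assumes l: "\<And>i j. 1 \<le> i \<Longrightarrow> i < j \<Longrightarrow> j \<le> n \<Longrightarrow> l j < l i"
    and z: "inj_on z {1..n}" "\<And>j. j \<in> {1..n} \<Longrightarrow> cmod (z j) = 1"
    and \<mu>: "\<And>j. j \<in> {1..n} \<Longrightarrow> \<mu> j > 0"
    and \<alpha>: "\<And>t. \<alpha> t (-1) = -1"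
      "\<And>t k. k < n \<Longrightarrow> \<alpha> t (int k) = (-1) ^ k * heine_coeff {1..n} \<mu> z l (Suc k) t"
  shows "asymptotic_data n \<alpha> l (limit_coeff z) (limit_coeff (z \<circ> mirror n))
    (\<lambda>k. leading_correction \<mu> z (k + 1)) (\<lambda>k. leading_correction (\<mu> \<circ> mirror n) (z \<circ> mirror n) (k + 1))"
proof -
  define l' where "l' = (\<lambda>j. - (l \<circ> mirror n) j)"
  have f: "mirror n j \<in> {1..n}" if "j \<in> {1..n}" for j using that by (auto simp: mirror_def)
  have l': "l' j < l' i" if "1 \<le> i" "i < j" "j \<le> n" for i j
    using that l[of "mirror n j" "mirror n i"] by (simp add: l'_def mirror_def)
  have z': "inj_on (z \<circ> mirror n) {1..n}" "\<And>j. j \<in> {1..n} \<Longrightarrow> cmod ((z \<circ> mirror n) j) = 1"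
    using z bij_mirror[of n] f by (auto simp: bij_betw_def comp_inj_on)
  have \<mu>': "(\<mu> \<circ> mirror n) j > 0" if "j \<in> {1..n}" for j using \<mu> f[OF that] by simp
  have \<alpha>': "\<alpha> (- t) (int k) = (-1) ^ k * heine_coeff {1..n} (\<mu> \<circ> mirror n) (z \<circ> mirror n) l' (Suc k) t"
    if "k < n" for t k
    using \<alpha>(2)[OF that, of "- t"] heine_coeff_permute[OF bij_mirror, of n \<mu> z l "Suc k" "- t"]
      heine_coeff_time_reversal[of "{1..n}" "\<mu> \<circ> mirror n" "z \<circ> mirror n" "l \<circ> mirror n" "Suc k" "- t"]
    by (simp add: l'_def)
  note top = l z \<mu> \<alpha>
  note bot = l' z' \<mu>' \<alpha>(1) \<alpha>'
  show ?thesis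
    unfolding asymptotic_data_def
  proof (intro conjI ballI)
    fix j assume j: "j \<in> {-1..int n - 1}"
    show "((\<lambda>t. \<alpha> t j) \<longlongrightarrow> limit_coeff z j) at_top"
      by (rule verblunsky_limit_at_top[OF top j])
    have "((\<lambda>t. \<alpha> (- t) j) \<longlongrightarrow> limit_coeff (z \<circ> mirror n) j) at_top"
      by (rule verblunsky_limit_at_top[OF bot j])
    then show "((\<lambda>t. \<alpha> t j) \<longlongrightarrow> limit_coeff (z \<circ> mirror n) j) at_bot"
      by (simp add: filterlim_at_bot_mirror)
  next
    fix k assume k: "k \<in> {1..<n}"
    then have k1: "k - 1 + 1 = k" by simp
    show "\<exists>\<gamma>>l k - l (k + 1). \<exists>r. r \<in> O[at_top](\<lambda>t. complex_of_real (exp (- \<gamma> * t))) \<and>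
      (\<forall>t. \<alpha> t (int k - 1) = limit_coeff z (int k - 1) *
         (1 + leading_correction \<mu> z (k - 1 + 1) * complex_of_real (exp (- (l k - l (k + 1)) * t)) + r t))"
      unfolding k1 by (rule verblunsky_expansion_at_top[OF top k])
    have lk: "l' k - l' (k + 1) = l (n - k) - l (n - k + 1)"
      using k by (simp add: l'_def mirror_def Suc_diff_le)
    obtain \<gamma> r where \<gamma>: "\<gamma> > l (n - k) - l (n - k + 1)"
      and r: "r \<in> O[at_top](\<lambda>t. complex_of_real (exp (- \<gamma> * t)))"
      and e: "\<And>t. \<alpha> (- t) (int k - 1) = limit_coeff (z \<circ> mirror n) (int k - 1) *
        (1 + leading_correction (\<mu> \<circ> mirror n) (z \<circ> mirror n) k *
          complex_of_real (exp (- (l (n - k) - l (n - k + 1)) * t)) + r t)"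
      using verblunsky_expansion_at_top[OF bot k] unfolding lk by blast
    have "(\<lambda>t. r (- t)) \<in> O[at_bot](\<lambda>t. complex_of_real (exp (\<gamma> * t)))"
      unfolding bigo_at_bot_mirror using r by simp
    moreover have "\<alpha> t (int k - 1) = limit_coeff (z \<circ> mirror n) (int k - 1) *
        (1 + leading_correction (\<mu> \<circ> mirror n) (z \<circ> mirror n) k *
          complex_of_real (exp ((l (n - k) - l (n - k + 1)) * t)) + r (- t))" for t
    proof -
      have "- (l (n - k) - l (n - k + 1)) * - t = (l (n - k) - l (n - k + 1)) * t" by (simp add: algebra_simps)
      then show ?thesis using e[of "- t"] by (simp only: minus_minus)
    qed
    ultimately show "\<exists>\<gamma>>l (n - k) - l (n - k + 1). \<exists>r. r \<in> O[at_bot](\<lambda>t. complex_of_real (exp (\<gamma> * t))) \<and>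
      (\<forall>t. \<alpha> t (int k - 1) = limit_coeff (z \<circ> mirror n) (int k - 1) *
         (1 + leading_correction (\<mu> \<circ> mirror n) (z \<circ> mirror n) (k - 1 + 1) *
           complex_of_real (exp ((l (n - k) - l (n - k + 1)) * t)) + r t))"
      unfolding k1 using \<gamma> by blast
  qed
qed

text \<open>The expansions contain the correction only multiplied by the limit, so comparing
  coefficients requires a nonzero limit.\<close>

lemma asymptotic_data_unique:
  assumes A: "asymptotic_data n \<alpha> l \<alpha>p \<alpha>m \<xi> \<zeta>" and B: "asymptotic_data n \<alpha> l \<beta>p \<beta>m \<xi>' \<zeta>'"
  shows "j \<in> {-1..int n - 1} \<Longrightarrow> \<alpha>p j = \<beta>p j" "j \<in> {-1..int n - 1} \<Longrightarrow> \<alpha>m j = \<beta>m j"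
    and "k \<in> {1..<n} \<Longrightarrow> \<beta>p (int k - 1) \<noteq> 0 \<Longrightarrow> \<xi> (k - 1) = \<xi>' (k - 1)"
    and "k \<in> {1..<n} \<Longrightarrow> \<beta>m (int k - 1) \<noteq> 0 \<Longrightarrow> \<zeta> (k - 1) = \<zeta>' (k - 1)"
proof -
  show p: "\<alpha>p j = \<beta>p j" if "j \<in> {-1..int n - 1}" for j
    using A B that unfolding asymptotic_data_def
    by (intro tendsto_unique[of at_top "\<lambda>t. \<alpha> t j"]) auto
  show m: "\<alpha>m j = \<beta>m j" if "j \<in> {-1..int n - 1}" for j
    using A B that unfolding asymptotic_data_def
    by (intro tendsto_unique[of at_bot "\<lambda>t. \<alpha> t j"]) auto
  show "\<xi> (k - 1) = \<xi>' (k - 1)" if k: "k \<in> {1..<n}" and nz: "\<beta>p (int k - 1) \<noteq> 0"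
  proof -
    define \<delta> where "\<delta> = l k - l (k + 1)"
    obtain \<gamma> r where r: "r \<in> O[at_top](\<lambda>t. complex_of_real (exp (- \<gamma> * t)))" "\<gamma> > \<delta>"
      and er: "\<And>t. \<alpha> t (int k - 1) = \<alpha>p (int k - 1) * (1 + \<xi> (k - 1) * complex_of_real (exp (- \<delta> * t)) + r t)"
      using A k unfolding asymptotic_data_def \<delta>_def by blast
    obtain \<gamma>' s where s: "s \<in> O[at_top](\<lambda>t. complex_of_real (exp (- \<gamma>' * t)))" "\<gamma>' > \<delta>"
      and es: "\<And>t. \<alpha> t (int k - 1) = \<beta>p (int k - 1) * (1 + \<xi>' (k - 1) * complex_of_real (exp (- \<delta> * t)) + s t)"
      using B k unfolding asymptotic_data_def \<delta>_def by blast
    have pk: "\<alpha>p (int k - 1) = \<beta>p (int k - 1)" using k by (intro p) auto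
    have "\<xi> (k - 1) * complex_of_real (exp (- \<delta> * t)) + r t = \<xi>' (k - 1) * complex_of_real (exp (- \<delta> * t)) + s t" for t
      using er[of t] es[of t] nz unfolding pk by (simp add: add.assoc)
    then show ?thesis by (rule correction_coeff_unique[OF _ r s])
  qed
  show "\<zeta> (k - 1) = \<zeta>' (k - 1)" if k: "k \<in> {1..<n}" and nz: "\<beta>m (int k - 1) \<noteq> 0"
  proof -
    define \<delta> where "\<delta> = l (n - k) - l (n - k + 1)"
    obtain \<gamma> r where r: "r \<in> O[at_bot](\<lambda>t. complex_of_real (exp (\<gamma> * t)))" "\<gamma> > \<delta>"
      and er: "\<And>t. \<alpha> t (int k - 1) = \<alpha>m (int k - 1) * (1 + \<zeta> (k - 1) * complex_of_real (exp (\<delta> * t)) + r t)"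
      using A k unfolding asymptotic_data_def \<delta>_def by blast
    obtain \<gamma>' s where s: "s \<in> O[at_bot](\<lambda>t. complex_of_real (exp (\<gamma>' * t)))" "\<gamma>' > \<delta>"
      and es: "\<And>t. \<alpha> t (int k - 1) = \<beta>m (int k - 1) * (1 + \<zeta>' (k - 1) * complex_of_real (exp (\<delta> * t)) + s t)"
      using B k unfolding asymptotic_data_def \<delta>_def by blast
    have mk: "\<alpha>m (int k - 1) = \<beta>m (int k - 1)" using k by (intro m) auto
    have eq: "\<zeta> (k - 1) * complex_of_real (exp (- \<delta> * t)) + r (- t) = \<zeta>' (k - 1) * complex_of_real (exp (- \<delta> * t)) + s (- t)" for t
      using er[of "- t"] es[of "- t"] nz unfolding mk by (simp add: add.assoc)
    have "(\<lambda>t. r (- t)) \<in> O[at_top](\<lambda>t. complex_of_real (exp (- \<gamma> * t)))"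
      "(\<lambda>t. s (- t)) \<in> O[at_top](\<lambda>t. complex_of_real (exp (- \<gamma>' * t)))"
      using r(1) s(1) unfolding bigo_at_bot_mirror by simp_all
    then show ?thesis using correction_coeff_unique[OF eq] r(2) s(2) by blast
  qed
qed

subsection \<open>Spectral data of a CMV matrix\<close>

lemma monic_poly_eq_prod_roots:
  fixes p :: "'a :: field poly"
  assumes J: "finite J" "inj_on z J" and deg: "degree p \<le> card J" and monic: "coeff p (card J) = 1"
    and roots: "\<And>j. j \<in> J \<Longrightarrow> poly p (z j) = 0"
  shows "p = (\<Prod>j\<in>J. [:- z j, 1:])"
proof (rule ccontr)
  define d where "d = p - (\<Prod>j\<in>J. [:- z j, 1:])"
  assume "p \<noteq> (\<Prod>j\<in>J. [:- z j, 1:])"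
  then have "d \<noteq> 0" by (simp add: d_def)
  moreover have "coeff d (card J) = 0" using monic monic_prod_linear(2)[OF J(1), of z] by (simp add: d_def)
  ultimately have "degree d \<noteq> card J" by (metis leading_coeff_0_iff)
  moreover have "degree d \<le> card J"
    unfolding d_def using deg monic_prod_linear(1)[OF J(1), of z] by (intro degree_diff_le) auto
  moreover have "poly d (z j) = 0" if "j \<in> J" for j
    using roots[OF that] that J(1) by (auto simp: d_def poly_prod intro: prod_zero)
  ultimately show False using poly_eq_0_if_many_roots[OF J, of d] \<open>d \<noteq> 0\<close> by simp
qed

text \<open>The bijection provides \<open>n\<close> distinct roots, so the characteristic polynomial
  splits with exactly these factors; comparing its value at 0 with det(-U) gives the claim.\<close>

lemma det_eq_prod_spectrum:
  assumes U: "(U :: complex mat) \<in> carrier_mat n n" and z: "bij_betw z {1..n} (spectrum U)"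
  shows "Determinant.det U = (\<Prod>j=1..n. z j)"
proof -
  have "char_poly U = (\<Prod>j\<in>{1..n}. [:- z j, 1:])"
  proof (rule monic_poly_eq_prod_roots)
    show "inj_on z {1..n}" using z by (simp add: bij_betw_def)
    show "degree (char_poly U) \<le> card {1..n}" "coeff (char_poly U) (card {1..n}) = 1"
      using degree_monic_char_poly[OF U] by auto
    show "poly (char_poly U) (z j) = 0" if "j \<in> {1..n}" for j
      using that z spectrum_root_char_poly[OF U] by (auto simp: bij_betw_def)
  qed simp
  then have "poly (char_poly U) 0 = (-1) ^ n * (\<Prod>j=1..n. z j)"
    using prod.distrib[of "\<lambda>_. -1" z "{1..n}"] by (simp add: poly_prod)
  moreover have "poly (char_poly U) 0 = (-1) ^ n * Determinant.det U"
  proof -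
    have "- char_matrix U 0 = (-1) \<cdot>\<^sub>m U"
      using U by (intro eq_matI) (auto simp: char_matrix_def)
    then show ?thesis using char_poly_matrix[OF U, of 0] U by (simp add: det_smult)
  qed
  ultimately show ?thesis by simp
qed

lemma det_adjoint_unitary:
  assumes U: "(U :: complex mat) \<in> carrier_mat n n" and un: "mat_adjoint U * U = 1\<^sub>m n"
    and z: "bij_betw z {1..n} (spectrum U)"
  shows "Determinant.det (mat_adjoint U) = (\<Prod>j=1..n. cnj (z j))"
proof -
  have "z j * cnj (z j) = 1" if "j \<in> {1..n}" for j
  proof -
    have "eigenvalue U (z j)" using z that by (auto simp: bij_betw_def spectrum_def)
    then show ?thesis using unitary_eigenvalue_norm[OF U un] by (simp flip: complex_norm_square)
  qed
  then have 1: "(\<Prod>j=1..n. z j) * (\<Prod>j=1..n. cnj (z j)) = 1"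
    unfolding prod.distrib[symmetric] by (intro prod.neutral) auto
  have "Determinant.det (mat_adjoint U) * Determinant.det U = 1"
    using det_mult[of "mat_adjoint U" n U] U un by simp
  then have 2: "Determinant.det (mat_adjoint U) * (\<Prod>j=1..n. z j) = 1" by (simp only: det_eq_prod_spectrum[OF U z])
  have "Determinant.det (mat_adjoint U) = Determinant.det (mat_adjoint U) * ((\<Prod>j=1..n. z j) * (\<Prod>j=1..n. cnj (z j)))"
    by (simp only: 1) simp
  also have "\<dots> = (Determinant.det (mat_adjoint U) * (\<Prod>j=1..n. z j)) * (\<Prod>j=1..n. cnj (z j))"
    by (simp only: mult.assoc)
  finally show ?thesis unfolding 2 by simp
qed

text \<open>Phi_n(C) kills e_1 and hence vanishes by cyclicity. Every eigenvalue is then a root of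
  Phi_n, which is monic of degree \<open>n\<close> and so equals the product.\<close>

lemma cmv_annihilated:
  assumes n: "n \<ge> 1" and v: "verblunsky n \<alpha>" and z: "bij_betw z {1..n} (spectrum (cmv n \<alpha>))"
  shows "poly_mat (\<Prod>j\<in>{1..n}. [:- z j, 1:]) (cmv n \<alpha>) = 0\<^sub>m n n"
proof -
  define a where "a = (\<lambda>k. \<alpha> (int k))"
  have 0: "poly_mat (szego a n) (cmv n \<alpha>) = 0\<^sub>m n n"
    unfolding a_def by (rule cmv_cyclic[OF n v szego_n_col[OF n v]])
  have "szego a n = (\<Prod>j\<in>{1..n}. [:- z j, 1:])"
  proof (rule monic_poly_eq_prod_roots)
    show "inj_on z {1..n}" using z by (simp add: bij_betw_def)
    show "poly (szego a n) (z j) = 0" if "j \<in> {1..n}" for j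
      using z that by (intro eigenvalue_root[OF cmv_carrier[OF n v] _ 0]) (auto simp: bij_betw_def spectrum_def)
  qed (simp_all add: degree_szego szego_monic)
  then show ?thesis using 0 by simp
qed

context
  fixes n :: nat and \<alpha> :: "int \<Rightarrow> complex" and J :: "'j set" and z :: "'j \<Rightarrow> complex"
  assumes n: "n \<ge> 1" and v: "verblunsky n \<alpha>" and J: "finite J" "inj_on z J"
    and circ: "\<And>j. j \<in> J \<Longrightarrow> cmod (z j) = 1"
    and ann: "poly_mat (\<Prod>j\<in>J. [:- z j, 1:]) (cmv n \<alpha>) = 0\<^sub>m n n"
begin

lemmas cmv_spectral = cmv_carrier[OF n v] n cmv_unitary[OF n v] J circ ann

text \<open>A zero weight means a zero first column of the projection L_j(C), hence a zero
  projection by cyclicity. The eigenvalue z_j would then be a root of L_j, although L_j(z_j) =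
  1.\<close>

lemma cmv_spectral_weight_pos:
  assumes j: "j \<in> J" and ev: "eigenvalue (cmv n \<alpha>) (z j)"
  shows "spectral_weight (cmv n \<alpha>) J z j > 0"
proof -
  let ?E = "poly_mat (lagrange J z j) (cmv n \<alpha>)"
  have w: "spectral_weight (cmv n \<alpha>) J z j = (\<Sum>a<n. (cmod (?E $$ (a, 0)))\<^sup>2)"
    by (rule spectral_weight_norm[OF cmv_spectral j])
  have "spectral_weight (cmv n \<alpha>) J z j \<noteq> 0"
  proof
    assume "spectral_weight (cmv n \<alpha>) J z j = 0"
    then have "\<forall>a\<in>{..<n}. (cmod (?E $$ (a, 0)))\<^sup>2 = 0"
      unfolding w by (subst (asm) sum_nonneg_eq_0_iff) auto
    then have "?E = 0\<^sub>m n n" by (intro cmv_cyclic[OF n v]) auto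
    then have "poly (lagrange J z j) (z j) = 0" by (rule eigenvalue_root[OF cmv_carrier[OF n v] ev])
    then show False by (simp add: poly_lagrange[OF J j j])
  qed
  then show ?thesis unfolding w by (simp add: sum_nonneg less_le)
qed

text \<open>The Krylov inner product is the one of the spectral measure, so the inner products of
  the Szego vectors carry over. They are known for all indices below \<open>n\<close>, which reaches
  Phi_{k+1} even for \<open>k = n - 1\<close>.\<close>

lemma cmv_verblunsky_formula:
  assumes card: "card J = n" and \<mu>: "\<And>j. j \<in> J \<Longrightarrow> spectral_weight (cmv n \<alpha>) J z j > 0" and k: "k < n"
  defines "\<mu> \<equiv> spectral_weight (cmv n \<alpha>) J z"
  shows "\<alpha> (int k) = (-1) ^ k *
      (\<Sum>I | I \<subseteq> J \<and> card I = Suc k. of_real (vdm_weight \<mu> z I) * (\<Prod>i\<in>I. cnj (z i))) /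
      of_real (\<Sum>I | I \<subseteq> J \<and> card I = Suc k. vdm_weight \<mu> z I)"
proof -
  define a where "a = (\<lambda>k. \<alpha> (int k))"
  define r where "r k = (\<Prod>j<k. rho \<alpha> j)\<^sup>2" for k
  have ip: "circle_ip J \<mu> z p q = krylov_ip n \<alpha> p q" for p q
    unfolding \<mu>_def krylov_ip_def[OF n v] by (rule column_ip_eq_circle_ip[OF cmv_spectral, symmetric])
  have "(\<forall>i<Suc k. circle_ip J \<mu> z (monom 1 i) (szego a (Suc k)) = 0) \<and>
    (\<forall>i\<in>{1..Suc k}. circle_ip J \<mu> z (monom 1 i) (szego_rev a (Suc k)) = 0)"
    by (rule szego_orthogonal[OF circ, where K = n and r = r])
      (use k in \<open>auto simp: ip a_def r_def szego_krylov_ip[OF n v] of_real_power simp del: of_real_prod\<close>)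
  then have "circle_ip J \<mu> z (monom 1 i) (szego a (Suc k)) = 0" if "i < Suc k" for i
    using that by blast
  then show ?thesis
    using verblunsky_heine[OF J, of \<mu> k a] \<mu> k card unfolding \<mu>_def a_def by auto
qed

end

subsection \<open>Evolution of the spectral data\<close>

text \<open>The weight has degree \<open>card I\<close> in the masses, so a common factor
  contributes the same power for all index sets of one size.\<close>

lemma vdm_weight_scale:
  assumes "finite I"
  shows "vdm_weight (\<lambda>j. c * exp (t * l j) * \<mu> j) z I = c ^ card I * (vdm_weight \<mu> z I * exp (t * sum l I))"
  using assms by (simp add: vdm_weight_def prod.distrib exp_sum sum_distrib_left)

lemma vdm_weight_cong: "(\<And>j. j \<in> I \<Longrightarrow> \<mu> j = \<nu> j) \<Longrightarrow> vdm_weight \<mu> z I = vdm_weight \<nu> z I"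
  by (simp add: vdm_weight_def)

context
  fixes n :: nat and f :: "complex poly" and C :: "real \<Rightarrow> complex mat" and \<alpha> :: "real \<Rightarrow> int \<Rightarrow> complex"
    and z :: "nat \<Rightarrow> complex"
  assumes n: "n \<ge> 1"
    and flow: "hamiltonian_flow n (im_tr f) C"
    and verb: "\<And>t. verblunsky n (\<alpha> t)"
    and cmv: "\<And>t. C t = cmv n (\<alpha> t)"
    and eigenvalues: "bij_betw z {1..n} (spectrum (C 0))"
begin

lemma flow_carrier [simp]: "C t \<in> carrier_mat n n"
  by (simp add: cmv cmv_carrier[OF n verb])

lemma flow_unitary: "mat_adjoint (C t) * C t = 1\<^sub>m n" "C t * mat_adjoint (C t) = 1\<^sub>m n"
  unfolding cmv by (rule cmv_unitary[OF n verb])+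

lemma flow_eigenvalue_0: "j \<in> {1..n} \<Longrightarrow> eigenvalue (C 0) (z j)"
  using eigenvalues by (auto simp: bij_betw_def spectrum_def)

lemma flow_inj: "inj_on z {1..n}"
  using eigenvalues by (simp add: bij_betw_def)

lemma flow_circle: "j \<in> {1..n} \<Longrightarrow> cmod (z j) = 1"
  using unitary_eigenvalue_norm[OF flow_carrier flow_unitary(1) flow_eigenvalue_0] .

private abbreviation (input) "flow_skew t \<equiv> proj_a n (poly_mat (pCons 0 (pderiv f)) (C t))"

lemma flow_skew: "flow_skew t \<in> skew_mats n"
  "poly_mat (pCons 0 (pderiv f)) (C t) - flow_skew t \<in> lower_mats n"
  by (intro proj_a_props poly_mat_carrier flow_carrier)+

lemma flow_lax: "has_mat_deriv n (\<lambda>s. poly_mat p (C s))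
    (flow_skew t * poly_mat p (C t) - poly_mat p (C t) * flow_skew t) t"
proof (rule has_mat_deriv_poly_commutator)
  show "flow_skew t \<in> carrier_mat n n" using flow_skew(1)[of t] by (simp add: skew_mats_def)
  show "has_mat_deriv n C (flow_skew t * C t - C t * flow_skew t) t"
    using hamiltonian_flow_lax[OF flow, of t] by (simp only: poly_mat_pCons_0[OF flow_carrier])
qed simp

lemma flow_annihilated: "poly_mat (\<Prod>j\<in>{1..n}. [:- z j, 1:]) (C t) = 0\<^sub>m n n"
proof (rule lax_skew_preserves_zero[OF _ flow_skew(1) flow_lax])
  show "poly_mat (\<Prod>j\<in>{1..n}. [:- z j, 1:]) (C 0) = 0\<^sub>m n n"
    using cmv_annihilated[OF n verb] eigenvalues unfolding cmv by blast
qed simp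

lemmas flow_spectral = flow_carrier n flow_unitary finite_atLeastAtMost flow_inj flow_circle flow_annihilated

private abbreviation (input) "flow_weight t \<equiv> spectral_weight (C t) {1..n} z"

lemma flow_weight_deriv:
  assumes j: "j \<in> {1..n}"
  shows "((\<lambda>t. flow_weight t j) has_real_derivative
    (rate f (z j) - 2 * Re (poly_mat (pCons 0 (pderiv f)) (C t) $$ (0, 0))) * flow_weight t j) (at t)"
proof -
  have n0: "0 < n" using n by simp
  have e: "(flow_skew t * poly_mat (lagrange {1..n} z j) (C t) - poly_mat (lagrange {1..n} z j) (C t) * flow_skew t) $$ (0, 0) =
      of_real ((2 * Re (z j * poly (pderiv f) (z j)) - 2 * Re (poly_mat (pCons 0 (pderiv f)) (C t) $$ (0, 0))) * flow_weight t j)"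
    by (rule commutator_spectral_weight[OF flow_spectral flow_skew j])
  have "((\<lambda>s. poly_mat (lagrange {1..n} z j) (C s) $$ (0, 0)) has_vector_derivative
      of_real ((2 * Re (z j * poly (pderiv f) (z j)) - 2 * Re (poly_mat (pCons 0 (pderiv f)) (C t) $$ (0, 0))) * flow_weight t j)) (at t)"
    using flow_lax[of "lagrange {1..n} z j" t, unfolded has_mat_deriv_def, rule_format, OF n0 n0]
    unfolding e .
  then have "((\<lambda>s. Re (poly_mat (lagrange {1..n} z j) (C s) $$ (0, 0))) has_real_derivative
      (2 * Re (z j * poly (pderiv f) (z j)) - 2 * Re (poly_mat (pCons 0 (pderiv f)) (C t) $$ (0, 0))) * flow_weight t j) (at t)"
    unfolding has_vector_derivative_complex_iff Re_complex_of_real by blast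
  moreover have "flow_weight s j = Re (poly_mat (lagrange {1..n} z j) (C s) $$ (0, 0))" for s
    using spectral_weight_eq[OF flow_spectral j, of s] by simp
  ultimately show ?thesis by (simp only: rate_def)
qed

text \<open>Restricted to time 0, the only time at which the z_j are so far known to be eigenvalues.
  The evolution carries positivity to all times, and from that the spectrum at time \<open>t\<close>
  is recovered.\<close>

lemma flow_weight_0_pos: "j \<in> {1..n} \<Longrightarrow> flow_weight 0 j > 0"
  using cmv_spectral_weight_pos[OF n verb finite_atLeastAtMost flow_inj flow_circle flow_annihilated[unfolded cmv],
      of j 0] flow_eigenvalue_0[of j] unfolding cmv by simp

lemma flow_weight_evolution:
  "\<exists>c>0. \<forall>j\<in>{1..n}. flow_weight t j = c * exp (t * rate f (z j)) * flow_weight 0 j"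
proof (rule weights_evolution[where s = "\<lambda>t. 2 * Re (poly_mat (pCons 0 (pderiv f)) (C t) $$ (0, 0))"])
  show "flow_weight t j \<ge> 0" if "j \<in> {1..n}" for t j
    using spectral_weight_norm[OF flow_spectral that, of t] by (simp add: sum_nonneg)
  show "(\<Sum>j\<in>{1..n}. flow_weight t j) = 1" for t
    by (rule sum_spectral_weight[OF flow_spectral])
qed (use n flow_weight_deriv flow_weight_0_pos in auto)

lemma flow_weight_pos: "j \<in> {1..n} \<Longrightarrow> flow_weight t j > 0"
  using flow_weight_evolution[of t] flow_weight_0_pos[of j] by auto

text \<open>Annihilation confines the spectrum to the z_j. Conversely, a positive weight makes the
  projection for z_j nonzero, and the projection satisfies the eigenvalue equation.\<close>

lemma flow_spectrum: "spectrum (C t) = z ` {1..n}"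
proof (intro equalityI subsetI)
  fix x assume "x \<in> spectrum (C t)"
  then have "poly (\<Prod>j\<in>{1..n}. [:- z j, 1:]) x = 0"
    using eigenvalue_root[OF flow_carrier _ flow_annihilated] by (simp add: spectrum_def)
  then show "x \<in> z ` {1..n}" by (auto simp: poly_prod)
next
  fix x assume "x \<in> z ` {1..n}"
  then obtain j where j: "j \<in> {1..n}" "x = z j" by auto
  let ?E = "poly_mat (lagrange {1..n} z j) (C t)"
  have "?E $$ (0, 0) \<noteq> 0"
    using spectral_weight_eq[OF flow_spectral j(1), of t] flow_weight_pos[OF j(1), of t] by simp
  then have "?E \<noteq> 0\<^sub>m n n" using n by auto
  moreover have "C t * ?E = x \<cdot>\<^sub>m ?E" unfolding j(2) by (rule spectral_proj_eigen[OF flow_spectral j(1)])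
  ultimately have "eigenvalue (C t) x"
    unfolding eigenvalue_iff_matrix[OF flow_carrier] by (intro bexI[of _ ?E]) auto
  then show "x \<in> spectrum (C t)" by (simp add: spectrum_def)
qed

text \<open>The unknown time-dependent factor \<open>c\<close> enters numerator and denominator with
  the same power \<open>Suc k\<close> and cancels; only the initial weights and the rates
  remain.\<close>

lemma flow_verblunsky:
  assumes k: "k < n" and l: "\<And>j. j \<in> {1..n} \<Longrightarrow> l j = rate f (z j)"
  shows "\<alpha> t (int k) = (-1) ^ k * heine_coeff {1..n} (flow_weight 0) z l (Suc k) t"
proof -
  define S where "S = {I. I \<subseteq> {1..n} \<and> card I = Suc k}"
  obtain c where c: "c > 0" and ev: "\<And>j. j \<in> {1..n} \<Longrightarrow> flow_weight t j = c * exp (t * l j) * flow_weight 0 j"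
    using flow_weight_evolution[of t] l by auto
  have w: "vdm_weight (flow_weight t) z I = c ^ Suc k * (vdm_weight (flow_weight 0) z I * exp (t * sum l I))"
    if "I \<in> S" for I
  proof -
    have I: "finite I" "card I = Suc k" "I \<subseteq> {1..n}"
      using that by (auto simp: S_def intro: finite_subset)
    have "vdm_weight (flow_weight t) z I = vdm_weight (\<lambda>j. c * exp (t * l j) * flow_weight 0 j) z I"
      using I ev by (intro vdm_weight_cong) auto
    then show ?thesis by (simp only: vdm_weight_scale[OF I(1)] I(2))
  qed
  have ann: "poly_mat (\<Prod>j\<in>{1..n}. [:- z j, 1:]) (cmv n (\<alpha> t)) = 0\<^sub>m n n"
    using flow_annihilated[of t] by (simp only: cmv)
  have "\<alpha> t (int k) = (-1) ^ k *
      (\<Sum>I\<in>S. of_real (vdm_weight (flow_weight t) z I) * (\<Prod>i\<in>I. cnj (z i))) /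
      of_real (\<Sum>I\<in>S. vdm_weight (flow_weight t) z I)"
    unfolding cmv S_def
    by (rule cmv_verblunsky_formula[OF n verb finite_atLeastAtMost flow_inj flow_circle ann])
      (use flow_weight_pos[of _ t] k in \<open>simp_all add: cmv\<close>)
  also have "(\<Sum>I\<in>S. of_real (vdm_weight (flow_weight t) z I) * (\<Prod>i\<in>I. cnj (z i))) =
      of_real (c ^ Suc k) * (\<Sum>I\<in>S. of_real (vdm_weight (flow_weight 0) z I * exp (t * sum l I)) * (\<Prod>i\<in>I. cnj (z i)))"
    unfolding sum_distrib_left[of "complex_of_real (c ^ Suc k)"] by (intro sum.cong refl) (simp only: w of_real_mult mult.assoc)
  also have "(\<Sum>I\<in>S. vdm_weight (flow_weight t) z I) =
      c ^ Suc k * (\<Sum>I\<in>S. vdm_weight (flow_weight 0) z I * exp (t * sum l I))"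
    unfolding sum_distrib_left[of "c ^ Suc k"] by (intro sum.cong refl w)
  finally show ?thesis using c
    unfolding heine_coeff_def S_def[symmetric] of_real_mult[of "c ^ Suc k"] by (simp del: power_Suc)
qed

end

text \<open>One explicit choice of asymptotic data is exhibited, and all identities are checked on
  it. Uniqueness of the expansions transfers them to arbitrary data, as every limit that occurs is a
  product of numbers of modulus 1 up to sign.\<close>

theorem proposition7p4:
  fixes n :: nat
    and f :: "complex poly"
    and C :: "real \<Rightarrow> complex mat"
    and \<alpha> :: "real \<Rightarrow> int \<Rightarrow> complex"
    and z :: "nat \<Rightarrow> complex"
    and l :: "nat \<Rightarrow> real"
  assumes "n \<ge> 1"
    and flow: "hamiltonian_flow n (im_tr f) C"
    and verb: "\<And>t. verblunsky n (\<alpha> t)"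
    and cmv: "\<And>t. C t = cmv n (\<alpha> t)"
    and eigenvalues: "bij_betw z {1..n} (spectrum (C 0))"
    and rates: "\<And>k. k \<in> {1..n} \<Longrightarrow> l k = rate f (z k)"
    and ordered: "\<And>j k. 1 \<le> j \<Longrightarrow> j \<le> k \<Longrightarrow> k \<le> n \<Longrightarrow> l k \<le> l j"
    and distinct: "inj_on l {1..n}"
  shows "(\<exists>\<alpha>p \<alpha>m \<xi> \<zeta>. asymptotic_data n \<alpha> l \<alpha>p \<alpha>m \<xi> \<zeta>) \<and>
    (\<forall>\<alpha>p \<alpha>m \<xi> \<zeta>. asymptotic_data n \<alpha> l \<alpha>p \<alpha>m \<xi> \<zeta> \<longrightarrow>
      (\<forall>k\<in>{1..<n}. \<forall>t.
         \<alpha>p (int k - 1) * \<alpha>m (int n - int k - 1) = (-1) ^ n * (\<Prod>j=1..n. cnj (z j)) \<and>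
         (-1) ^ n * (\<Prod>j=1..n. cnj (z j)) = (-1) ^ n * Determinant.det (mat_adjoint (C t)) \<and>
         (-1) ^ n * Determinant.det (mat_adjoint (C t)) = - \<alpha> t (int n - 1)) \<and>
      (\<forall>k\<in>{1..<n}.
         \<xi> (k - 1) * \<zeta> (n - k - 1) = complex_of_real (
           (cmod (z (k + 1) - z k))\<^sup>2 *
           (\<Prod>i=1..k-1. (cmod ((z (k + 1) - z i) / (z k - z i)))\<^sup>2) *
           (\<Prod>m=k+2..n. (cmod ((z k - z m) / (z (k + 1) - z m)))\<^sup>2))) \<and>
      (\<forall>j\<in>{1..n}.
         z j = - \<alpha>p (int j - 2) / \<alpha>p (int j - 1) \<and>
         z j = - \<alpha>m (int n - int j - 1) / \<alpha>m (int n - int j))) \<and>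
    (\<forall>t. spectrum (C t) = z ` {1..n})"
proof -
  note ctx = \<open>n \<ge> 1\<close> flow verb cmv eigenvalues
  define \<mu> where "\<mu> = spectral_weight (C 0) {1..n} z"
  define z' where "z' = z \<circ> mirror n"
  define \<mu>' where "\<mu>' = \<mu> \<circ> mirror n"
  have l: "l j < l i" if "1 \<le> i" "i < j" "j \<le> n" for i j
    using ordered[of i j] inj_onD[OF distinct, of i j] that by force
  have inj: "inj_on z {1..n}" using eigenvalues by (simp add: bij_betw_def)
  have circ: "cmod (z j) = 1" if "j \<in> {1..n}" for j by (rule flow_circle[OF ctx that])
  have \<mu>: "\<mu> j > 0" if "j \<in> {1..n}" for j unfolding \<mu>_def by (rule flow_weight_0_pos[OF ctx that])
  have \<alpha>m1: "\<alpha> t (-1) = -1" for t using verb[of t] by (simp add: verblunsky_def)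
  have \<alpha>k: "\<alpha> t (int k) = (-1) ^ k * heine_coeff {1..n} \<mu> z l (Suc k) t" if "k < n" for t k
    unfolding \<mu>_def by (rule flow_verblunsky[OF ctx that rates])
  have circ': "cmod (z' j) = 1" if "j \<in> {1..n}" for j
  proof -
    have "mirror n j \<in> {1..n}" using that by (auto simp: mirror_def)
    then show ?thesis using circ by (simp add: z'_def)
  qed
  have data: "asymptotic_data n \<alpha> l (limit_coeff z) (limit_coeff z')
      (\<lambda>k. leading_correction \<mu> z (k + 1)) (\<lambda>k. leading_correction \<mu>' z' (k + 1))"
    unfolding z'_def \<mu>'_def by (rule asymptotic_data_heine[OF l inj circ \<mu> \<alpha>m1 \<alpha>k])
  have spec: "spectrum (C t) = z ` {1..n}" for t by (rule flow_spectrum[OF ctx])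
  have det: "Determinant.det (mat_adjoint (C t)) = (\<Prod>j=1..n. cnj (z j))" for t
    by (rule det_adjoint_unitary[OF flow_carrier[OF ctx] flow_unitary(1)[OF ctx]])
      (use inj in \<open>simp add: spec bij_betw_def\<close>)
  have last: "- \<alpha> t (int n - 1) = (-1) ^ n * (\<Prod>j=1..n. cnj (z j))" for t
  proof -
    obtain m where m: "n = Suc m" using \<open>n \<ge> 1\<close> by (cases n) auto
    have "heine_coeff {1..n} \<mu> z l n t = (\<Prod>j=1..n. cnj (z j))"
      using heine_coeff_full[of "{1..n}" z \<mu> l t] inj \<mu> by simp
    moreover have "\<alpha> t (int n - 1) = (-1) ^ m * heine_coeff {1..n} \<mu> z l n t"
      using \<alpha>k[of m t] by (simp add: m)
    ultimately show ?thesis by (simp add: m)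
  qed
  have "(\<forall>k\<in>{1..<n}. \<forall>t.
         \<alpha>p (int k - 1) * \<alpha>m (int n - int k - 1) = (-1) ^ n * (\<Prod>j=1..n. cnj (z j)) \<and>
         (-1) ^ n * (\<Prod>j=1..n. cnj (z j)) = (-1) ^ n * Determinant.det (mat_adjoint (C t)) \<and>
         (-1) ^ n * Determinant.det (mat_adjoint (C t)) = - \<alpha> t (int n - 1)) \<and>
      (\<forall>k\<in>{1..<n}.
         \<xi> (k - 1) * \<zeta> (n - k - 1) = complex_of_real (
           (cmod (z (k + 1) - z k))\<^sup>2 *
           (\<Prod>i=1..k-1. (cmod ((z (k + 1) - z i) / (z k - z i)))\<^sup>2) *
           (\<Prod>m=k+2..n. (cmod ((z k - z m) / (z (k + 1) - z m)))\<^sup>2))) \<and>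
      (\<forall>j\<in>{1..n}.
         z j = - \<alpha>p (int j - 2) / \<alpha>p (int j - 1) \<and>
         z j = - \<alpha>m (int n - int j - 1) / \<alpha>m (int n - int j))"
    if A: "asymptotic_data n \<alpha> l \<alpha>p \<alpha>m \<xi> \<zeta>" for \<alpha>p \<alpha>m \<xi> \<zeta>
  proof (intro conjI ballI allI)
    note unique = asymptotic_data_unique[OF A data]
    fix k t assume k: "k \<in> {1..<n}"
    show "\<alpha>p (int k - 1) * \<alpha>m (int n - int k - 1) = (-1) ^ n * (\<Prod>j=1..n. cnj (z j))"
      using unique(1)[of "int k - 1"] unique(2)[of "int n - int k - 1"] k
        limit_coeff_product[of k n z] by (simp add: z'_def)
    show "(-1) ^ n * (\<Prod>j=1..n. cnj (z j)) = (-1) ^ n * Determinant.det (mat_adjoint (C t))"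
      by (simp only: det)
    show "(-1) ^ n * Determinant.det (mat_adjoint (C t)) = - \<alpha> t (int n - 1)"
      by (simp only: det last)
  next
    note unique = asymptotic_data_unique[OF A data]
    fix k assume k: "k \<in> {1..<n}"
    have "\<xi> (k - 1) = leading_correction \<mu> z k"
      using unique(3)[OF k] limit_coeff_nonzero[of n z "int k - 1"] circ k by simp
    moreover have "\<zeta> (n - k - 1) = leading_correction \<mu>' z' (n - k)"
    proof -
      have nk: "n - k \<in> {1..<n}" and e: "n - k - 1 + 1 = n - k" using k by auto
      have "limit_coeff z' (int (n - k) - 1) \<noteq> 0"
        using k by (intro limit_coeff_nonzero[of n] circ') auto
      from unique(4)[OF nk this] show ?thesis unfolding e .
    qed
    ultimately show "\<xi> (k - 1) * \<zeta> (n - k - 1) = complex_of_real (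
           (cmod (z (k + 1) - z k))\<^sup>2 *
           (\<Prod>i=1..k-1. (cmod ((z (k + 1) - z i) / (z k - z i)))\<^sup>2) *
           (\<Prod>m=k+2..n. (cmod ((z k - z m) / (z (k + 1) - z m)))\<^sup>2))"
      using leading_correction_product[of n z \<mu> k, OF circ \<mu> k] by (simp only: z'_def \<mu>'_def)
  next
    note unique = asymptotic_data_unique[OF A data]
    fix j assume j: "j \<in> {1..n}"
    show "z j = - \<alpha>p (int j - 2) / \<alpha>p (int j - 1)"
      using limit_coeff_ratio[of n z j, OF circ j] unique(1)[of "int j - 2"] unique(1)[of "int j - 1"] j by simp
    \<comment> \<open>The formula at minus infinity is the one at plus infinity for the reversed
      labels, taken at the label that reversal assigns to j.\<close>
    have fj: "mirror n j \<in> {1..n}" and zj: "z' (mirror n j) = z j" using j by (auto simp: mirror_def z'_def)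
    have i: "int (mirror n j) - 2 = int n - int j - 1" "int (mirror n j) - 1 = int n - int j"
      using j by (auto simp: mirror_def of_nat_diff)
    show "z j = - \<alpha>m (int n - int j - 1) / \<alpha>m (int n - int j)"
      using limit_coeff_ratio[of n z' "mirror n j", OF circ' fj] unique(2)[of "int n - int j - 1"]
        unique(2)[of "int n - int j"] j unfolding i zj by simp
  qed
  then show ?thesis using data spec by blast
qed

end
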